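(* Let $G$ be a hypergraph with $\lambda(G) \geq 3$. Then $\chi(G) \leq \lambda(G) + 1$, and equality $\chi(G) = \lambda(G)+1$ holds if and only if $G$ has a block belonging to the class $\mathcal{H}_{\lambda(G)}$.
   Context: A hypergraph is a pair $G=(V,E)$ of finite sets with $E \subseteq 2^V$ and $|e|\ge 2$ for all $e\in E$ (no multiple edges). An edge with $|e|=2$ is ordinary (written $vw$), otherwise a hyperedge. A coloring of $G$ with color set $C$ is a map $\varphi:V(G)\to C$ such that every edge contains two vertices of different colors; $\chi(G)$ is the least $k$ admitting a coloring with color set $\{1,\dots,k\}$. Subhypergraphs: $V(G')\subseteq V(G)$, $E(G')\subseteq E(G)$. For $X\subseteq V(G)$, $G[X]$ has vertex set $X$ and all edges of $G$ contained in $X$. A $(v,w)$-hyperpath is a sequence $(v_1,e_1,v_2,\dots,e_{q-1},v_q)$ of distinct vertices and distinct edges with $v_1=v$, $v_q=w$, $\{v_i,v_{i+1}\}\subseteq e_i$. The local edge connectivity $\lambda_G(v,w)$ is the maximum number of pairwise edge-disjoint $(v,w)$-hyperpaths; $\lambda(G)=\max_{v\ne w}\lambda_G(v,w)$, and $\lambda(G)=0$ if $|V(G)|\le 1$. $G$ is connected if any two vertices are joined by a hyperpath. A set $S\subseteq V(G)$ is a separating vertex set if $G$ is the union of two induced subhypergraphs $G_1,G_2$ with $V(G_1)\cap V(G_2)=S$ and $|V(G_i)|>|S|$ for $i=1,2$; if $S=\{v\}$, $v$ is a separating vertex. A block of $G$ is a maximal connected subhypergraph of $G$ without a separating vertex.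 Hajós join: let $G_1,G_2$ be vertex-disjoint hypergraphs, $e_i\in E(G_i)$, $v_i\in e_i$. The hypergraph obtained by deleting $e_1,e_2$, identifying $v_1$ and $v_2$ into a new vertex $v^*$, and adding a new edge $e^*$ equal either to $(e_1\cup e_2)\setminus\{v_1,v_2\}$ or to $((e_1\cup e_2)\setminus\{v_1,v_2\})\cup\{v^*\}$, is a Hajós join $G=(G_1,v_1,e_1)\Delta(G_2,v_2,e_2)$ of $G_1$ and $G_2$. An odd wheel is the graph obtained from a cycle of odd length (ordinary edges) by adding one new vertex joined by ordinary edges to all cycle vertices. $\mathcal{H}_3$ is the smallest class of hypergraphs containing all odd wheels and closed under taking Hajós joins; for $k\ge 4$, $\mathcal{H}_k$ is the smallest class of hypergraphs containing the complete graph $K_{k+1}$ and closed under taking Hajós joins. *)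

theory Defs
  imports Main
begin

type_synonym 'a hgraph = "'a set \<times> 'a set set"

definition verts :: "'a hgraph \<Rightarrow> 'a set" where "verts G = fst G"
definition edges :: "'a hgraph \<Rightarrow> 'a set set" where "edges G = snd G"

definition hypergraph :: "'a hgraph \<Rightarrow> bool" where
  "hypergraph G \<longleftrightarrow> finite (verts G) \<and> edges G \<subseteq> Pow (verts G)
     \<and> (\<forall>e\<in>edges G. card e \<ge> 2)"

definition coloring :: "'a hgraph \<Rightarrow> ('a \<Rightarrow> 'c) \<Rightarrow> 'c set \<Rightarrow> bool" where
  "coloring G \<phi> C \<longleftrightarrow> (\<forall>v\<in>verts G. \<phi> v \<in> C)
     \<and> (\<forall>e\<in>edges G. \<exists>u\<in>e. \<exists>w\<in>e. \<phi> u \<noteq> \<phi> w)"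

definition chi :: "'a hgraph \<Rightarrow> nat" where
  "chi G = (LEAST k. \<exists>\<phi> :: 'a \<Rightarrow> nat. coloring G \<phi> {1..k})"

definition hyperpath :: "'a hgraph \<Rightarrow> 'a \<Rightarrow> 'a \<Rightarrow> 'a list \<Rightarrow> 'a set list \<Rightarrow> bool" where
  "hyperpath G v w vs es \<longleftrightarrow>
     vs \<noteq> [] \<and> length es + 1 = length vs \<and> distinct vs \<and> distinct es
     \<and> set vs \<subseteq> verts G \<and> set es \<subseteq> edges G
     \<and> hd vs = v \<and> last vs = w
     \<and> (\<forall>i < length es. {vs ! i, vs ! Suc i} \<subseteq> es ! i)"

definition local_lambda :: "'a hgraph \<Rightarrow> 'a \<Rightarrow> 'a \<Rightarrow> nat" where
  "local_lambda G v w = Max {k. \<exists>P :: ('a list \<times> 'a set list) list. length P = k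
      \<and> (\<forall>i < k. hyperpath G v w (fst (P ! i)) (snd (P ! i)))
      \<and> (\<forall>i < k. \<forall>j < k. i \<noteq> j \<longrightarrow> set (snd (P ! i)) \<inter> set (snd (P ! j)) = {})}"

definition lambda :: "'a hgraph \<Rightarrow> nat" where
  "lambda G = (if card (verts G) \<le> 1 then 0
     else Max {local_lambda G v w | v w. v \<in> verts G \<and> w \<in> verts G \<and> v \<noteq> w})"

definition connected_hg :: "'a hgraph \<Rightarrow> bool" where
  "connected_hg G \<longleftrightarrow> (\<forall>v\<in>verts G. \<forall>w\<in>verts G. \<exists>vs es. hyperpath G v w vs es)"

definition subhypergraph :: "'a hgraph \<Rightarrow> 'a hgraph \<Rightarrow> bool" where
  "subhypergraph H G \<longleftrightarrow> hypergraph H \<and> verts H \<subseteq> verts G \<and> edges H \<subseteq> edges G"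

definition induced :: "'a hgraph \<Rightarrow> 'a set \<Rightarrow> 'a hgraph" where
  "induced G X = (X, {e \<in> edges G. e \<subseteq> X})"

definition separating_set :: "'a hgraph \<Rightarrow> 'a set \<Rightarrow> bool" where
  "separating_set G S \<longleftrightarrow> (\<exists>V1 V2. V1 \<subseteq> verts G \<and> V2 \<subseteq> verts G
      \<and> V1 \<union> V2 = verts G \<and> V1 \<inter> V2 = S
      \<and> edges G = edges (induced G V1) \<union> edges (induced G V2)
      \<and> card V1 > card S \<and> card V2 > card S)"

definition separating_vertex :: "'a hgraph \<Rightarrow> 'a \<Rightarrow> bool" where
  "separating_vertex G v \<longleftrightarrow> separating_set G {v}"

definition no_sep_vertex :: "'a hgraph \<Rightarrow> bool" where
  "no_sep_vertex G \<longleftrightarrow> (\<nexists>v. separating_vertex G v)"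

definition is_block :: "'a hgraph \<Rightarrow> 'a hgraph \<Rightarrow> bool" where
  "is_block G B \<longleftrightarrow> subhypergraph B G \<and> connected_hg B \<and> no_sep_vertex B
     \<and> (\<forall>B'. subhypergraph B' G \<and> connected_hg B' \<and> no_sep_vertex B'
            \<and> verts B \<subseteq> verts B' \<and> edges B \<subseteq> edges B' \<longrightarrow> B' = B)"

definition iso_hg :: "'a hgraph \<Rightarrow> 'b hgraph \<Rightarrow> bool" where
  "iso_hg G H \<longleftrightarrow> (\<exists>f. bij_betw f (verts G) (verts H) \<and> edges H = (\<lambda>e. f ` e) ` edges G)"

text \<open>Hajos join: G1, G2 vertex-disjoint, e_i \<in> E(G_i), v_i \<in> e_i. The identified vertex
  v* is represented by v1 (v2 is renamed to v1). The flag b chooses whether v* is in e*.\<close>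

definition hajos_join :: "'a hgraph \<Rightarrow> 'a \<Rightarrow> 'a set \<Rightarrow> 'a hgraph \<Rightarrow> 'a \<Rightarrow> 'a set \<Rightarrow> bool \<Rightarrow> 'a hgraph" where
  "hajos_join G1 v1 e1 G2 v2 e2 b =
     (let r = (\<lambda>x. if x = v2 then v1 else x);
          estar = ((e1 \<union> e2) - {v1, v2}) \<union> (if b then {v1} else {})
      in (verts G1 \<union> r ` verts G2,
          (edges G1 - {e1}) \<union> (\<lambda>e. r ` e) ` (edges G2 - {e2}) \<union> {estar}))"

definition odd_wheel :: "nat \<Rightarrow> nat hgraph" where
  "odd_wheel n = ({0..n},
     {{i, Suc i} | i. 1 \<le> i \<and> i < n} \<union> {{n, 1}} \<union> {{0, i} | i. 1 \<le> i \<and> i \<le> n})"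

definition complete_graph :: "nat \<Rightarrow> nat hgraph" where
  "complete_graph m = ({0..<m}, {e. e \<subseteq> {0..<m} \<and> card e = 2})"

inductive_set hajos_class :: "nat \<Rightarrow> nat hgraph set" for k :: nat where
  wheel: "\<lbrakk>k = 3; odd n; n \<ge> 3\<rbrakk> \<Longrightarrow> odd_wheel n \<in> hajos_class k"
| complete: "k \<ge> 4 \<Longrightarrow> complete_graph (Suc k) \<in> hajos_class k"
| iso: "\<lbrakk>G \<in> hajos_class k; iso_hg G H\<rbrakk> \<Longrightarrow> H \<in> hajos_class k"
| join: "\<lbrakk>G1 \<in> hajos_class k; G2 \<in> hajos_class k; verts G1 \<inter> verts G2 = {};
          e1 \<in> edges G1; v1 \<in> e1; e2 \<in> edges G2; v2 \<in> e2\<rbrakk>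
         \<Longrightarrow> hajos_join G1 v1 e1 G2 v2 e2 b \<in> hajos_class k"

definition in_H :: "nat \<Rightarrow> 'a hgraph \<Rightarrow> bool" where
  "in_H k G \<longleftrightarrow> (\<exists>H \<in> hajos_class k. iso_hg G H)"

end

theory Submission
  imports Defs
begin

text \<open>
  Let \<open>k = \<lambda>(G)\<close>. By Menger's theorem any two vertices of \<open>G\<close> are separated by at most \<open>k\<close> edges,
  while every edge cut of a \<open>(k + 1)\<close>-critical hypergraph has at least \<open>k\<close> edges: otherwise some
  cyclic shift of the colours on one side glues colourings of the two sides together. This gives
  \<open>\<chi>(G) \<le> k + 1\<close>, and shows that a \<open>(k + 1)\<close>-critical subhypergraph \<open>H\<close> of \<open>G\<close> is a block of \<open>G\<close>, since a
  further path between two of its vertices would enlarge a cut of size \<open>k\<close>.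

  It remains to see that such an \<open>H\<close> is an odd wheel, a complete graph, or a Hajos join of two smaller
  ones, that is, that deleting some edge \<open>e\<close> creates a separating vertex \<open>v\<close>. If \<open>H\<close> has a cut of
  size \<open>k\<close> with at least two vertices on both sides, then one side \<open>X\<close> is such that every colouring
  of \<open>H[X]\<close> is constant on the set \<open>A\<close> of endpoints of the cut in \<open>X\<close>. The hypergraph \<open>H[X] + A\<close> is then
  smaller and of the same kind; either one of its splittings lifts to \<open>H\<close>, or it has two different
  ends each containing a single vertex of \<open>A\<close>, and uncrossing cuts shows that one of these vertices
  is on a single cut edge, which again splits \<open>H\<close>. If there is no such cut, then all vertices but one
  vertex \<open>h\<close> have degree \<open>k\<close>, and greedy colourings along paths and cycles avoiding \<open>h\<close>, as in
  Zajac's proof of Brooks' theorem, leave only wheels and complete graphs.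
\<close>

section \<open>Menger's theorem for edge-disjoint hyperpaths\<close>

text \<open>Local connectivity is used only through cuts, in the form \<open>low_conn\<close>:
  bounds on crossing edges pass to subhypergraphs, to the parts of a splitting and to
  \<open>H[X] + A\<close> by counting, whereas families of paths would have to be rerouted through
  the new edge each time. The obstacle is the new edge \<open>A\<close>. It is not an edge of
  \<open>H\<close> but stands for the ends of \<open>k\<close> cut edges in \<open>X\<close>, so a
  splitting of \<open>H[X] + A\<close> at \<open>A\<close> itself cannot be carried back. Instead
  the pieces are split again and again at the edge descending from \<open>A\<close> until all edges
  have size two. What remains is an end: a piece hanging at a hinge vertex and holding, off the
  hinge, one vertex \<open>w\<close> of \<open>A\<close>. In \<open>H\<close> this piece is attached
  by nothing but its hinge and the cut edges at \<open>w\<close>, so a single edge cuts it off if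
  \<open>w\<close> lies on one cut edge only. Of two vertices of \<open>A\<close> at most one can
  fail this. The descent stops only at hypergraphs with ordinary edges; for this reason the case
  without nontrivial cuts has to show that every edge has size two, and not just membership in the
  class.\<close>

definition walk :: "('n \<times> 'n) set \<Rightarrow> 'n set \<Rightarrow> 'n set \<Rightarrow> 'n list \<Rightarrow> bool" where
  "walk R A B p \<longleftrightarrow> p \<noteq> [] \<and> hd p \<in> A \<and> last p \<in> B \<and> successively (\<lambda>x y. (x, y) \<in> R) p"

definition separates :: "('n \<times> 'n) set \<Rightarrow> 'n set \<Rightarrow> 'n set \<Rightarrow> 'n set \<Rightarrow> bool" where
  "separates R A B W \<longleftrightarrow> (\<forall>p. walk R A B p \<longrightarrow> set p \<inter> W \<noteq> {})"

text \<open>The nodes will later be the edges of a hypergraph, so that node-disjoint walks become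
  edge-disjoint hyperpaths.\<close>

definition linked :: "('n \<times> 'n) set \<Rightarrow> 'n set \<Rightarrow> 'n set \<Rightarrow> nat \<Rightarrow> bool" where
  "linked R A B n \<longleftrightarrow> (\<exists>P. finite P \<and> card P = n \<and> (\<forall>p\<in>P. walk R A B p \<and> distinct p)
     \<and> (\<forall>p\<in>P. \<forall>q\<in>P. p \<noteq> q \<longrightarrow> set p \<inter> set q = {}))"

lemma successively_avoid_source:
  assumes "successively (\<lambda>x y. (x, y) \<in> R) (p @ [z])" "a \<notin> set p"
  shows "successively (\<lambda>x y. (x, y) \<in> R - {(a, b)}) (p @ [z])"
  using assms
proof (induction p)
  case (Cons c p)
  then show ?case by (cases p) auto
qed simp

lemma successively_avoid_target:
  assumes "successively (\<lambda>x y. (x, y) \<in> R) (z # p)" "b \<notin> set p"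
  shows "successively (\<lambda>x y. (x, y) \<in> R - {(a, b)}) (z # p)"
  using assms
proof (induction p arbitrary: z)
  case (Cons c p)
  then show ?case by (auto simp: successively_Cons)
qed auto

lemma walk_mono: "walk R A B p \<Longrightarrow> R \<subseteq> R' \<Longrightarrow> walk R' A B p"
  unfolding walk_def using successively_mono[of "\<lambda>x y. (x, y) \<in> R" p "\<lambda>x y. (x, y) \<in> R'"] by blast

lemma separates_insert_source:
  assumes "separates (R - {(a, b)}) A B S"
  shows "separates R A B (insert a S)"
  unfolding separates_def
proof (intro allI impI notI)
  fix p assume p: "walk R A B p" and e: "set p \<inter> insert a S = {}"
  from p have ne: "p \<noteq> []" by (simp add: walk_def)
  have "successively (\<lambda>x y. (x, y) \<in> R - {(a, b)}) (butlast p @ [last p])"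
    using p e ne in_set_butlastD[of a p] by (intro successively_avoid_source) (auto simp: walk_def)
  then have "walk (R - {(a, b)}) A B p" using p ne by (simp add: walk_def)
  then show False using assms e by (auto simp: separates_def)
qed

lemma separates_insert_target:
  assumes "separates (R - {(a, b)}) A B S"
  shows "separates R A B (insert b S)"
  unfolding separates_def
proof (intro allI impI notI)
  fix p assume p: "walk R A B p" and e: "set p \<inter> insert b S = {}"
  from p obtain x q where pq: "p = x # q" by (cases p) (auto simp: walk_def)
  have "successively (\<lambda>x y. (x, y) \<in> R - {(a, b)}) (x # q)"
    using p e pq by (intro successively_avoid_target) (auto simp: walk_def)
  then have "walk (R - {(a, b)}) A B p" using p pq by (simp add: walk_def)
  then show False using assms e by (auto simp: separates_def)
qed

text \<open>Stop a walk at its first node in \<open>insert a S\<close>: up to there it never leaves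
  \<open>a\<close>, so it survives the deletion of the arc \<open>(a, b)\<close>.\<close>

lemma separates_source_side:
  assumes "separates R A B (insert a S)" "separates (R - {(a, b)}) A (insert a S) W"
  shows "separates R A B W"
  unfolding separates_def
proof (intro allI impI)
  fix p assume p: "walk R A B p"
  then have "\<exists>z\<in>set p. z \<in> insert a S" using assms(1) by (auto simp: separates_def)
  then obtain p1 z p2 where s: "p = p1 @ z # p2" "z \<in> insert a S" "\<forall>y\<in>set p1. y \<notin> insert a S"
    using split_list_first_prop[of p "\<lambda>z. z \<in> insert a S"] by blast
  have "successively (\<lambda>x y. (x, y) \<in> R) ((p1 @ [z]) @ p2)" using p s by (simp add: walk_def)
  then have "successively (\<lambda>x y. (x, y) \<in> R) (p1 @ [z])" by (simp only: successively_append_iff)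
  then have "successively (\<lambda>x y. (x, y) \<in> R - {(a, b)}) (p1 @ [z])"
    using s by (intro successively_avoid_source) auto
  then have "walk (R - {(a, b)}) A (insert a S) (p1 @ [z])"
    using p s unfolding walk_def by (cases p1) auto
  then have "set (p1 @ [z]) \<inter> W \<noteq> {}" using assms(2) unfolding separates_def by blast
  then show "set p \<inter> W \<noteq> {}" using s by auto
qed

lemma separates_target_side:
  assumes "separates R A B (insert b S)" "separates (R - {(a, b)}) (insert b S) B W"
  shows "separates R A B W"
  unfolding separates_def
proof (intro allI impI)
  fix p assume p: "walk R A B p"
  then have "\<exists>z\<in>set p. z \<in> insert b S" using assms(1) by (auto simp: separates_def)
  then obtain p1 z p2 where s: "p = p1 @ z # p2" "z \<in> insert b S" "\<forall>y\<in>set p2. y \<notin> insert b S"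
    using split_list_last_prop[of p "\<lambda>z. z \<in> insert b S"] by blast
  have "successively (\<lambda>x y. (x, y) \<in> R) (p1 @ (z # p2))" using p s by (simp add: walk_def)
  then have "successively (\<lambda>x y. (x, y) \<in> R) (z # p2)" by (simp only: successively_append_iff)
  then have "successively (\<lambda>x y. (x, y) \<in> R - {(a, b)}) (z # p2)"
    using s by (intro successively_avoid_target) auto
  then have "walk (R - {(a, b)}) (insert b S) B (z # p2)"
    using p s unfolding walk_def by auto
  then have "set (z # p2) \<inter> W \<noteq> {}" using assms(2) unfolding separates_def by blast
  then show "set p \<inter> W \<noteq> {}" using s by auto
qed

text \<open>Pigeonhole: \<open>n\<close> disjoint walks with one marked node each in a set of size
  \<open>n\<close> use up this set, so no walk can meet it in a second node.\<close>

lemma linkage_ends_bij: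
  assumes "finite P" "card P = n" "card T = n" "finite T"
    and "\<And>p. p \<in> P \<Longrightarrow> f p \<in> set p \<and> f p \<in> T"
    and disj: "\<And>p q. p \<in> P \<Longrightarrow> q \<in> P \<Longrightarrow> p \<noteq> q \<Longrightarrow> set p \<inter> set q = {}"
  shows "bij_betw f P T" "\<And>p z. p \<in> P \<Longrightarrow> z \<in> set p \<Longrightarrow> z \<in> T \<Longrightarrow> z = f p"
proof -
  have inj: "inj_on f P"
  proof (rule inj_onI, rule ccontr)
    fix p q assume a: "p \<in> P" "q \<in> P" "f p = f q" "p \<noteq> q"
    then show False using assms(5)[of p] assms(5)[of q] disj[of p q] by auto
  qed
  have "f ` P = T"
    by (rule card_subset_eq) (use assms inj in \<open>auto simp: card_image\<close>)
  then show bij: "bij_betw f P T" using inj by (simp add: bij_betw_def)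
  fix p z assume p: "p \<in> P" "z \<in> set p" "z \<in> T"
  then obtain q where q: "q \<in> P" "z = f q" using \<open>f ` P = T\<close> by blast
  then show "z = f p" using assms(5)[of q] disj[of p q] p by blast
qed

text \<open>Induction on the number of arcs. If a set \<open>S\<close> of fewer than
  \<open>n\<close> nodes separates after the deletion of \<open>(x, y)\<close>, then
  \<open>insert x S\<close> and \<open>insert y S\<close> separate in \<open>R\<close> and have
  exactly \<open>n\<close> nodes. A linkage into the first and a linkage out of the second are
  joined along \<open>S\<close> and the arc \<open>(x, y)\<close>.\<close>

theorem menger:
  assumes "finite R" "finite A" "finite B"
    and "\<And>W. finite W \<Longrightarrow> separates R A B W \<Longrightarrow> n \<le> card W"
  shows "linked R A B n"
  using assms
proof (induction "card R" arbitrary: R A B rule: less_induct)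
  case less
  show ?case
  proof (cases "R = {}")
    case True
    have "separates R A B (A \<inter> B)"
      unfolding separates_def
    proof (intro allI impI)
      fix p assume p: "walk R A B p"
      then obtain x where "p = [x]" using True by (cases p rule: list.exhaust) (auto simp: walk_def successively_Cons)
      then show "set p \<inter> (A \<inter> B) \<noteq> {}" using p by (auto simp: walk_def)
    qed
    then have "n \<le> card (A \<inter> B)" using less.prems by auto
    then obtain S where S: "S \<subseteq> A \<inter> B" "card S = n" "finite S"
      using obtain_subset_with_card_n by blast
    have "card ((\<lambda>a. [a]) ` S) = n" using S by (simp add: card_image inj_on_def)
    then show ?thesis unfolding linked_def
      by (intro exI[of _ "(\<lambda>a. [a]) ` S"]) (use S in \<open>auto simp: walk_def\<close>)
  next
    case False
    then obtain x y where xy: "(x, y) \<in> R" by auto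
    define R' where "R' = R - {(x, y)}"
    have cR: "card R' < card R" "finite R'" "R' \<subseteq> R"
      unfolding R'_def using card_Diff1_less[OF less.prems(1) xy] less.prems(1) by (simp_all only: finite_Diff Diff_subset)
    show ?thesis
    proof (cases "\<forall>W. finite W \<longrightarrow> separates R' A B W \<longrightarrow> n \<le> card W")
      case True
      then have "linked R' A B n" by (intro less.hyps[OF cR(1,2)] less.prems(2,3)) auto
      then show ?thesis unfolding linked_def using walk_mono[OF _ cR(3)] by blast
    next
      case False
      then obtain S where S: "finite S" "separates R' A B S" "card S < n" by fastforce
      have sx: "separates R A B (insert x S)" using separates_insert_source S(2) unfolding R'_def by fast
      have sy: "separates R A B (insert y S)" using separates_insert_target S(2) unfolding R'_def by fast
      have "n \<le> card (insert x S)" "n \<le> card (insert y S)" using less.prems(4) sx sy S(1) by auto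
      then have xS: "x \<notin> S" "y \<notin> S" "card (insert x S) = n" "card (insert y S) = n"
        using S by (auto simp: card_insert_if split: if_splits)
      have "linked R' A (insert x S) n"
        using S(1) less.prems(2,4) separates_source_side[OF sx, of y, folded R'_def]
        by (intro less.hyps[OF cR(1,2)]) auto
      then obtain P where P: "finite P" "card P = n" "\<And>p. p \<in> P \<Longrightarrow> walk R' A (insert x S) p"
          "\<And>p. p \<in> P \<Longrightarrow> distinct p"
          "\<And>p q. p \<in> P \<Longrightarrow> q \<in> P \<Longrightarrow> p \<noteq> q \<Longrightarrow> set p \<inter> set q = {}"
        unfolding linked_def by blast
      have "linked R' (insert y S) B n"
        using S(1) less.prems(3,4) separates_target_side[OF sy, of x, folded R'_def]
        by (intro less.hyps[OF cR(1,2)]) auto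
      then obtain Q where Q: "finite Q" "card Q = n" "\<And>p. p \<in> Q \<Longrightarrow> walk R' (insert y S) B p"
          "\<And>p. p \<in> Q \<Longrightarrow> distinct p"
          "\<And>p q. p \<in> Q \<Longrightarrow> q \<in> Q \<Longrightarrow> p \<noteq> q \<Longrightarrow> set p \<inter> set q = {}"
        unfolding linked_def by blast
      have lastP: "bij_betw last P (insert x S)"
        "\<And>p z. p \<in> P \<Longrightarrow> z \<in> set p \<Longrightarrow> z \<in> insert x S \<Longrightarrow> z = last p"
        by (rule linkage_ends_bij[of P n "insert x S" last]; use P xS S(1) in \<open>simp add: walk_def\<close>)+
      have hdQ: "bij_betw hd Q (insert y S)"
        "\<And>p z. p \<in> Q \<Longrightarrow> z \<in> set p \<Longrightarrow> z \<in> insert y S \<Longrightarrow> z = hd p"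
        by (rule linkage_ends_bij[of Q n "insert y S" hd]; use Q xS S(1) in \<open>simp add: walk_def\<close>)+
      \<comment> \<open>Following \<open>p\<close> up to \<open>z\<close> and \<open>q\<close> from
        there on gives a walk without the arc \<open>(x, y)\<close>, which must meet
        \<open>S\<close>. As \<open>p\<close> meets \<open>insert x S\<close> only in its last node
        and \<open>q\<close> meets \<open>insert y S\<close> only in its first, the meeting point is
        \<open>z\<close> itself.\<close>
      have meet: "z = last p \<and> z = hd q \<and> z \<in> S"
        if pq: "p \<in> P" "q \<in> Q" "z \<in> set p" "z \<in> set q" for p q z
      proof -
        obtain p1 p2 where p: "p = p1 @ z # p2" using pq(3) split_list by metis
        obtain q1 q2 where q: "q = q1 @ z # q2" using pq(4) split_list by metis
        have "walk R' A B (p1 @ z # q2)"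
          using P(3)[OF pq(1)] Q(3)[OF pq(2)] unfolding p q walk_def
          by (cases q2) (auto simp: successively_append_iff hd_append split: if_splits)
        then obtain s where s: "s \<in> S" "s \<in> set p1 \<or> s = z \<or> s \<in> set q2"
          using S(2) unfolding separates_def by fastforce
        have "z = s"
          using s(2)
        proof (elim disjE)
          assume a: "s \<in> set p1"
          then have "s = last p" using lastP(2)[OF pq(1), of s] s(1) p by auto
          then have "s \<in> set (z # p2)" unfolding p by (metis last_appendR last_in_set list.distinct(1))
          then show ?thesis using a P(4)[OF pq(1)] p by auto
        next
          assume a: "s \<in> set q2"
          then have "s = hd q" using hdQ(2)[OF pq(2), of s] s(1) q by auto
          then have "s \<in> set (q1 @ [z])" unfolding q by (cases q1) auto
          then show ?thesis using a Q(4)[OF pq(2)] q by auto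
        qed simp
        then show ?thesis using s(1) lastP(2)[OF pq(1,3)] hdQ(2)[OF pq(2,4)] by auto
      qed
      \<comment> \<open>A walk ending in \<open>S\<close> is continued by the walk starting at the
        same node, whose first node is then dropped; the walk ending in \<open>x\<close> is
        continued through the arc by the walk starting at \<open>y\<close>, and nothing is
        dropped.\<close>
      define tgt where "tgt z = (if z = x then y else z)" for z
      define qq where "qq p = the_inv_into Q hd (tgt (last p))" for p
      define g where "g p = (if last p = x then p @ qq p else p @ tl (qq p))" for p
      have tgt: "tgt (last p) \<in> insert y S" if "p \<in> P" for p
        using P(3)[OF that] unfolding walk_def tgt_def by auto
      have qq: "qq p \<in> Q" "hd (qq p) = tgt (last p)" if "p \<in> P" for p
        using tgt[OF that] hdQ(1) unfolding qq_def bij_betw_def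
        by (auto simp: the_inv_into_into f_the_inv_into_f)
      have qne: "qq p \<noteq> []" if "p \<in> P" for p using Q(3)[OF qq(1)[OF that]] by (simp add: walk_def)
      have pne: "p \<noteq> []" if "p \<in> P" for p using P(3)[OF that] by (simp add: walk_def)
      have setg: "set (g p) = set p \<union> set (qq p)" if "p \<in> P" for p
      proof (cases "last p = x")
        case False
        then have "hd (qq p) \<in> set p" using qq(2)[OF that] pne[OF that] by (simp add: tgt_def)
        then show ?thesis using False qne[OF that] by (cases "qq p") (auto simp: g_def)
      qed (simp add: g_def)
      have qinj: "p = p'" if "p \<in> P" "p' \<in> P" "tgt (last p) = tgt (last p')" for p p'
      proof -
        have "last p \<in> insert x S" "last p' \<in> insert x S" using P(3) that by (auto simp: walk_def)
        then have "last p = last p'" using that(3) xS unfolding tgt_def by (auto split: if_splits)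
        then show ?thesis using lastP(1) that by (auto simp: bij_betw_def inj_on_def)
      qed
      have cross: "set p \<inter> set (qq p') = {}" if "p \<in> P" "p' \<in> P" "p \<noteq> p'" for p p'
      proof (rule ccontr)
        assume "set p \<inter> set (qq p') \<noteq> {}"
        then obtain z where "z \<in> set p" "z \<in> set (qq p')" by auto
        then have z: "z = last p" "z = hd (qq p')" "z \<in> S" using meet that qq by blast+
        then have "tgt (last p) = tgt (last p')" using xS qq(2)[OF that(2)] by (auto simp: tgt_def)
        then show False using qinj that by blast
      qed
      have disj: "set (g p) \<inter> set (g p') = {}" if "p \<in> P" "p' \<in> P" "p \<noteq> p'" for p p'
      proof -
        have "qq p \<noteq> qq p'" using qinj qq that by metis
        then have "set (qq p) \<inter> set (qq p') = {}" using Q(5) qq that by blast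
        then show ?thesis unfolding setg[OF that(1)] setg[OF that(2)]
          using P(5)[OF that] cross[OF that] cross[OF that(2,1) that(3)[symmetric]] by auto
      qed
      have walkg: "walk R A B (g p)" if "p \<in> P" for p
      proof (cases "last p = x")
        case True
        then show ?thesis
          using walk_mono[OF P(3)[OF that] cR(3)] walk_mono[OF Q(3)[OF qq(1)[OF that]] cR(3)] qq(2)[OF that] xy
          by (simp add: g_def walk_def successively_append_iff tgt_def)
      next
        case False
        have 1: "walk R A (insert x S) p" "walk R (insert y S) B (qq p)"
          using walk_mono[OF P(3)[OF that] cR(3)] walk_mono[OF Q(3)[OF qq(1)[OF that]] cR(3)] by auto
        have 2: "hd (qq p) = last p" using False qq(2)[OF that] by (simp add: tgt_def)
        show ?thesis
        proof (cases "qq p")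
          case (Cons a r)
          then show ?thesis using 1 2 False
            by (cases r) (auto simp: g_def walk_def successively_append_iff successively_Cons)
        qed (use qne[OF that] in auto)
      qed
      have distg: "distinct (g p)" if "p \<in> P" for p
      proof (cases "last p = x")
        case True
        then have "set p \<inter> set (qq p) = {}" using meet[OF that qq(1)[OF that]] xS by blast
        then show ?thesis using True P(4)[OF that] Q(4)[OF qq(1)[OF that]] by (simp add: g_def)
      next
        case False
        have "distinct (qq p)" using Q(4)[OF qq(1)[OF that]] .
        then have "set p \<inter> set (tl (qq p)) = {}" "distinct (tl (qq p))"
          using meet[OF that qq(1)[OF that]] by (cases "qq p"; fastforce)+
        then show ?thesis using False P(4)[OF that] by (simp add: g_def)
      qed
      have "inj_on g P"
      proof (rule inj_onI, rule ccontr)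
        fix p p' assume a: "p \<in> P" "p' \<in> P" "g p = g p'" "p \<noteq> p'"
        then have "set (g p) = {}" using disj[of p p'] by auto
        then show False using setg[OF a(1)] pne[OF a(1)] by auto
      qed
      then have "card (g ` P) = n" using P(2) by (simp add: card_image)
      moreover have "set q \<inter> set q' = {}" if "q \<in> g ` P" "q' \<in> g ` P" "q \<noteq> q'" for q q'
        using that disj by blast
      ultimately show ?thesis unfolding linked_def
        by (intro exI[of _ "g ` P"]) (use P(1) walkg distg in simp)
    qed
  qed
qed

text \<open>If a later edge contains \<open>s\<close>, the walk may start there. Otherwise no later
  edge contains \<open>s\<close>, and a path whose vertices lie in the later edges cannot return to
  \<open>s\<close>; the bound on \<open>set vs\<close> is carried along for this purpose.\<close>

lemma hyperpath_of_edge_walk: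
  assumes "hypergraph G" "es \<noteq> []" "set es \<subseteq> edges G" "distinct es" "s \<noteq> t"
    and "s \<in> hd es" "t \<in> last es" "successively (\<lambda>e f. e \<inter> f \<noteq> {}) es"
  shows "\<exists>vs es'. hyperpath G s t vs es' \<and> set es' \<subseteq> set es \<and> set vs \<subseteq> \<Union>(set es)"
  using assms
proof (induction "length es" arbitrary: es s rule: less_induct)
  case less
  obtain e r where es: "es = e # r" using less.prems(2) by (cases es) auto
  have eG: "e \<subseteq> verts G" using less.prems(1,3) unfolding hypergraph_def es by auto
  show ?case
  proof (cases "\<exists>f\<in>set r. s \<in> f")
    case True
    then obtain f r1 r2 where r: "r = r1 @ f # r2" "s \<in> f" by (meson split_list)
    have "\<exists>vs es'. hyperpath G s t vs es' \<and> set es' \<subseteq> set (f # r2) \<and> set vs \<subseteq> \<Union>(set (f # r2))"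
      by (rule less.hyps) (use less.prems r es in \<open>auto simp: successively_append_iff successively_Cons\<close>)
    then show ?thesis unfolding es r by (auto 0 4)
  next
    case s: False
    show ?thesis
    proof (cases "t \<in> e")
      case True
      have "hyperpath G s t [s, t] [e]"
        using True less.prems eG unfolding hyperpath_def es by auto
      then show ?thesis using True less.prems unfolding es
        by (intro exI[of _ "[s, t]"] exI[of _ "[e]"]) auto
    next
      case False
      then have rne: "r \<noteq> []" using less.prems(7) es by auto
      then obtain u where u: "u \<in> e" "u \<in> hd r" using less.prems(8) es by (auto simp: successively_Cons)
      have us: "u \<noteq> s" "u \<noteq> t" using s u rne False by auto
      have "\<exists>vs es'. hyperpath G u t vs es' \<and> set es' \<subseteq> set r \<and> set vs \<subseteq> \<Union>(set r)"
        by (rule less.hyps) (use less.prems es rne u us in \<open>auto simp: successively_Cons\<close>)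
      then obtain vs es' where h: "hyperpath G u t vs es'" "set es' \<subseteq> set r" "set vs \<subseteq> \<Union>(set r)" by blast
      obtain ws where vs: "vs = u # ws" using h(1) by (cases vs) (auto simp: hyperpath_def)
      have "hyperpath G s t (s # vs) (e # es')"
        unfolding hyperpath_def
      proof (intro conjI allI impI)
        show "distinct (s # vs)" using h s by (auto simp: hyperpath_def)
        show "distinct (e # es')" using h less.prems(4) es by (auto simp: hyperpath_def)
        show "{(s # vs) ! i, (s # vs) ! Suc i} \<subseteq> (e # es') ! i" if "i < length (e # es')" for i
          using that h(1) u less.prems(6) es vs by (cases i) (auto simp: hyperpath_def)
      qed (use h less.prems eG es vs in \<open>auto simp: hyperpath_def\<close>)
      then show ?thesis using h less.prems(6) es
        by (intro exI[of _ "s # vs"] exI[of _ "e # es'"]) auto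
    qed
  qed
qed

section \<open>Edge cuts and local edge connectivity\<close>

definition cut :: "'a hgraph \<Rightarrow> 'a set \<Rightarrow> 'a set set" where
  "cut H X = {e \<in> edges H. e \<inter> X \<noteq> {} \<and> \<not> e \<subseteq> X}"

lemma finite_edges: "hypergraph H \<Longrightarrow> finite (edges H)"
  unfolding hypergraph_def by (meson finite_Pow_iff finite_subset)

text \<open>Menger's theorem is applied to the line graph: nodes are the edges of \<open>H\<close>,
  arcs join intersecting edges. A set \<open>W\<close> of edges separating there contains the whole
  cut of some vertex set, and hence has at least \<open>n\<close> elements.\<close>

lemma hyperpaths_of_cuts:
  assumes H: "hypergraph H" and st: "s \<noteq> t" "s \<in> verts H"
    and big: "\<And>Z. Z \<subseteq> verts H \<Longrightarrow> s \<in> Z \<Longrightarrow> t \<notin> Z \<Longrightarrow> n \<le> card (cut H Z)"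
  shows "\<exists>P :: ('a list \<times> 'a set list) list. length P = n
      \<and> (\<forall>i < n. hyperpath H s t (fst (P ! i)) (snd (P ! i)))
      \<and> (\<forall>i < n. \<forall>j < n. i \<noteq> j \<longrightarrow> set (snd (P ! i)) \<inter> set (snd (P ! j)) = {})"
proof -
  define A where "A = {e \<in> edges H. s \<in> e}"
  define B where "B = {e \<in> edges H. t \<in> e}"
  define R where "R = {(e, f). e \<in> edges H \<and> f \<in> edges H \<and> e \<inter> f \<noteq> {}}"
  note fin = finite_edges[OF H]
  have "finite R" by (rule finite_subset[of _ "edges H \<times> edges H"]) (use fin in \<open>auto simp: R_def\<close>)
  moreover have "finite A" "finite B" using fin by (auto simp: A_def B_def)
  moreover have "n \<le> card W" if W: "finite W" "separates R A B W" for W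
  proof -
    \<comment> \<open>\<open>Z\<close> consists of \<open>s\<close> and all that is reached from
      \<open>s\<close> by edge sequences avoiding \<open>W\<close>. An edge crossing
      \<open>Z\<close> but not in \<open>W\<close> would be reachable too, and then lie inside
      \<open>Z\<close>.\<close>
    define Rc where "Rc = {e. \<exists>p. walk R A {e} p \<and> set p \<inter> W = {}}"
    define Z where "Z = insert s (\<Union>Rc)"
    have Rc: "e \<in> edges H" if e: "e \<in> Rc" for e
    proof -
      obtain p where p: "walk R A {e} p" using e by (auto simp: Rc_def)
      then show ?thesis
        by (cases p rule: rev_cases) (auto simp: walk_def A_def R_def successively_append_iff)
    qed
    have t: "t \<notin> Z"
    proof
      assume "t \<in> Z"
      then obtain e where e: "e \<in> Rc" "t \<in> e" using st by (auto simp: Z_def)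
      then have "e \<in> B" using Rc by (auto simp: B_def)
      then obtain p where "walk R A B p" "set p \<inter> W = {}" using e unfolding Rc_def walk_def by auto
      then show False using W(2) by (auto simp: separates_def)
    qed
    have "cut H Z \<subseteq> W"
    proof
      fix g assume g: "g \<in> cut H Z"
      show "g \<in> W"
      proof (rule ccontr)
        assume gW: "g \<notin> W"
        have "g \<in> Rc"
        proof (cases "s \<in> g")
          case True
          then show ?thesis using g gW unfolding Rc_def
            by (auto intro!: exI[of _ "[g]"] simp: walk_def A_def cut_def)
        next
          case False
          then obtain f where f: "f \<in> Rc" "f \<inter> g \<noteq> {}" using g by (auto simp: cut_def Z_def)
          then obtain p where p: "walk R A {f} p" "set p \<inter> W = {}" by (auto simp: Rc_def)
          have "walk R A {g} (p @ [g])"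
            using p(1) Rc[OF f(1)] f(2) g unfolding walk_def R_def
            by (auto simp: successively_append_iff cut_def)
          then show ?thesis using p(2) gW unfolding Rc_def by (auto intro!: exI[of _ "p @ [g]"])
        qed
        then show False using g by (auto simp: cut_def Z_def)
      qed
    qed
    moreover have "Z \<subseteq> verts H" using Rc H st unfolding Z_def hypergraph_def by blast
    ultimately show ?thesis using big[of Z] t W(1) card_mono[of W "cut H Z"] by (auto simp: Z_def)
  qed
  ultimately have "linked R A B n" by (rule menger)
  then obtain P where P: "finite P" "card P = n" "\<And>p. p \<in> P \<Longrightarrow> walk R A B p \<and> distinct p"
    "\<And>p q. p \<in> P \<Longrightarrow> q \<in> P \<Longrightarrow> p \<noteq> q \<Longrightarrow> set p \<inter> set q = {}"
    unfolding linked_def by blast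
  have "\<exists>h. hyperpath H s t (fst h) (snd h) \<and> set (snd h) \<subseteq> set p" if p: "p \<in> P" for p
  proof -
    have w: "walk R A B p" "distinct p" using P(3)[OF p] by auto
    have "set p \<subseteq> edges H"
    proof
      fix e assume "e \<in> set p"
      then obtain p1 p2 where "p = p1 @ e # p2" by (meson split_list)
      then show "e \<in> edges H" using w(1)
        by (cases p1) (auto simp: walk_def A_def successively_Cons successively_append_iff R_def hd_append split: if_splits)
    qed
    moreover have "successively (\<lambda>e f. e \<inter> f \<noteq> {}) p"
      using w(1) unfolding walk_def R_def by (elim conjE successively_mono) auto
    ultimately show ?thesis using hyperpath_of_edge_walk[OF H, of p s t] w st unfolding walk_def A_def B_def
      by fastforce
  qed
  then obtain h where h: "\<And>p. p \<in> P \<Longrightarrow> hyperpath H s t (fst (h p)) (snd (h p)) \<and> set (snd (h p)) \<subseteq> set p"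
    by metis
  obtain ps where ps: "set ps = P" "distinct ps" using finite_distinct_list[OF P(1)] by blast
  have "length ps = n" using ps P(2) distinct_card by force
  moreover have "ps ! i \<in> P" if "i < n" for i using that ps \<open>length ps = n\<close> by auto
  moreover have "ps ! i \<noteq> ps ! j" if "i < n" "j < n" "i \<noteq> j" for i j
    using that ps \<open>length ps = n\<close> by (simp add: nth_eq_iff_index_eq)
  ultimately have props: "length (map h ps) = n" "\<And>i. i < n \<Longrightarrow> map h ps ! i = h (ps ! i) \<and> ps ! i \<in> P"
    "\<And>i j. i < n \<Longrightarrow> j < n \<Longrightarrow> i \<noteq> j \<Longrightarrow> ps ! i \<noteq> ps ! j"
    by auto
  have "set (snd (h (ps ! i))) \<inter> set (snd (h (ps ! j))) = {}" if "i < n" "j < n" "i \<noteq> j" for i j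
    using h[of "ps ! i"] h[of "ps ! j"] P(4)[of "ps ! i" "ps ! j"] props(2,3) that by blast
  then show ?thesis using props h by (intro exI[of _ "map h ps"]) simp
qed

definition low_conn :: "'a hgraph \<Rightarrow> nat \<Rightarrow> bool" where
  "low_conn H k \<longleftrightarrow> (\<forall>v\<in>verts H. \<forall>w\<in>verts H. v \<noteq> w \<longrightarrow>
     (\<exists>Z. v \<in> Z \<and> w \<notin> Z \<and> card (cut H Z) \<le> k))"

lemma low_conn_lambda:
  assumes G: "hypergraph G"
  shows "low_conn G (lambda G)"
  unfolding low_conn_def
proof (intro ballI impI)
  fix v w assume vw: "v \<in> verts G" "w \<in> verts G" "v \<noteq> w"
  let ?n = "Suc (lambda G)"
  show "\<exists>Z. v \<in> Z \<and> w \<notin> Z \<and> card (cut G Z) \<le> lambda G"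
  proof (rule ccontr)
    assume "\<not> ?thesis"
    then have big: "?n \<le> card (cut G Z)" if "v \<in> Z" "w \<notin> Z" for Z using that by (meson not_less_eq_eq)
    let ?K = "{k. \<exists>P :: ('a list \<times> 'a set list) list. length P = k
      \<and> (\<forall>i < k. hyperpath G v w (fst (P ! i)) (snd (P ! i)))
      \<and> (\<forall>i < k. \<forall>j < k. i \<noteq> j \<longrightarrow> set (snd (P ! i)) \<inter> set (snd (P ! j)) = {})}"
    have "?n \<in> ?K" using hyperpaths_of_cuts[OF G vw(3,1), of ?n] big by blast
    \<comment> \<open>\<open>Max\<close> is only meaningful for a finite set. Disjoint hyperpaths
      between distinct vertices have distinct first edges, so their number is bounded by the number
      of edges.\<close>
    moreover have "?K \<subseteq> {..card (edges G)}"
    proof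
      fix k assume "k \<in> ?K"
      then obtain P :: "('a list \<times> 'a set list) list" where P:
        "\<And>i. i < k \<Longrightarrow> hyperpath G v w (fst (P ! i)) (snd (P ! i))"
        "\<And>i j. i < k \<Longrightarrow> j < k \<Longrightarrow> i \<noteq> j \<Longrightarrow> set (snd (P ! i)) \<inter> set (snd (P ! j)) = {}" by blast
      have hp: "snd (P ! i) \<noteq> [] \<and> set (snd (P ! i)) \<subseteq> edges G" if "i < k" for i
      proof -
        have "snd (P ! i) \<noteq> []"
        proof
          assume "snd (P ! i) = []"
          then have "length (fst (P ! i)) = 1" using P(1)[OF that] by (auto simp: hyperpath_def)
          then show False using P(1)[OF that] vw(3) by (auto simp: hyperpath_def length_Suc_conv)
        qed
        then show ?thesis using P(1)[OF that] by (auto simp: hyperpath_def)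
      qed
      let ?f = "\<lambda>i. hd (snd (P ! i))"
      have f: "?f i \<in> set (snd (P ! i))" if "i < k" for i using hp[OF that] by simp
      have "inj_on ?f {..<k}"
      proof (rule inj_onI, rule ccontr)
        fix i j assume a: "i \<in> {..<k}" "j \<in> {..<k}" "?f i = ?f j" "i \<noteq> j"
        then have "set (snd (P ! i)) \<inter> set (snd (P ! j)) = {}" using P(2) by auto
        then show False using f[of i] f[of j] a by auto
      qed
      moreover have "?f ` {..<k} \<subseteq> edges G" using hp f by blast
      ultimately have "card {..<k} \<le> card (edges G)" by (rule card_inj_on_le) (rule finite_edges[OF G])
      then show "k \<in> {..card (edges G)}" by simp
    qed
    then have "finite ?K" by (rule finite_subset) simp
    ultimately have 1: "?n \<le> local_lambda G v w" unfolding local_lambda_def by (rule Max_ge[rotated])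
    let ?L = "{local_lambda G v w | v w. v \<in> verts G \<and> w \<in> verts G \<and> v \<noteq> w}"
    have fV: "finite (verts G)" using G by (simp add: hypergraph_def)
    have "?L \<subseteq> (\<lambda>(v, w). local_lambda G v w) ` (verts G \<times> verts G)" by auto
    then have "finite ?L" using fV by (meson finite_SigmaI finite_imageI finite_subset)
    then have "local_lambda G v w \<le> Max ?L" using vw by (intro Max_ge) auto
    moreover have "\<not> card (verts G) \<le> 1"
      using vw fV card_le_Suc0_iff_eq[OF fV] by auto
    ultimately have "local_lambda G v w \<le> lambda G" by (simp add: lambda_def)
    then show False using 1 by simp
  qed
qed

section \<open>Critical hypergraphs and their edge cuts\<close>

definition monochr :: "('a \<Rightarrow> nat) \<Rightarrow> 'a set \<Rightarrow> bool" where
  "monochr \<phi> e \<longleftrightarrow> (\<forall>u\<in>e. \<forall>w\<in>e. \<phi> u = \<phi> w)"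

text \<open>Only edges inside \<open>D\<close> count, so this is a proper colouring of the
  hypergraph induced on \<open>D\<close>, and colourings can be grown vertex by vertex. Colours
  start at 0 to allow arithmetic modulo \<open>k\<close>.\<close>

definition pcol :: "'a hgraph \<Rightarrow> nat \<Rightarrow> 'a set \<Rightarrow> ('a \<Rightarrow> nat) \<Rightarrow> bool" where
  "pcol H k D \<phi> \<longleftrightarrow> (\<forall>v\<in>D. \<phi> v < k) \<and> (\<forall>e\<in>edges H. e \<subseteq> D \<longrightarrow> \<not> monochr \<phi> e)"

definition colorable :: "'a hgraph \<Rightarrow> nat \<Rightarrow> bool" where
  "colorable H k \<longleftrightarrow> (\<exists>\<phi>. pcol H k (verts H) \<phi>)"

text \<open>\<open>critical H k\<close> is what the literature calls \<open>(k + 1)\<close>-critical.\<close>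

definition critical :: "'a hgraph \<Rightarrow> nat \<Rightarrow> bool" where
  "critical H k \<longleftrightarrow> hypergraph H \<and> \<not> colorable H k
     \<and> (\<forall>e\<in>edges H. colorable (verts H, edges H - {e}) k) \<and> verts H \<subseteq> \<Union>(edges H)"

lemma verts_pair [simp]: "verts (V, E) = V" and edges_pair [simp]: "edges (V, E) = E"
  by (simp_all add: verts_def edges_def)

lemma hypergraphD:
  assumes "hypergraph H"
  shows "finite (verts H)" "finite (edges H)" "e \<in> edges H \<Longrightarrow> e \<subseteq> verts H"
    "e \<in> edges H \<Longrightarrow> 2 \<le> card e" "e \<in> edges H \<Longrightarrow> finite e" "e \<in> edges H \<Longrightarrow> e \<noteq> {}"
    "\<lbrakk>e \<in> edges H; e \<subseteq> {x}\<rbrakk> \<Longrightarrow> False"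
proof -
  show 1: "finite (verts H)" "finite (edges H)" using assms finite_edges[OF assms] by (auto simp: hypergraph_def)
  show 2: "e \<in> edges H \<Longrightarrow> e \<subseteq> verts H" "e \<in> edges H \<Longrightarrow> 2 \<le> card e"
    using assms by (auto simp: hypergraph_def)
  show 3: "e \<in> edges H \<Longrightarrow> finite e" using 1 2 finite_subset by blast
  show "e \<in> edges H \<Longrightarrow> e \<noteq> {}" using 2(2) by auto
  show "\<lbrakk>e \<in> edges H; e \<subseteq> {x}\<rbrakk> \<Longrightarrow> False" using 2(2) card_mono[of "{x}" e] by fastforce
qed

lemma pcol_subset: "pcol H k D \<phi> \<Longrightarrow> D' \<subseteq> D \<Longrightarrow> pcol H k D' \<phi>"
  unfolding pcol_def by blast

lemma monochr_cong: "(\<And>v. v \<in> e \<Longrightarrow> \<phi> v = \<psi> v) \<Longrightarrow> monochr \<phi> e \<longleftrightarrow> monochr \<psi> e"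
  unfolding monochr_def by (simp cong: ball_cong)

lemma monochrD: "monochr \<phi> e \<Longrightarrow> u \<in> e \<Longrightarrow> w \<in> e \<Longrightarrow> \<phi> u = \<phi> w"
  unfolding monochr_def by blast

lemma pcol_cong: "(\<And>v. v \<in> D \<Longrightarrow> \<phi> v = \<psi> v) \<Longrightarrow> pcol H k D \<phi> \<longleftrightarrow> pcol H k D \<psi>"
proof -
  assume a: "\<And>v. v \<in> D \<Longrightarrow> \<phi> v = \<psi> v"
  have "monochr \<phi> e \<longleftrightarrow> monochr \<psi> e" if "e \<subseteq> D" for e
    by (rule monochr_cong) (use a that in blast)
  then show ?thesis using a unfolding pcol_def by (metis (no_types))
qed

lemma pcol_permute:
  assumes "pcol H k D \<phi>" "bij_betw \<pi> {..<k} {..<k}"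
  shows "pcol H k D (\<pi> \<circ> \<phi>)"
proof -
  have "monochr \<phi> e" if "monochr (\<pi> \<circ> \<phi>) e" "e \<subseteq> D" for e
    unfolding monochr_def
  proof (intro ballI)
    fix u w assume "u \<in> e" "w \<in> e"
    moreover from this have "\<phi> u \<in> {..<k}" "\<phi> w \<in> {..<k}" using that(2) assms(1) by (auto simp: pcol_def)
    ultimately show "\<phi> u = \<phi> w" using inj_onD[OF bij_betw_imp_inj_on[OF assms(2)]] monochrD[OF that(1)] unfolding o_def by blast
  qed
  moreover have "\<pi> c < k" if "c < k" for c using assms(2) that by (auto simp: bij_betw_def)
  ultimately show ?thesis using assms(1) unfolding pcol_def by auto
qed

lemma criticalD:
  assumes "critical H k"
  shows "hypergraph H" "\<not> pcol H k (verts H) \<phi>" "\<lbrakk>v \<in> verts H\<rbrakk> \<Longrightarrow> \<exists>e\<in>edges H. v \<in> e"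
    "e \<in> edges H \<Longrightarrow> \<exists>\<phi>. pcol (verts H, edges H - {e}) k (verts H) \<phi>"
  using assms by (auto simp: critical_def colorable_def)

text \<open>An edge at a vertex outside \<open>D\<close> puts no condition on \<open>D\<close>, so a
  colouring of \<open>H\<close> without this edge will do.\<close>

lemma critical_proper:
  assumes "critical H k" "D \<subseteq> verts H" "D \<noteq> verts H"
  obtains \<phi> where "pcol H k D \<phi>"
proof -
  obtain x where x: "x \<in> verts H" "x \<notin> D" using assms by blast
  then obtain e where e: "e \<in> edges H" "x \<in> e" using criticalD(3)[OF assms(1)] by blast
  then obtain \<phi> where "pcol (verts H, edges H - {e}) k (verts H) \<phi>" using criticalD(4)[OF assms(1)] by blast
  then have "pcol H k D \<phi>" using x e assms(2) unfolding pcol_def by (simp, blast)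
  then show ?thesis using that by blast
qed

lemma critical_nonempty: "critical H k \<Longrightarrow> verts H \<noteq> {}"
proof
  assume c: "critical H k" and "verts H = {}"
  then have "edges H = {}" using hypergraphD(3,6)[OF criticalD(1)[OF c]] by blast
  then show False using criticalD(2)[OF c] \<open>verts H = {}\<close> by (simp add: pcol_def)
qed

section \<open>Permuting the colours on one side of an edge cut\<close>

lemma swap_perm:
  assumes "a < k" "b < k"
  shows "bij_betw (\<lambda>x. if x = a then b else if x = b then a else x) {..<k::nat} {..<k}"
  by (rule bij_betw_byWitness[where f' = "\<lambda>x. if x = a then b else if x = b then a else x"])
    (use assms in auto)

lemma perm_two_points:
  assumes "a < k" "b < k" "a' < k" "b' < k" "a \<noteq> b" "a' \<noteq> b'"
  obtains \<sigma> where "bij_betw \<sigma> {..<k::nat} {..<k}" "\<sigma> a = a'" "\<sigma> b = b'"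
proof -
  define s1 where "s1 x = (if x = a then a' else if x = a' then a else x)" for x
  define s2 where "s2 x = (if x = s1 b then b' else if x = b' then s1 b else x)" for x
  have 1: "bij_betw s1 {..<k} {..<k}" unfolding s1_def using swap_perm assms by blast
  have "s1 b < k" using assms by (simp add: s1_def)
  then have 2: "bij_betw s2 {..<k} {..<k}" unfolding s2_def using swap_perm assms by blast
  have "bij_betw (s2 \<circ> s1) {..<k} {..<k}" using 1 2 by (rule bij_betw_trans)
  moreover have "(s2 \<circ> s1) a = a'" "(s2 \<circ> s1) b = b'" using assms by (auto simp: s1_def s2_def)
  ultimately show ?thesis using that by blast
qed

lemma shift_perm:
  assumes "0 < k"
  shows "bij_betw (\<lambda>b. (b + s) mod k) {..<k::nat} {..<k}"
proof -
  have "inj_on (\<lambda>b. (b + s) mod k) {..<k}"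
  proof (rule inj_onI)
    fix x y assume xy: "x \<in> {..<k}" "y \<in> {..<k}" "(x + s) mod k = (y + s) mod k"
    have "(int x + int s) mod int k = (int y + int s) mod int k"
      using xy(3) by (metis of_nat_add zmod_int)
    then have "int x mod int k = int y mod int k" by (simp add: mod_eq_dvd_iff)
    then show "x = y" using xy by simp
  qed
  moreover from this have "(\<lambda>b. (b + s) mod k) ` {..<k} = {..<k}"
    by (intro card_subset_eq) (use assms in \<open>auto simp: card_image\<close>)
  ultimately show ?thesis by (simp add: bij_betw_def)
qed

lemma shift_unique:
  assumes "s < k" "t < k" "(b + s) mod k = (b + t) mod (k::nat)"
  shows "s = t"
proof -
  have "(s + b) mod k = (t + b) mod k" using assms(3) by (simp only: add.commute)
  then show ?thesis using inj_onD[OF bij_betw_imp_inj_on[OF shift_perm[of k b]], of s t] assms by simp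
qed

text \<open>The two colourings, the outer one permuted by \<open>\<pi>\<close>, cannot fit together,
  and edges inside either side are fine; so an edge of the cut is monochromatic.\<close>

lemma bad_edge:
  assumes "critical H k" "X \<subseteq> verts H" "pcol H k X \<phi>" "pcol H k (verts H - X) \<psi>"
    and "bij_betw \<pi> {..<k} {..<k}"
  shows "\<exists>e\<in>cut H X. \<exists>c. (\<forall>v\<in>e \<inter> X. \<phi> v = c) \<and> (\<forall>v\<in>e - X. \<pi> (\<psi> v) = c)"
proof -
  define \<chi> where "\<chi> v = (if v \<in> X then \<phi> v else (\<pi> \<circ> \<psi>) v)" for v
  have 1: "pcol H k X \<chi>" using assms(3) pcol_cong[of X \<chi> \<phi>] by (simp add: \<chi>_def)
  have 2: "pcol H k (verts H - X) \<chi>"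
    using pcol_permute[OF assms(4,5)] pcol_cong[of "verts H - X" \<chi> "\<pi> \<circ> \<psi>"] by (simp add: \<chi>_def)
  have "\<not> pcol H k (verts H) \<chi>" using criticalD(2)[OF assms(1)] .
  moreover have "\<chi> v < k" if "v \<in> verts H" for v using 1 2 that unfolding pcol_def by blast
  ultimately obtain e where e: "e \<in> edges H" "monochr \<chi> e" unfolding pcol_def by blast
  have eV: "e \<subseteq> verts H" "e \<noteq> {}" using hypergraphD[OF criticalD(1)[OF assms(1)]] e(1) by auto
  have "\<not> e \<subseteq> X" "\<not> e \<subseteq> verts H - X" using e 1 2 unfolding pcol_def by blast+
  then have "e \<in> cut H X" using e eV by (auto simp: cut_def)
  moreover obtain u where "u \<in> e" using eV by blast
  then have "\<forall>v\<in>e. \<chi> v = \<chi> u" using monochrD[OF e(2)] by blast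
  then have "(\<forall>v\<in>e \<inter> X. \<phi> v = \<chi> u) \<and> (\<forall>v\<in>e - X. \<pi> (\<psi> v) = \<chi> u)" by (auto simp: \<chi>_def)
  ultimately show ?thesis by blast
qed

text \<open>Each of the \<open>k\<close> cyclic shifts spoils some cut edge. If two shifts spoilt
  the same edge, a vertex of it outside \<open>X\<close> would receive the same colour under both,
  so the shifts would be equal. The preliminary permutation \<open>\<sigma>\<close> serves the tight
  case, where prescribed colours have to be matched first.\<close>

lemma cut_shifts:
  assumes "critical H k" "0 < k" "X \<subseteq> verts H" "pcol H k X \<phi>" "pcol H k (verts H - X) \<psi>"
    and \<sigma>: "bij_betw \<sigma> {..<k} {..<k}"
  shows "\<exists>g. inj_on g {..<k} \<and> g ` {..<k} \<subseteq> cut H X \<and>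
    (\<forall>s<k. \<exists>c. (\<forall>v\<in>g s \<inter> X. \<phi> v = c) \<and> (\<forall>v\<in>g s - X. (\<sigma> (\<psi> v) + s) mod k = c))"
proof -
  have "\<exists>e\<in>cut H X. \<exists>c. (\<forall>v\<in>e \<inter> X. \<phi> v = c) \<and> (\<forall>v\<in>e - X. (\<sigma> (\<psi> v) + s) mod k = c)" for s
    using bad_edge[OF assms(1,3-5) bij_betw_trans[OF \<sigma> shift_perm[OF assms(2), of s]]] by (simp add: o_def)
  then obtain g where g: "\<And>s. g s \<in> cut H X"
    "\<And>s. \<exists>c. (\<forall>v\<in>g s \<inter> X. \<phi> v = c) \<and> (\<forall>v\<in>g s - X. (\<sigma> (\<psi> v) + s) mod k = c)" by metis
  have "inj_on g {..<k}"
  proof (rule inj_onI)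
    fix s t assume st: "s \<in> {..<k}" "t \<in> {..<k}" "g s = g t"
    obtain u v where "u \<in> g s \<inter> X" "v \<in> g s - X" using g(1)[of s] by (auto simp: cut_def)
    then have "(\<sigma> (\<psi> v) + s) mod k = (\<sigma> (\<psi> v) + t) mod k" using g(2)[of s] g(2)[of t] st(3) by metis
    then show "s = t" using shift_unique st by auto
  qed
  then show ?thesis using g by blast
qed

lemma cut_ge:
  assumes "critical H k" "X \<subseteq> verts H" "X \<noteq> {}" "X \<noteq> verts H"
  shows "k \<le> card (cut H X)"
proof (cases "k = 0")
  case False
  obtain \<phi> where "pcol H k X \<phi>" using critical_proper[OF assms(1,2,4)] by blast
  moreover obtain \<psi> where "pcol H k (verts H - X) \<psi>"
    using critical_proper[OF assms(1), of "verts H - X"] assms by blast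
  ultimately obtain g where "inj_on g {..<k}" "g ` {..<k} \<subseteq> cut H X"
    using cut_shifts[OF assms(1) _ assms(2), of \<phi> \<psi> id] False bij_betw_id[of "{..<k}"] by blast
  moreover have "finite (cut H X)"
    using hypergraphD(2)[OF criticalD(1)[OF assms(1)]] by (auto simp: cut_def)
  ultimately show ?thesis using card_inj_on_le[of g "{..<k}" "cut H X"] by simp
qed simp

text \<open>With only \<open>k\<close> cut edges, the edges spoilt by the \<open>k\<close> shifts
  exhaust the cut. So each cut edge has one colour \<open>a e\<close> inside \<open>X\<close> and
  one colour \<open>b e\<close> outside, and each permutation \<open>\<sigma>\<close> satisfies
  \<open>\<sigma> (b e) = a e\<close> for exactly one edge, the one spoilt by the shift 0.\<close>

lemma tight_cut_pair:
  assumes crit: "critical H k" and k: "3 \<le> k" and X: "X \<subseteq> verts H" and card: "card (cut H X) = k"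
    and \<phi>: "pcol H k X \<phi>" and \<psi>: "pcol H k (verts H - X) \<psi>"
  shows "(monochr \<phi> (\<Union>e\<in>cut H X. e \<inter> X) \<and> (\<forall>c<k. \<exists>e\<in>cut H X. \<forall>u\<in>e - X. \<psi> u = c))
    \<or> (monochr \<psi> (\<Union>e\<in>cut H X. e - X) \<and> (\<forall>c<k. \<exists>e\<in>cut H X. \<forall>u\<in>e \<inter> X. \<phi> u = c))"
proof -
  let ?F = "cut H X"
  have fin: "finite ?F" using hypergraphD(2)[OF criticalD(1)[OF crit]] by (auto simp: cut_def)
  define a where "a e = \<phi> (SOME u. u \<in> e \<inter> X)" for e
  define b where "b e = \<psi> (SOME u. u \<in> e - X)" for e
  have someX: "(SOME u. u \<in> e \<inter> X) \<in> e \<inter> X" if "e \<in> ?F" for e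
    using that someI_ex[of "\<lambda>u. u \<in> e \<inter> X"] by (auto simp: cut_def)
  have someY: "(SOME u. u \<in> e - X) \<in> e - X" if "e \<in> ?F" for e
    using that someI_ex[of "\<lambda>u. u \<in> e - X"] by (auto simp: cut_def)
  have onto: "\<exists>g. g ` {..<k} = ?F \<and> inj_on g {..<k} \<and> (\<forall>s<k.
      (\<forall>v\<in>g s \<inter> X. \<phi> v = a (g s)) \<and> (\<forall>v\<in>g s - X. (\<sigma> (\<psi> v) + s) mod k = a (g s)))"
    if \<sigma>: "bij_betw \<sigma> {..<k} {..<k}" for \<sigma>
  proof -
    obtain g where g: "inj_on g {..<k}" "g ` {..<k} \<subseteq> ?F"
      "\<And>s. s < k \<Longrightarrow> \<exists>c. (\<forall>v\<in>g s \<inter> X. \<phi> v = c) \<and> (\<forall>v\<in>g s - X. (\<sigma> (\<psi> v) + s) mod k = c)"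
      proof -
      have "0 < k" using k by simp
      then show thesis using that cut_shifts[OF crit _ X \<phi> \<psi> \<sigma>] by blast
    qed
    have "g ` {..<k} = ?F" by (rule card_subset_eq) (use g card fin in \<open>auto simp: card_image\<close>)
    moreover have "(\<forall>v\<in>g s \<inter> X. \<phi> v = a (g s)) \<and> (\<forall>v\<in>g s - X. (\<sigma> (\<psi> v) + s) mod k = a (g s))"
      if s: "s < k" for s
    proof -
      have "(SOME u. u \<in> g s \<inter> X) \<in> g s \<inter> X" using someX[of "g s"] g(2) s by blast
      then show ?thesis using g(3)[OF s] unfolding a_def by metis
    qed
    ultimately show ?thesis using g(1) by blast
  qed
  have V: "e \<subseteq> verts H" if "e \<in> ?F" for e
    using that hypergraphD(3)[OF criticalD(1)[OF crit]] by (auto simp: cut_def)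
  have a: "\<phi> v = a e" if e: "e \<in> ?F" "v \<in> e \<inter> X" for e v
  proof -
    from onto[OF bij_betw_id] obtain g where g: "g ` {..<k} = ?F"
      "\<forall>s<k. (\<forall>v\<in>g s \<inter> X. \<phi> v = a (g s)) \<and> (\<forall>v\<in>g s - X. (id (\<psi> v) + s) mod k = a (g s))"
      by (elim exE conjE)
    obtain s where "s < k" "e = g s" using g(1) e(1) by blast
    then show ?thesis using g(2) e(2) by blast
  qed
  have b: "\<psi> v = b e" if e: "e \<in> ?F" "v \<in> e - X" for e v
  proof -
    from onto[OF bij_betw_id] obtain g where g: "g ` {..<k} = ?F"
      "\<forall>s<k. (\<forall>v\<in>g s \<inter> X. \<phi> v = a (g s)) \<and> (\<forall>v\<in>g s - X. (id (\<psi> v) + s) mod k = a (g s))"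
      by (elim exE conjE)
    obtain s where s: "s < k" "e = g s" using g(1) e(1) by blast
    let ?w = "SOME u. u \<in> e - X"
    have w: "?w \<in> e - X" by (rule someY[OF e(1)])
    have "(\<psi> u + s) mod k = a e" if "u \<in> e - X" for u using g(2) s that unfolding id_apply by blast
    then have "(s + \<psi> v) mod k = (s + \<psi> ?w) mod k"
      using e(2) w by (metis add.commute)
    moreover have "\<psi> v < k" "\<psi> ?w < k" using \<psi> V[OF e(1)] e(2) w unfolding pcol_def by blast+
    ultimately show ?thesis using shift_unique unfolding b_def by blast
  qed
  have ltk: "a e < k" "b e < k" if "e \<in> ?F" for e
    using someX[OF that] someY[OF that] V[OF that] X \<phi> \<psi> unfolding a_def b_def pcol_def by blast+
  \<comment> \<open>Every edge \<open>h\<close> with \<open>\<sigma> (b h) = a h\<close> is the one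
    spoilt by the shift 0, so two such edges cannot exist.\<close>
  have no: False if ef: "e \<in> ?F" "f \<in> ?F" "e \<noteq> f" and \<sigma>: "bij_betw \<sigma> {..<k} {..<k}"
    "\<sigma> (b e) = a e" "\<sigma> (b f) = a f" for e f \<sigma>
  proof -
    from onto[OF \<sigma>(1)] obtain g where g: "g ` {..<k} = ?F"
      "\<forall>s<k. (\<forall>v\<in>g s \<inter> X. \<phi> v = a (g s)) \<and> (\<forall>v\<in>g s - X. (\<sigma> (\<psi> v) + s) mod k = a (g s))"
      by (elim exE conjE)
    have "g 0 = h" if h: "h \<in> ?F" "\<sigma> (b h) = a h" for h
    proof -
      obtain s where s: "s < k" "h = g s" using g(1) h(1) by blast
      obtain w where w: "w \<in> h - X" using someY[OF h(1)] by blast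
      have "(a h + s) mod k = a h" using g(2) s w b[OF h(1) w] h(2) by metis
      then have "(a h + s) mod k = (a h + 0) mod k" using ltk(1)[OF h(1)] by simp
      then show ?thesis using shift_unique[of s k 0 "a h"] s k by auto
    qed
    then show False using ef \<sigma> by metis
  qed
  \<comment> \<open>If both coincidences hold or both fail, some permutation sends
    \<open>b e\<close> to \<open>a e\<close> and \<open>b f\<close> to \<open>a f\<close>
    simultaneously.\<close>
  have xor: "(a e = a f) \<noteq> (b e = b f)" if ef: "e \<in> ?F" "f \<in> ?F" "e \<noteq> f" for e f
  proof (cases "a e = a f")
    case True
    obtain \<sigma> where "bij_betw \<sigma> {..<k} {..<k}" "\<sigma> (b e) = a e"
      using swap_perm[of "b e" k "a e"] ltk[OF ef(1)] by fastforce
    then show ?thesis using no[OF ef, of \<sigma>] True by metis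
  next
    case False
    show ?thesis
    proof (cases "b e = b f")
      case False
      then obtain \<sigma> where "bij_betw \<sigma> {..<k} {..<k}" "\<sigma> (b e) = a e" "\<sigma> (b f) = a f"
        using perm_two_points[of "b e" k "b f" "a e" "a f"] ltk ef \<open>a e \<noteq> a f\<close> by metis
      then show ?thesis using no[OF ef] by blast
    qed (use False in simp)
  qed
  have surj: "\<exists>e\<in>?F. h e = c" if "inj_on h ?F" "\<And>e. e \<in> ?F \<Longrightarrow> h e < k" "c < k" for h :: "'a set \<Rightarrow> nat" and c
  proof -
    have "h ` ?F = {..<k}" by (rule card_subset_eq) (use that card in \<open>auto simp: card_image\<close>)
    then show ?thesis using that(3) by (metis imageE lessThan_iff)
  qed
  show ?thesis
  proof (cases "\<exists>e\<in>?F. \<exists>f\<in>?F. e \<noteq> f \<and> a e = a f")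
    case True
    then obtain e f where ef: "e \<in> ?F" "f \<in> ?F" "e \<noteq> f" "a e = a f" by blast
    \<comment> \<open>An edge \<open>g\<close> with another colour inside \<open>X\<close> would
      have \<open>b g = b e\<close> and \<open>b g = b f\<close>, and then \<open>e\<close> and
      \<open>f\<close> would agree on both sides.\<close>
    have aeq: "a g = a e" if "g \<in> ?F" for g using xor[OF that ef(1)] xor[OF that ef(2)] xor[OF ef(1-3)] ef by metis
    then have "inj_on b ?F" using xor by (metis inj_onI)
    then have "\<exists>e\<in>?F. b e = c" if "c < k" for c using surj[of b] ltk that by blast
    then have "\<forall>c<k. \<exists>e\<in>?F. \<forall>u\<in>e - X. \<psi> u = c" using b by fastforce
    moreover have "monochr \<phi> (\<Union>e\<in>?F. e \<inter> X)"
      unfolding monochr_def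
    proof (intro ballI)
      fix u w assume "u \<in> (\<Union>e\<in>?F. e \<inter> X)" "w \<in> (\<Union>e\<in>?F. e \<inter> X)"
      then obtain e1 e2 where "e1 \<in> ?F" "u \<in> e1 \<inter> X" "e2 \<in> ?F" "w \<in> e2 \<inter> X" by blast
      then show "\<phi> u = \<phi> w" using a[of e1 u] a[of e2 w] aeq by metis
    qed
    ultimately show ?thesis by blast
  next
    case False
    then have inj: "inj_on a ?F" by (metis inj_onI)
    have beq: "b e = b f" if "e \<in> ?F" "f \<in> ?F" for e f using xor[OF that] False that by metis
    have "\<exists>e\<in>?F. a e = c" if "c < k" for c using surj[of a] inj ltk that by blast
    then have "\<forall>c<k. \<exists>e\<in>?F. \<forall>u\<in>e \<inter> X. \<phi> u = c" using a by fastforce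
    moreover have "monochr \<psi> (\<Union>e\<in>?F. e - X)"
      unfolding monochr_def
    proof (intro ballI)
      fix u w assume "u \<in> (\<Union>e\<in>?F. e - X)" "w \<in> (\<Union>e\<in>?F. e - X)"
      then obtain e1 e2 where "e1 \<in> ?F" "u \<in> e1 - X" "e2 \<in> ?F" "w \<in> e2 - X" by blast
      then show "\<psi> u = \<psi> w" using b[of e1 u] b[of e2 w] beq by metis
    qed
    ultimately show ?thesis by blast
  qed
qed

lemma cut_compl:
  assumes "hypergraph H"
  shows "cut H (verts H - X) = cut H X"
  using hypergraphD(3)[OF assms] unfolding cut_def by blast

text \<open>For each pair of colourings \<open>tight_cut_pair\<close> tells which side is constant
  and which shows all colours. A single colouring cannot do both, since at least two colours exist;
  so one fixed colouring on each side decides the matter for all colourings.\<close>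

lemma tight_cut:
  assumes crit: "critical H k" and k: "3 \<le> k" and X: "X \<subseteq> verts H" "X \<noteq> {}" "X \<noteq> verts H"
    and card: "card (cut H X) = k"
  obtains Y where "Y = X \<or> Y = verts H - X" "cut H Y = cut H X"
    "\<And>\<phi>. pcol H k Y \<phi> \<Longrightarrow> monochr \<phi> (\<Union>e\<in>cut H Y. e \<inter> Y)"
    "\<And>\<psi> c. \<lbrakk>pcol H k (verts H - Y) \<psi>; c < k\<rbrakk> \<Longrightarrow> \<exists>e\<in>cut H Y. \<forall>u\<in>e - Y. \<psi> u = c"
proof -
  let ?F = "cut H X" and ?V = "verts H"
  note hyp = criticalD(1)[OF crit]
  have FV: "e - X = e \<inter> (?V - X)" "e \<inter> X = e - (?V - X)" if "e \<in> ?F" for e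
    using that hypergraphD(3)[OF hyp] by (auto simp: cut_def)
  obtain \<phi>0 where \<phi>0: "pcol H k X \<phi>0" using critical_proper[OF crit X(1,3)] by blast
  obtain \<psi>0 where \<psi>0: "pcol H k (?V - X) \<psi>0" using critical_proper[OF crit, of "?V - X"] X by blast
  note pair = tight_cut_pair[OF crit k X(1) card]
  have excl1: False if m: "monochr \<phi> (\<Union>e\<in>?F. e \<inter> X)" and r: "\<forall>c<k. \<exists>e\<in>?F. \<forall>u\<in>e \<inter> X. \<phi> u = c" for \<phi>
  proof -
    have "0 < k" "1 < k" using k by auto
    then obtain e f where ef: "e \<in> ?F" "\<forall>u\<in>e \<inter> X. \<phi> u = 0" "f \<in> ?F" "\<forall>u\<in>f \<inter> X. \<phi> u = 1" using r by meson
    then obtain u v where uv: "u \<in> e \<inter> X" "v \<in> f \<inter> X" by (fastforce simp: cut_def)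
    then have "\<phi> u = \<phi> v" using monochrD[OF m, of u v] ef by blast
    then show False using ef uv by simp
  qed
  have excl2: False if m: "monochr \<psi> (\<Union>e\<in>?F. e - X)" and r: "\<forall>c<k. \<exists>e\<in>?F. \<forall>u\<in>e - X. \<psi> u = c" for \<psi>
  proof -
    have "0 < k" "1 < k" using k by auto
    then obtain e f where ef: "e \<in> ?F" "\<forall>u\<in>e - X. \<psi> u = 0" "f \<in> ?F" "\<forall>u\<in>f - X. \<psi> u = 1" using r by meson
    then obtain u v where uv: "u \<in> e - X" "v \<in> f - X" by (fastforce simp: cut_def)
    then have "\<psi> u = \<psi> v" using monochrD[OF m, of u v] ef by blast
    then show False using ef uv by simp
  qed
  show ?thesis
  proof (cases "monochr \<phi>0 (\<Union>e\<in>?F. e \<inter> X)")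
    case True
    have R: "\<forall>c<k. \<exists>e\<in>?F. \<forall>u\<in>e - X. \<psi> u = c" if "pcol H k (?V - X) \<psi>" for \<psi>
      using pair[OF \<phi>0 that] excl1[OF True] by blast
    have M: "monochr \<phi> (\<Union>e\<in>?F. e \<inter> X)" if "pcol H k X \<phi>" for \<phi>
      using pair[OF that \<psi>0] excl2[of \<psi>0] R[OF \<psi>0] by blast
    show ?thesis by (rule that[of X]) (use R M in auto)
  next
    case False
    then have M0: "monochr \<psi>0 (\<Union>e\<in>?F. e - X)" using pair[OF \<phi>0 \<psi>0] by blast
    have R: "\<forall>c<k. \<exists>e\<in>?F. \<forall>u\<in>e \<inter> X. \<phi> u = c" if "pcol H k X \<phi>" for \<phi>
      using pair[OF that \<psi>0] excl2[OF M0] by blast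
    have M: "monochr \<psi> (\<Union>e\<in>?F. e - X)" if "pcol H k (?V - X) \<psi>" for \<psi>
      using pair[OF \<phi>0 that] excl1[of \<phi>0] R[OF \<phi>0] by blast
    have eq: "(\<Union>e\<in>?F. e - X) = (\<Union>e\<in>?F. e \<inter> (?V - X))" using FV(1) by blast
    have VV: "?V - (?V - X) = X" using X(1) by blast
    show ?thesis
    proof (rule that[of "?V - X"])
      show "monochr \<phi> (\<Union>e\<in>cut H (?V - X). e \<inter> (?V - X))" if "pcol H k (?V - X) \<phi>" for \<phi>
        using M[OF that] unfolding cut_compl[OF hyp] eq .
      show "\<exists>e\<in>cut H (?V - X). \<forall>u\<in>e - (?V - X). \<psi> u = c" if "pcol H k (?V - (?V - X)) \<psi>" "c < k" for \<psi> c
        using R[of \<psi>] that FV(2) unfolding cut_compl[OF hyp] VV by metis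
    qed (use cut_compl[OF hyp] in auto)
  qed
qed

section \<open>Submodularity of cuts, and adding an edge to an induced part\<close>

lemma card_cut_submodular:
  assumes "hypergraph H"
  shows "card (cut H (X \<inter> Z)) + card (cut H (X \<union> Z)) \<le> card (cut H X) + card (cut H Z)"
proof -
  have fin: "finite (edges H)" using hypergraphD(2)[OF assms] .
  have c: "card (cut H X) = (\<Sum>e\<in>edges H. if e \<inter> X \<noteq> {} \<and> \<not> e \<subseteq> X then 1 else 0)" for X
    unfolding cut_def using fin by (simp add: sum.If_cases Int_def)
  show ?thesis unfolding c sum.distrib[symmetric]
    by (rule sum_mono) auto
qed

definition glue :: "'a hgraph \<Rightarrow> 'a set \<Rightarrow> 'a set \<Rightarrow> 'a hgraph" where
  "glue H X A = (X, insert A {e \<in> edges H. e \<subseteq> X})"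

text \<open>\<open>mono\<close> makes \<open>H[X] + A\<close> uncolourable, \<open>del\<close> lets
  a colouring of \<open>H\<close> without \<open>f\<close> restrict to one of
  \<open>H[X] + A\<close> without \<open>f\<close>, and without \<open>A\<close> only a proper part
  of \<open>H\<close> is left. Splittings and tight cuts both supply these hypotheses.\<close>

lemma critical_glue:
  assumes crit: "critical H k" and X: "X \<subseteq> verts H" "X \<noteq> verts H" and A: "A \<subseteq> X" "2 \<le> card A"
    and mono: "\<And>\<phi>. pcol H k X \<phi> \<Longrightarrow> monochr \<phi> A"
    and del: "\<And>\<phi> f. \<lbrakk>f \<in> edges H; f \<subseteq> X; pcol (verts H, edges H - {f}) k (verts H) \<phi>\<rbrakk> \<Longrightarrow> \<not> monochr \<phi> A"
    and cov: "\<And>x. x \<in> X \<Longrightarrow> x \<notin> A \<Longrightarrow> \<exists>e\<in>edges H. e \<subseteq> X \<and> x \<in> e"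
  shows "critical (glue H X A) k" "A \<notin> edges H"
proof -
  note hyp = criticalD(1)[OF crit]
  obtain \<phi>0 where \<phi>0: "pcol H k X \<phi>0" using critical_proper[OF crit X] by blast
  show AE: "A \<notin> edges H" using mono[OF \<phi>0] \<phi>0 A unfolding pcol_def by blast
  have "colorable (X, insert A {e \<in> edges H. e \<subseteq> X} - {f}) k" if "f \<in> edges (glue H X A)" for f
  proof (cases "f = A")
    case True
    then show ?thesis unfolding colorable_def using \<phi>0 AE by (auto simp: pcol_def intro!: exI[of _ \<phi>0])
  next
    case False
    then have f: "f \<in> edges H" "f \<subseteq> X" using that by (auto simp: glue_def)
    then obtain \<phi> where \<phi>: "pcol (verts H, edges H - {f}) k (verts H) \<phi>" using criticalD(4)[OF crit] by blast
    have "pcol (X, insert A {e \<in> edges H. e \<subseteq> X} - {f}) k X \<phi>"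
      unfolding pcol_def
    proof (intro conjI ballI impI)
      fix e assume "e \<in> edges (X, insert A {e \<in> edges H. e \<subseteq> X} - {f})"
      then consider "e = A" | "e \<in> edges H - {f}" "e \<subseteq> verts H" using X by auto
      then show "\<not> monochr \<phi> e" using del[OF f \<phi>] \<phi> by cases (simp_all add: pcol_def)
    next
      show "\<phi> v < k" if "v \<in> X" for v using \<phi> X that unfolding pcol_def by blast
    qed
    then show ?thesis by (auto simp: colorable_def)
  qed
  moreover have "\<not> colorable (glue H X A) k"
  proof
    assume "colorable (glue H X A) k"
    then obtain \<phi> where \<phi>: "pcol (glue H X A) k X \<phi>" by (auto simp: colorable_def glue_def)
    then have "pcol H k X \<phi>" by (auto simp: pcol_def glue_def)
    then show False using mono \<phi> A by (auto simp: pcol_def glue_def)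
  qed
  moreover have "hypergraph (glue H X A)"
    using hyp X A finite_subset[of X "verts H"] unfolding hypergraph_def glue_def by auto
  moreover have "X \<subseteq> \<Union>(edges (glue H X A))" using cov unfolding glue_def by auto
  ultimately show "critical (glue H X A) k" unfolding critical_def by (simp add: glue_def)
qed

lemma verts_glue [simp]: "verts (glue H X A) = X" by (simp add: glue_def)

lemma edges_glue: "edges (glue H X A) = insert A {e \<in> edges H. e \<subseteq> X}" by (simp add: glue_def)

section \<open>Splitting at a vertex and an edge\<close>

text \<open>A Hajos join seen from its result: \<open>e\<close> is the new edge and \<open>v\<close>
  the identified vertex, which may or may not belong to \<open>e\<close>.\<close>

definition sep :: "'a hgraph \<Rightarrow> 'a \<Rightarrow> 'a set \<Rightarrow> 'a set \<Rightarrow> 'a set \<Rightarrow> bool" where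
  "sep H v e V1 V2 \<longleftrightarrow> e \<in> edges H \<and> V1 \<union> V2 = verts H \<and> V1 \<inter> V2 = {v}
     \<and> V1 \<noteq> {v} \<and> V2 \<noteq> {v} \<and> (\<forall>f\<in>edges H. f \<noteq> e \<longrightarrow> f \<subseteq> V1 \<or> f \<subseteq> V2)"

lemma sep_sym: "sep H v e V1 V2 \<Longrightarrow> sep H v e V2 V1"
  unfolding sep_def by blast

lemma sepD:
  assumes "sep H v e V1 V2"
  shows "e \<in> edges H" "V1 \<union> V2 = verts H" "V1 \<inter> V2 = {v}" "v \<in> V1" "v \<in> V2"
    "V1 \<subseteq> verts H" "V1 \<noteq> verts H" "V2 \<subseteq> verts H" "V2 \<noteq> verts H"
    "\<lbrakk>f \<in> edges H; f \<noteq> e\<rbrakk> \<Longrightarrow> f \<subseteq> V1 \<or> f \<subseteq> V2"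
  using assms unfolding sep_def by blast+

lemma pcolD:
  assumes "pcol H k D \<phi>"
  shows "x \<in> D \<Longrightarrow> \<phi> x < k" "\<lbrakk>e \<in> edges H; e \<subseteq> D\<rbrakk> \<Longrightarrow> \<not> monochr \<phi> e"
  using assms unfolding pcol_def by blast+

lemma pcol_failD:
  assumes "\<not> pcol H k D \<phi>" "\<And>x. x \<in> D \<Longrightarrow> \<phi> x < k"
  obtains f where "f \<in> edges H" "f \<subseteq> D" "monochr \<phi> f"
  using assms unfolding pcol_def by blast

text \<open>The union of two colourings that agree at \<open>v\<close> can be improper only at
  \<open>e\<close>.\<close>

lemma sep_combine:
  assumes crit: "critical H k" and s: "sep H v e V1 V2"
    and \<phi>: "pcol H k V1 \<phi>" and \<psi>: "pcol H k V2 \<psi>" and eq: "\<phi> v = \<psi> v"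
  shows "monochr (\<lambda>x. if x \<in> V1 then \<phi> x else \<psi> x) e" "\<not> e \<subseteq> V1" "\<not> e \<subseteq> V2"
proof -
  let ?\<chi> = "\<lambda>x. if x \<in> V1 then \<phi> x else \<psi> x"
  have 1: "pcol H k V1 ?\<chi>" using \<phi> pcol_cong[of V1 ?\<chi> \<phi>] by simp
  have "?\<chi> x = \<psi> x" if "x \<in> V2" for x using that s eq unfolding sep_def by auto
  then have 2: "pcol H k V2 ?\<chi>" using \<psi> pcol_cong[of V2 ?\<chi> \<psi>] by blast
  have "\<not> pcol H k (verts H) ?\<chi>" using criticalD(2)[OF crit] .
  moreover have "?\<chi> x < k" if "x \<in> verts H" for x
    using pcolD(1)[OF 1, of x] pcolD(1)[OF 2, of x] that sepD(2)[OF s] by blast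
  ultimately obtain f where f: "f \<in> edges H" "monochr ?\<chi> f" by (rule pcol_failD)
  then have n: "\<not> f \<subseteq> V1" "\<not> f \<subseteq> V2" using pcolD(2)[OF 1 f(1)] pcolD(2)[OF 2 f(1)] by blast+
  then have "f = e" using sepD(10)[OF s f(1)] by blast
  then show "monochr ?\<chi> e" "\<not> e \<subseteq> V1" "\<not> e \<subseteq> V2" using f n by auto
qed

lemma sep_colorings:
  assumes "critical H k" "sep H v e V1 V2"
  obtains \<phi> \<psi> where "pcol H k V1 \<phi>" "pcol H k V2 \<psi>"
proof -
  obtain \<phi> where "pcol H k V1 \<phi>" using critical_proper[OF assms(1) sepD(6,7)[OF assms(2)]] .
  moreover obtain \<psi> where "pcol H k V2 \<psi>" using critical_proper[OF assms(1) sepD(8,9)[OF assms(2)]] .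
  ultimately show ?thesis by (rule that)
qed

lemma align_coloring:
  assumes "pcol H k D \<psi>" "v \<in> D" "c < k"
  obtains \<psi>' where "pcol H k D \<psi>'" "\<psi>' v = c"
proof -
  have "\<psi> v < k" using assms by (auto simp: pcol_def)
  then show ?thesis using that[OF pcol_permute[OF assms(1) swap_perm[of "\<psi> v" k c]]] assms(3) by simp
qed

lemma sep_edge:
  assumes "critical H k" "sep H v e V1 V2"
  shows "\<not> e \<subseteq> V1" "\<not> e \<subseteq> V2" "e \<inter> V1 - {v} \<noteq> {}" "e \<inter> V2 - {v} \<noteq> {}"
proof -
  obtain \<phi> \<psi> where c: "pcol H k V1 \<phi>" "pcol H k V2 \<psi>" using sep_colorings[OF assms] .
  have v: "v \<in> V1" "v \<in> V2" using assms(2) unfolding sep_def by auto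
  then have "\<phi> v < k" using c by (auto simp: pcol_def)
  then obtain \<psi>' where "pcol H k V2 \<psi>'" "\<psi>' v = \<phi> v" using align_coloring[OF c(2) v(2)] by blast
  then show 1: "\<not> e \<subseteq> V1" "\<not> e \<subseteq> V2" using sep_combine(2,3)[OF assms c(1)] by auto
  have "e \<subseteq> V1 \<union> V2"
    using hypergraphD(3)[OF criticalD(1)[OF assms(1)] sepD(1)[OF assms(2)]] sepD(2)[OF assms(2)] by simp
  then show "e \<inter> V1 - {v} \<noteq> {}" "e \<inter> V2 - {v} \<noteq> {}" using 1 v by blast+
qed

text \<open>Suppose that \<open>e\<close> has a colour in \<open>V1\<close> other than that of
  \<open>v\<close>. Then the colours on \<open>V2\<close> can be permuted so that \<open>v\<close>
  keeps its colour while the vertices of \<open>e\<close> in \<open>V2\<close> move to a third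
  colour, and \<open>e\<close> is no longer monochromatic. This takes three colours.\<close>

lemma sep_monochr:
  assumes crit: "critical H k" and k: "3 \<le> k" and s: "sep H v e V1 V2" and \<phi>: "pcol H k V1 \<phi>"
  shows "monochr \<phi> (insert v (e \<inter> V1))"
proof (rule ccontr)
  assume nm: "\<not> ?thesis"
  obtain \<psi>0 where \<psi>0: "pcol H k V2 \<psi>0" using sep_colorings[OF crit s] by blast
  have v: "v \<in> V1" "v \<in> V2" using s unfolding sep_def by blast+
  have vk: "\<phi> v < k" using \<phi> v by (auto simp: pcol_def)
  obtain \<psi> where \<psi>: "pcol H k V2 \<psi>" "\<psi> v = \<phi> v" using align_coloring[OF \<psi>0 v(2) vk] by blast
  obtain a where a: "a \<in> e \<inter> V1" using sep_edge(3)[OF crit s] by blast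
  obtain b where b: "b \<in> e \<inter> V2 - {v}" using sep_edge(4)[OF crit s] by blast
  then have bV1: "b \<notin> V1" using s unfolding sep_def by blast
  have m: "\<phi> x = \<psi>' b" if "pcol H k V2 \<psi>'" "\<psi>' v = \<phi> v" "x \<in> e \<inter> V1" for \<psi>' x
    using monochrD[OF sep_combine(1)[OF crit s \<phi> that(1) that(2)[symmetric]], of x b] that(3) b bV1 by auto
  have ne: "\<phi> a \<noteq> \<phi> v"
  proof
    assume "\<phi> a = \<phi> v"
    then have "\<phi> x = \<phi> v" if "x \<in> insert v (e \<inter> V1)" for x using m[OF \<psi>] a that by auto
    then show False using nm unfolding monochr_def by metis
  qed
  have ak: "\<phi> a < k" using a \<phi> by (auto simp: pcol_def)
  have "card {\<phi> a, \<phi> v} < card {..<k}" using k ne by simp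
  then obtain c where c: "c < k" "c \<noteq> \<phi> a" "c \<noteq> \<phi> v"
    using card_mono[of "{\<phi> a, \<phi> v}" "{..<k}"] by fastforce
  obtain \<pi> where \<pi>: "bij_betw \<pi> {..<k} {..<k}" "\<pi> (\<phi> a) = c" "\<pi> (\<phi> v) = \<phi> v"
    using perm_two_points[OF ak vk c(1) vk ne c(3)] by blast
  have "\<phi> a = (\<pi> \<circ> \<psi>) b" using m[OF pcol_permute[OF \<psi>(1) \<pi>(1)]] a \<pi>(3) \<psi>(2) by simp
  moreover have "\<psi> b = \<phi> a" using m[OF \<psi>] a by simp
  ultimately show False using \<pi>(2) c by simp
qed

lemma sep_parts:
  assumes crit: "critical H k" and k: "3 \<le> k" and s: "sep H v e V1 V2"
  shows "critical (glue H V1 (insert v (e \<inter> V1))) k" "insert v (e \<inter> V1) \<notin> edges H"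
proof -
  note hyp = criticalD(1)[OF crit]
  let ?A = "insert v (e \<inter> V1)" and ?B = "insert v (e \<inter> V2)"
  note V = sepD(6,7,4)[OF s]
  have eE: "e \<in> edges H" "e \<subseteq> V1 \<union> V2"
    using sepD(1,2)[OF s] hypergraphD(3)[OF hyp sepD(1)[OF s]] by simp_all
  obtain a where a: "a \<in> e \<inter> V1 - {v}" using sep_edge(3)[OF crit s] by blast
  then have "card {a, v} \<le> card ?A"
    using hypergraphD(5)[OF hyp eE(1)] by (intro card_mono) auto
  then have 2: "2 \<le> card ?A" using a by simp
  \<comment> \<open>\<open>f\<close> is not an edge inside \<open>V2\<close>, so
    \<open>\<phi>\<close> is still proper there and constant on \<open>?B\<close>. Were it constant
    on \<open>?A\<close> too, it would be constant on all of \<open>e\<close>.\<close>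
  have del: "\<not> monochr \<phi> ?A"
    if f: "f \<in> edges H" "f \<subseteq> V1" and \<phi>: "pcol (verts H, edges H - {f}) k (verts H) \<phi>" for f \<phi>
  proof
    assume m: "monochr \<phi> ?A"
    have fe: "f \<noteq> e" using f sep_edge(1)[OF crit s] by blast
    have "\<not> f \<subseteq> V2" using f hypergraphD(7)[OF hyp f(1), of v] sepD(3)[OF s] by blast
    then have "pcol H k V2 \<phi>" using \<phi> sepD(8)[OF s] unfolding pcol_def by auto
    then have m2: "monochr \<phi> ?B" using sep_monochr[OF crit k sep_sym[OF s]] by blast
    have "\<phi> x = \<phi> v" if "x \<in> e" for x
      using that eE(2) monochrD[OF m, of x v] monochrD[OF m2, of x v] by blast
    then have "monochr \<phi> e" unfolding monochr_def by simp
    then show False using \<phi> fe eE(1) hypergraphD(3)[OF hyp eE(1)] unfolding pcol_def by auto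
  qed
  have cov: "\<exists>f\<in>edges H. f \<subseteq> V1 \<and> x \<in> f" if x: "x \<in> V1" "x \<notin> ?A" for x
  proof -
    obtain f where "f \<in> edges H" "x \<in> f" using criticalD(3)[OF crit, of x] x V by blast
    moreover from this have "f \<noteq> e" "\<not> f \<subseteq> V2" using x sepD(3)[OF s] by blast+
    ultimately show ?thesis using sepD(10)[OF s] by blast
  qed
  show "critical (glue H V1 ?A) k" "?A \<notin> edges H"
    using critical_glue[OF crit V(1,2) _ 2 sep_monochr[OF crit k s] del cov] V by auto
qed

lemma finite_cut: "hypergraph H \<Longrightarrow> finite (cut H Z)"
  using hypergraphD(2)[of H] by (auto simp: cut_def)

text \<open>The glued edge \<open>A\<close> may add one to the cut. It is paid for by a crossing
  edge \<open>g\<close> of \<open>H\<close> that is not contained in \<open>X\<close> and therefore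
  disappears.\<close>

lemma card_cut_glue_le:
  assumes H: "hypergraph H" and AX: "A \<subseteq> X"
    and g: "\<lbrakk>A \<inter> Z \<noteq> {}; \<not> A \<subseteq> Z\<rbrakk> \<Longrightarrow> \<exists>g\<in>cut H Z. \<not> g \<subseteq> X"
  shows "card (cut (glue H X A) (Z \<inter> X)) \<le> card (cut H Z)"
proof (cases "A \<inter> Z \<noteq> {} \<and> \<not> A \<subseteq> Z")
  case True
  then obtain g where g: "g \<in> cut H Z" "\<not> g \<subseteq> X" using assms(3) by blast
  have "card (cut (glue H X A) (Z \<inter> X)) \<le> card (insert A (cut H Z - {g}))"
    by (rule card_mono) (use finite_cut[OF H] g in \<open>auto simp: cut_def edges_glue\<close>)
  also have "\<dots> \<le> Suc (card (cut H Z - {g}))" using finite_cut[OF H] by (simp add: card_insert_if)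
  also have "\<dots> = card (cut H Z)" using g finite_cut[OF H] by (metis card_Suc_Diff1)
  finally show ?thesis .
next
  case False
  then show ?thesis using AX by (intro card_mono finite_cut[OF H]) (auto simp: cut_def edges_glue)
qed

lemma sep_low_conn:
  assumes crit: "critical H k" and k: "3 \<le> k" and s: "sep H v e V1 V2" and low: "low_conn H k"
  shows "low_conn (glue H V1 (insert v (e \<inter> V1))) k"
  unfolding low_conn_def verts_glue
proof (intro ballI impI)
  fix p q assume pq: "p \<in> V1" "q \<in> V1" "p \<noteq> q"
  note hyp = criticalD(1)[OF crit]
  let ?A = "insert v (e \<inter> V1)" and ?B = "insert v (e \<inter> V2)"
  note V = sepD(6,4,5,3,1)[OF s]
  have *: "card (cut (glue H V1 ?A) (Z \<inter> V1)) \<le> k" if Z: "v \<notin> Z" "card (cut H Z) \<le> k" for Z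
  proof -
    \<comment> \<open>If \<open>e\<close> crosses \<open>Z\<close>, it pays for the new edge. If
      \<open>e \<subseteq> Z\<close>, then \<open>Z\<close> also cuts the other part, since
      \<open>v\<close> is outside; that part is critical, so besides its own new edge an edge of
      \<open>H\<close> inside \<open>V2\<close> crosses \<open>Z\<close>.\<close>
    have "\<exists>g\<in>cut H Z. \<not> g \<subseteq> V1" if AZ: "?A \<inter> Z \<noteq> {}"
    proof (cases "e \<subseteq> Z")
      case False
      then have "e \<in> cut H Z" using AZ Z(1) V(5) by (auto simp: cut_def)
      then show ?thesis using sep_edge(1)[OF crit s] by blast
    next
      case True
      obtain u where u: "u \<in> e \<inter> V2 - {v}" using sep_edge(4)[OF crit s] by blast
      have "k \<le> card (cut (glue H V2 ?B) (Z \<inter> V2))"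
        by (rule cut_ge[OF sep_parts(1)[OF crit k sep_sym[OF s]]]) (use Z(1) V(3) u True in auto)
      then have "\<not> cut (glue H V2 ?B) (Z \<inter> V2) \<subseteq> {?B}"
        using k card_mono[of "{?B}" "cut (glue H V2 ?B) (Z \<inter> V2)"] by auto
      then obtain g where g: "g \<in> edges H" "g \<subseteq> V2" "g \<in> cut H Z"
        by (auto simp: cut_def edges_glue)
      then have "\<not> g \<subseteq> V1" using hypergraphD(7)[OF hyp g(1), of v] V(4) by blast
      then show ?thesis using g by blast
    qed
    then show ?thesis using card_cut_glue_le[OF hyp, of ?A V1 Z] V(2) Z(2) by fastforce
  qed
  obtain Z where Z: "p \<in> Z" "q \<notin> Z" "card (cut H Z) \<le> k"
    using low pq V(1) unfolding low_conn_def by blast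
  show "\<exists>Z. p \<in> Z \<and> q \<notin> Z \<and> card (cut (glue H V1 ?A) Z) \<le> k"
  proof (cases "v \<in> Z")
    case False
    then show ?thesis using *[OF False Z(3)] Z pq by (intro exI[of _ "Z \<inter> V1"]) auto
  next
    case True
    let ?Y = "verts H - Z"
    have h: "hypergraph (glue H V1 ?A)" by (rule criticalD(1)[OF sep_parts(1)[OF crit k s]])
    have "card (cut (glue H V1 ?A) (?Y \<inter> V1)) \<le> k" using *[of ?Y] True Z(3) cut_compl[OF hyp] by simp
    moreover have "V1 - Z \<inter> V1 = ?Y \<inter> V1" using V(1) by blast
    ultimately have "card (cut (glue H V1 ?A) (Z \<inter> V1)) \<le> k"
      using cut_compl[OF h, of "Z \<inter> V1"] by simp
    then show ?thesis using Z pq by (intro exI[of _ "Z \<inter> V1"]) auto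
  qed
qed

section \<open>Nontrivial tight cuts\<close>

lemma sepI:
  assumes "e \<in> edges H" "V1 \<union> V2 = verts H" "V1 \<inter> V2 = {v}" "a \<in> V1" "a \<noteq> v" "b \<in> V2" "b \<noteq> v"
    and "\<And>f. \<lbrakk>f \<in> edges H; f \<noteq> e\<rbrakk> \<Longrightarrow> f \<subseteq> V1 \<or> f \<subseteq> V2"
  shows "sep H v e V1 V2"
  using assms unfolding sep_def by auto

lemma sep_other:
  assumes "sep H v e V1 V2"
  obtains a b where "a \<in> V1" "a \<noteq> v" "b \<in> V2" "b \<noteq> v"
proof -
  have "V1 \<noteq> {v}" "v \<in> V1" "V2 \<noteq> {v}" "v \<in> V2" using assms unfolding sep_def by auto
  then have "\<exists>a\<in>V1. a \<noteq> v" "\<exists>b\<in>V2. b \<noteq> v" by blast+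
  then show ?thesis using that by blast
qed

text \<open>The edge that replaces \<open>A\<close> in the part lies within \<open>W1\<close> and
  contains the hinge \<open>u\<close>, so all of \<open>U1\<close> can be put on the side of
  \<open>W1\<close>.\<close>

lemma glue_sep_lift:
  assumes G: "hypergraph G" and s: "sep G u A U1 U2"
    and s': "sep (glue G U2 (insert u (A \<inter> U2))) u' f' W1 W2"
    and f': "f' \<noteq> insert u (A \<inter> U2)" and in1: "insert u (A \<inter> U2) \<subseteq> W1"
  shows "sep G u' f' (W1 \<union> U1) W2" "f' \<in> edges G" "f' \<subseteq> U2"
proof -
  show f: "f' \<in> edges G" "f' \<subseteq> U2" using sepD(1)[OF s'] f' by (auto simp: edges_glue)
  have W: "W1 \<union> W2 = U2" "W1 \<inter> W2 = {u'}" using sepD(2,3)[OF s'] by auto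
  have g: "g \<subseteq> W1 \<union> U1 \<or> g \<subseteq> W2" if g: "g \<in> edges G" "g \<noteq> f'" for g
  proof (cases "g = A")
    case True
    then show ?thesis using in1 hypergraphD(3)[OF G g(1)] sepD(2)[OF s] by blast
  next
    case False
    show ?thesis
    proof (cases "g \<subseteq> U1")
      case False
      then have "g \<in> edges (glue G U2 (insert u (A \<inter> U2)))"
        using sepD(10)[OF s g(1) \<open>g \<noteq> A\<close>] g(1) by (auto simp: edges_glue)
      then show ?thesis using sepD(10)[OF s'] g(2) by blast
    qed blast
  qed
  have u: "u \<in> W1" "U1 \<inter> U2 = {u}" using in1 sepD(3)[OF s] by auto
  obtain a b where ab: "a \<in> W1" "a \<noteq> u'" "b \<in> W2" "b \<noteq> u'" using sep_other[OF s'] .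
  show "sep G u' f' (W1 \<union> U1) W2"
  proof (rule sepI[OF f(1) _ _ _ ab(2,3,4) g])
    show "W1 \<union> U1 \<union> W2 = verts G" using W(1) sepD(2)[OF s] by blast
    show "(W1 \<union> U1) \<inter> W2 = {u'}" using W u by blast
  qed (use ab in auto)
qed

text \<open>If \<open>G\<close> splits only at \<open>A\<close>, pass to the part on the far side of
  \<open>v\<close>, with the hinge \<open>u\<close> in the role of \<open>v\<close>. A splitting of
  this part at another edge lifts to \<open>G\<close>. An end of the part that avoids
  \<open>u\<close> off its own hinge is already an end of \<open>G\<close>, since the edges of the
  other side do not reach it. When all edges are ordinary, the whole vertex set hinged at
  \<open>v\<close> is an end. \<open>N\<close> bounds the sizes for which the hypothesis
  \<open>MC\<close> is available.\<close>

lemma ends: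
  assumes MC: "\<forall>G :: 'a hgraph. card (verts G) < N \<longrightarrow> critical G k \<longrightarrow> low_conn G k
      \<longrightarrow> (\<forall>e\<in>edges G. card e = 2) \<or> (\<exists>v e V1 V2. sep G v e V1 V2)"
    and k: "3 \<le> k"
  shows "\<lbrakk>critical (G :: 'a hgraph) k; low_conn G k; card (verts G) < N; A \<in> edges G; v \<in> A\<rbrakk> \<Longrightarrow>
    (\<exists>u f V1 V2. f \<noteq> A \<and> sep G u f V1 V2) \<or>
    (\<exists>u U w. U \<subseteq> verts G \<and> u \<in> U \<and> v \<notin> U - {u} \<and> A \<inter> (U - {u}) = {w} \<and>
       (\<forall>f\<in>edges G. f \<noteq> A \<longrightarrow> f \<subseteq> U \<or> f \<subseteq> (verts G - U) \<union> {u}))"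
proof (induction "card (verts G)" arbitrary: G A v rule: less_induct)
  case less
  note crit = less.prems(1) and low = less.prems(2)
  note hyp = criticalD(1)[OF crit]
  have AV: "A \<subseteq> verts G" "2 \<le> card A" "finite A" using hypergraphD[OF hyp] less.prems(4) by auto
  show ?case
  proof (cases "\<exists>u f V1 V2. f \<noteq> A \<and> sep G u f V1 V2")
    case False
    consider "\<forall>e\<in>edges G. card e = 2" | "\<exists>u e V1 V2. sep G u e V1 V2"
      using MC less.prems(3) crit low by blast
    then show ?thesis
    proof cases
      case 1
      then have "card (A - {v}) = 1" using less.prems(4,5) AV by simp
      then obtain w where w: "A - {v} = {w}" by (auto simp: card_1_singleton_iff)
      then have "A \<inter> (verts G - {v}) = {w}" using AV by blast
      moreover have "v \<in> verts G" using AV less.prems(5) by blast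
      ultimately show ?thesis using hypergraphD(3)[OF hyp]
        by (intro disjI2 exI[of _ v] exI[of _ "verts G"] exI[of _ w]) auto
    next
      case 2
      then obtain u e U1' U2' where s0: "sep G u e U1' U2'" by blast
      then have "e = A" using False by blast
      then have s': "sep G u A U1' U2'" using s0 by simp
      have "v \<in> U1' \<or> v \<in> U2'" using sepD(2)[OF s'] AV(1) less.prems(5) by blast
      then obtain U1 U2 where s: "sep G u A U1 U2" and v: "v \<in> U1"
        using s' sep_sym[OF s'] by metis
      let ?A = "insert u (A \<inter> U2)"
      let ?G = "glue G U2 ?A"
      have cG: "critical ?G k" "?A \<notin> edges G" using sep_parts[OF crit k sep_sym[OF s]] by auto
      have lG: "low_conn ?G k" using sep_low_conn[OF crit k sep_sym[OF s] low] .
      have "card (verts ?G) < card (verts G)"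
        using sepD(8,9)[OF s] hypergraphD(1)[OF hyp] by (simp add: psubset_card_mono psubset_eq)
      moreover from this have "card (verts ?G) < N" using less.prems(3) by simp
      moreover have "?A \<in> edges ?G" by (simp add: edges_glue)
      ultimately consider
          (sp) "\<exists>u' f V1 V2. f \<noteq> ?A \<and> sep ?G u' f V1 V2"
        | (en) "\<exists>u' U w. U \<subseteq> U2 \<and> u' \<in> U \<and> u \<notin> U - {u'} \<and> ?A \<inter> (U - {u'}) = {w} \<and>
            (\<forall>f\<in>edges ?G. f \<noteq> ?A \<longrightarrow> f \<subseteq> U \<or> f \<subseteq> (U2 - U) \<union> {u'})"
        using less.hyps[of ?G ?A u] cG(1) lG unfolding verts_glue by blast
      then show ?thesis
      proof cases
        case sp
        then obtain u' f W1' W2' where w': "f \<noteq> ?A" "sep ?G u' f W1' W2'" by blast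
        then have "?A \<subseteq> W1' \<or> ?A \<subseteq> W2'" using sepD(10)[OF w'(2), of ?A] by (auto simp: edges_glue)
        then obtain W1 W2 where w: "sep ?G u' f W1 W2" "?A \<subseteq> W1" using w'(2) sep_sym[OF w'(2)] by metis
        have "f \<noteq> A" using glue_sep_lift(3)[OF hyp s w(1) w'(1) w(2)] sep_edge(2)[OF crit s] by blast
        then have False using glue_sep_lift(1)[OF hyp s w(1) w'(1) w(2)] False by blast
        then show ?thesis ..
      next
        case en
        then obtain u' U w where U: "U \<subseteq> U2" "u' \<in> U" "u \<notin> U - {u'}" "?A \<inter> (U - {u'}) = {w}"
          and U5: "\<forall>f\<in>edges ?G. f \<noteq> ?A \<longrightarrow> f \<subseteq> U \<or> f \<subseteq> (U2 - U) \<union> {u'}"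
          by (elim exE conjE)
        have U12: "U1 \<union> U2 = verts G" "U1 \<inter> U2 = {u}" using sepD(2,3)[OF s] by auto
        have "A \<inter> (U - {u'}) = ?A \<inter> (U - {u'})" using U(1,3) by auto
        then have "A \<inter> (U - {u'}) = {w}" using U(4) by simp
        moreover have "v \<notin> U - {u'}" using v U(1,3) U12(2) by auto
        moreover have "f \<subseteq> U \<or> f \<subseteq> (verts G - U) \<union> {u'}" if f: "f \<in> edges G" "f \<noteq> A" for f
        proof (cases "f \<subseteq> U1")
          case True
          have "f \<inter> (U - {u'}) = {}" using True U(1,3) U12(2) by auto
          then show ?thesis using hypergraphD(3)[OF hyp f(1)] by auto
        next
          case False
          then have "f \<in> edges ?G" using sepD(10)[OF s f] f(1) by (auto simp: edges_glue)
          moreover have "f \<noteq> ?A" using cG(2) f(1) by blast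
          ultimately have "f \<subseteq> U \<or> f \<subseteq> (U2 - U) \<union> {u'}" using U5 by simp
          then show ?thesis using U12(1) by auto
        qed
        moreover have "U \<subseteq> verts G" using U(1) U12(1) by auto
        ultimately show ?thesis using U(2) by (intro disjI2 exI[of _ u'] exI[of _ U] exI[of _ w]) auto
      qed
    qed
  qed blast
qed

lemma nontrivial_tight_cut:
  fixes H :: "'a hgraph"
  assumes MC: "\<forall>G :: 'a hgraph. card (verts G) < card (verts H) \<longrightarrow> critical G k \<longrightarrow> low_conn G k
      \<longrightarrow> (\<forall>e\<in>edges G. card e = 2) \<or> (\<exists>v e V1 V2. sep G v e V1 V2)"
    and k: "3 \<le> k" and crit: "critical H k" and low: "low_conn H k"
    and X0: "X0 \<subseteq> verts H" "2 \<le> card X0" "2 \<le> card (verts H - X0)" "card (cut H X0) \<le> k"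
  shows "\<exists>v e V1 V2. sep H v e V1 V2"
proof -
  note hyp = criticalD(1)[OF crit]
  note fin = hypergraphD(1)[OF hyp]
  have X0n: "X0 \<noteq> {}" "X0 \<noteq> verts H" using X0 by auto
  then have cX: "card (cut H X0) = k" using cut_ge[OF crit X0(1)] X0(4) by simp
  obtain X where X': "X = X0 \<or> X = verts H - X0" and cutX: "cut H X = cut H X0"
    and mono: "\<And>\<phi>. pcol H k X \<phi> \<Longrightarrow> monochr \<phi> (\<Union>e\<in>cut H X. e \<inter> X)"
    and rain: "\<And>\<psi> c. \<lbrakk>pcol H k (verts H - X) \<psi>; c < k\<rbrakk> \<Longrightarrow> \<exists>e\<in>cut H X. \<forall>u\<in>e - X. \<psi> u = c"
    using tight_cut[OF crit k X0(1) X0n cX] by blast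
  define A where "A = (\<Union>e\<in>cut H X. e \<inter> X)"
  have X: "X \<subseteq> verts H" "X \<noteq> verts H" "2 \<le> card X" "X \<noteq> {}" using X' X0 X0n by auto
  have FE: "e \<in> edges H" "e \<subseteq> verts H" "e \<inter> X \<noteq> {}" "\<not> e \<subseteq> X" "e \<inter> X \<subseteq> A" if "e \<in> cut H X" for e
    using that hypergraphD(3)[OF hyp] by (auto simp: cut_def A_def)
  have AX: "A \<subseteq> X" by (auto simp: A_def)
  then have finA: "finite A" using X(1) fin by (meson finite_subset)
  have monoA: "monochr \<phi> A" if "pcol H k X \<phi>" for \<phi> using mono[OF that] by (simp add: A_def)
  \<comment> \<open>Some cut edge is coloured outside \<open>X\<close> throughout with the common
    colour of \<open>A\<close>.\<close>
  have bad: "\<exists>e\<in>cut H X. e \<subseteq> A \<union> (verts H - X) \<and> monochr \<phi> e"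
    if \<phi>: "pcol H k (verts H - X) \<phi>" "monochr \<phi> A" "\<And>x. x \<in> A \<Longrightarrow> \<phi> x < k" for \<phi>
  proof -
    obtain e0 where "e0 \<in> cut H X" using cutX cX k by fastforce
    then obtain x where x: "x \<in> A" using FE by blast
    obtain e where e: "e \<in> cut H X" "\<forall>u\<in>e - X. \<phi> u = \<phi> x" using rain[OF \<phi>(1) \<phi>(3)[OF x]] by blast
    have "\<phi> u = \<phi> x" if "u \<in> e" for u using that e(2) FE(5)[OF e(1)] monochrD[OF \<phi>(2) _ x] by blast
    then have "monochr \<phi> e" unfolding monochr_def by simp
    then show ?thesis using e(1) FE(2,5)[OF e(1)] by blast
  qed
  \<comment> \<open>On a set of at most one vertex every colouring is constant. As \<open>X\<close>
    has a vertex outside such a set \<open>A\<close>, the hypergraph induced on \<open>A\<close> and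
    the outside is a proper part, hence colourable, against \<open>bad\<close>. By symmetry of the
    hypotheses it does not matter which side \<open>X\<close> is.\<close>
  have A2: "2 \<le> card A"
  proof (rule ccontr)
    assume "\<not> 2 \<le> card A"
    then have A1: "\<And>x y. x \<in> A \<Longrightarrow> y \<in> A \<Longrightarrow> x = y" using card_le_Suc0_iff_eq[OF finA] by auto
    have "\<not> X \<subseteq> A" using X(3) card_mono[OF finA, of X] \<open>\<not> 2 \<le> card A\<close> by auto
    then obtain z where z: "z \<in> X" "z \<notin> A" by blast
    have D: "A \<union> (verts H - X) \<subseteq> verts H" "A \<union> (verts H - X) \<noteq> verts H" using z X AX by auto
    obtain \<phi> where \<phi>: "pcol H k (A \<union> (verts H - X)) \<phi>" using critical_proper[OF crit D] .
    have "monochr \<phi> A" using A1 unfolding monochr_def by metis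
    moreover have "pcol H k (verts H - X) \<phi>" by (rule pcol_subset[OF \<phi>]) simp
    moreover have "\<phi> x < k" if "x \<in> A" for x using pcolD(1)[OF \<phi>] that by simp
    ultimately obtain e where e: "e \<in> cut H X" "e \<subseteq> A \<union> (verts H - X)" "monochr \<phi> e"
      using bad[of \<phi>] by auto
    then show False using pcolD(2)[OF \<phi> FE(1)[OF e(1)]] by simp
  qed
  have del: "\<not> monochr \<phi> A" if f: "f \<in> edges H" "f \<subseteq> X" "pcol (verts H, edges H - {f}) k (verts H) \<phi>" for f \<phi>
  proof
    assume m: "monochr \<phi> A"
    have "f \<noteq> {}" using hypergraphD(6)[OF hyp f(1)] .
    then have "pcol H k (verts H - X) \<phi>" using f by (auto simp: pcol_def)
    moreover have "\<phi> x < k" if "x \<in> A" for x using f(3) that AX X(1) by (auto simp: pcol_def)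
    ultimately obtain e where "e \<in> cut H X" "monochr \<phi> e" using bad m by blast
    then show False using f FE[of e] by (auto simp: pcol_def)
  qed
  have cov: "\<exists>e\<in>edges H. e \<subseteq> X \<and> x \<in> e" if x: "x \<in> X" "x \<notin> A" for x
  proof -
    obtain e where "e \<in> edges H" "x \<in> e" using criticalD(3)[OF crit, of x] x X by blast
    then show ?thesis using x by (auto simp: A_def cut_def)
  qed
  let ?G = "glue H X A"
  have cG: "critical ?G k" and AE: "A \<notin> edges H"
    using critical_glue[OF crit X(1,2) AX A2 monoA del cov] by auto
  \<comment> \<open>A separating set may reach beyond \<open>X\<close>. If its union with
    \<open>X\<close> misses a vertex, submodularity bounds the cut of its intersection with
    \<open>X\<close>; if it contains everything outside \<open>X\<close>, its complement lies in
    \<open>X\<close>. The complement exchanges \<open>v\<close> and \<open>w\<close>, whence the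
    symmetric form of the claim.\<close>
  have uncross: "\<exists>Z'. Z' \<subseteq> X \<and> (v \<in> Z' \<longleftrightarrow> w \<notin> Z') \<and> card (cut H Z') \<le> k"
    if vw: "v \<in> X" "w \<in> X" "v \<noteq> w" for v w
  proof -
    obtain Z0 where Z0: "v \<in> Z0" "w \<notin> Z0" "card (cut H Z0) \<le> k"
      using low vw X(1) unfolding low_conn_def by blast
    define Z where "Z = Z0 \<inter> verts H"
    have "cut H Z = cut H Z0" using hypergraphD(3)[OF hyp] unfolding cut_def Z_def by blast
    then have Z: "Z \<subseteq> verts H" "v \<in> Z" "w \<notin> Z" "card (cut H Z) \<le> k"
      using Z0 vw X(1) by (auto simp: Z_def)
    show ?thesis
    proof (cases "verts H - X \<subseteq> Z")
      case True
      then show ?thesis using Z vw cut_compl[OF hyp, of Z] X(1)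
        by (intro exI[of _ "verts H - Z"]) auto
    next
      case False
      then have "k \<le> card (cut H (X \<union> Z))" using X Z(1) by (intro cut_ge[OF crit]) auto
      then have "card (cut H (X \<inter> Z)) \<le> k"
        using card_cut_submodular[OF hyp, of X Z] Z(4) cutX cX by simp
      then show ?thesis using Z vw by (intro exI[of _ "X \<inter> Z"]) auto
    qed
  qed
  have meetF: "\<exists>g\<in>cut H Z. \<not> g \<subseteq> X" if "A \<inter> Z \<noteq> {}" "Z \<subseteq> X" for Z
    using that by (auto simp: A_def cut_def)
  have low_G: "low_conn ?G k"
    unfolding low_conn_def verts_glue
  proof (intro ballI impI)
    fix v w assume vw: "v \<in> X" "w \<in> X" "v \<noteq> w"
    from uncross[OF vw] obtain Z where Z: "Z \<subseteq> X" "v \<in> Z \<longleftrightarrow> w \<notin> Z" "card (cut H Z) \<le> k"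
      by (elim exE conjE)
    have "card (cut ?G (Z \<inter> X)) \<le> k"
      using card_cut_glue_le[OF hyp AX, of Z] meetF[OF _ Z(1)] Z(3) by fastforce
    then have c: "card (cut ?G Z) \<le> k" using Z(1) by (simp add: Int_absorb2)
    show "\<exists>Z. v \<in> Z \<and> w \<notin> Z \<and> card (cut ?G Z) \<le> k"
    proof (cases "v \<in> Z")
      case True
      then show ?thesis using c Z by blast
    next
      case False
      then show ?thesis using c Z vw cut_compl[OF criticalD(1)[OF cG], of Z]
        by (intro exI[of _ "X - Z"]) auto
    qed
  qed
  \<comment> \<open>\<open>H[X] + A\<close> is critical, so besides \<open>A\<close> at least
    \<open>k - 1\<close> edges crossing \<open>Z\<close> lie inside \<open>X\<close>. Edges of the
    cut of \<open>X\<close> that meet \<open>Z\<close> cross \<open>Z\<close> as well, and there is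
    room for only one of them.\<close>
  have one: "card {e \<in> cut H X. e \<inter> Z \<noteq> {}} \<le> 1"
    if Z: "Z \<subseteq> X" "card (cut H Z) \<le> k" "A \<inter> Z \<noteq> {}" "\<not> A \<subseteq> Z" for Z
  proof -
    let ?I = "{e \<in> cut H Z. e \<subseteq> X}" and ?O = "{e \<in> cut H X. e \<inter> Z \<noteq> {}}"
    have "k \<le> card (cut ?G Z)" by (rule cut_ge[OF cG]) (use Z AX in auto)
    also have "\<dots> \<le> card (insert A ?I)"
      by (rule card_mono) (use hypergraphD(2)[OF hyp] in \<open>auto simp: cut_def edges_glue\<close>)
    also have "\<dots> \<le> Suc (card ?I)" using finite_cut[OF hyp, of Z] by (simp add: card_insert_if)
    finally have "k \<le> Suc (card ?I)" .
    moreover have "card (?I \<union> ?O) = card ?I + card ?O"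
      using hypergraphD(2)[OF hyp] by (intro card_Un_disjoint) (auto simp: cut_def)
    moreover have "card (?I \<union> ?O) \<le> card (cut H Z)"
      by (rule card_mono) (use hypergraphD(2)[OF hyp] Z(1) in \<open>auto simp: cut_def\<close>)
    ultimately show ?thesis using Z(2) by linarith
  qed
  have single: "(\<forall>e\<in>cut H X. \<forall>f\<in>cut H X. v \<in> e \<longrightarrow> v \<in> f \<longrightarrow> e = f) \<or> (\<forall>e\<in>cut H X. \<forall>f\<in>cut H X. w \<in> e \<longrightarrow> w \<in> f \<longrightarrow> e = f)"
    if vw: "v \<in> A" "w \<in> A" "v \<noteq> w" for v w
  proof -
    have "v \<in> X" "w \<in> X" using vw AX by auto
    from uncross[OF this vw(3)] obtain Z where Z: "Z \<subseteq> X" "v \<in> Z \<longleftrightarrow> w \<notin> Z" "card (cut H Z) \<le> k"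
      by (elim exE conjE)
    have "card {e \<in> cut H X. e \<inter> Z \<noteq> {}} \<le> 1" by (rule one) (use Z vw in auto)
    then have "\<forall>e\<in>{e \<in> cut H X. e \<inter> Z \<noteq> {}}. \<forall>f\<in>{e \<in> cut H X. e \<inter> Z \<noteq> {}}. e = f"
      using card_le_Suc0_iff_eq[of "{e \<in> cut H X. e \<inter> Z \<noteq> {}}"] finite_cut[OF hyp, of X] by simp
    then have eq: "e = f" if "e \<in> cut H X" "f \<in> cut H X" "z \<in> e" "z \<in> f" "z \<in> Z" for e f z
      using that by blast
    show ?thesis
    proof (cases "v \<in> Z")
      case True
      then show ?thesis using eq[of _ _ v] by simp
    next
      case False
      then have "w \<in> Z" using Z(2) by simp
      then show ?thesis using eq[of _ _ w] by simp
    qed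
  qed
  have cardG: "card (verts ?G) < card (verts H)"
    using X(1,2) fin by (simp add: psubset_card_mono psubset_eq)
  note ends' = ends[OF MC k cG low_G cardG, of A]
  have AG: "A \<in> edges ?G" by (simp add: edges_glue)
  obtain a where a: "a \<in> A" using A2 by fastforce
  show ?thesis
  proof (cases "\<exists>u f V1 V2. f \<noteq> A \<and> sep ?G u f V1 V2")
    case True
    then obtain u f V1' V2' where s': "f \<noteq> A" "sep ?G u f V1' V2'" by blast
    then have "A \<subseteq> V1' \<or> A \<subseteq> V2'" using sepD(10)[OF s'(2) AG] by blast
    then obtain V1 V2 where s: "sep ?G u f V1 V2" and AV1: "A \<subseteq> V1" using s'(2) sep_sym[OF s'(2)] by metis
    have f: "f \<in> edges H" "f \<subseteq> X" using sepD(1)[OF s] s'(1) by (auto simp: edges_glue)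
    have V: "V1 \<union> V2 = X" "V1 \<inter> V2 = {u}" using sepD(2,3)[OF s] by auto
    obtain p q where pq: "p \<in> V1" "p \<noteq> u" "q \<in> V2" "q \<noteq> u" using sep_other[OF s] .
    \<comment> \<open>Edges leaving \<open>X\<close> touch it only in
      \<open>A \<subseteq> V1\<close>, so everything outside \<open>X\<close> may join
      \<open>V1\<close>.\<close>
    have "sep H u f (V1 \<union> (verts H - X)) V2"
    proof (rule sepI[OF f(1) _ _ _ pq(2) pq(3,4)])
      show "V1 \<union> (verts H - X) \<union> V2 = verts H" using V X(1) by blast
      show "(V1 \<union> (verts H - X)) \<inter> V2 = {u}" using V by blast
      show "p \<in> V1 \<union> (verts H - X)" using pq by simp
      fix g assume g: "g \<in> edges H" "g \<noteq> f"
      show "g \<subseteq> V1 \<union> (verts H - X) \<or> g \<subseteq> V2"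
      proof (cases "g \<subseteq> X")
        case True
        then have "g \<in> edges ?G" using g by (simp add: edges_glue)
        then show ?thesis using sepD(10)[OF s _ g(2)] by blast
      next
        case False
        then have "g \<inter> X \<subseteq> A" using g(1) by (auto simp: A_def cut_def)
        then show ?thesis using AV1 hypergraphD(3)[OF hyp g(1)] by blast
      qed
    qed
    then show ?thesis by blast
  next
    case False
    have en: "\<exists>u U w. U \<subseteq> X \<and> u \<in> U \<and> v \<notin> U - {u} \<and> A \<inter> (U - {u}) = {w} \<and>
       (\<forall>f\<in>edges ?G. f \<noteq> A \<longrightarrow> f \<subseteq> U \<or> f \<subseteq> (X - U) \<union> {u})" if "v \<in> A" for v
      by (rule disjE[OF ends'[OF AG that, unfolded verts_glue]]) (use False in blast, assumption)
    from en[OF a] obtain u1 U1 w1 where U1: "U1 \<subseteq> X" "u1 \<in> U1" "a \<notin> U1 - {u1}" "A \<inter> (U1 - {u1}) = {w1}"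
       "\<forall>f\<in>edges ?G. f \<noteq> A \<longrightarrow> f \<subseteq> U1 \<or> f \<subseteq> (X - U1) \<union> {u1}" by (elim exE conjE)
    have w1: "w1 \<in> A" using U1(4) by auto
    \<comment> \<open>The second end is chosen to avoid the vertex found by the first. Thus
      \<open>w1\<close> and \<open>w2\<close> differ, and \<open>single\<close> applies to
      them.\<close>
    from en[OF w1] obtain u2 U2 w2 where U2: "U2 \<subseteq> X" "u2 \<in> U2" "w1 \<notin> U2 - {u2}" "A \<inter> (U2 - {u2}) = {w2}"
       "\<forall>f\<in>edges ?G. f \<noteq> A \<longrightarrow> f \<subseteq> U2 \<or> f \<subseteq> (X - U2) \<union> {u2}" by (elim exE conjE)
    have w2: "w2 \<in> A" "w1 \<noteq> w2" using U2(3,4) by auto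
    obtain u U w where U: "U \<subseteq> X" "u \<in> U" "A \<inter> (U - {u}) = {w}"
       "\<forall>f\<in>edges ?G. f \<noteq> A \<longrightarrow> f \<subseteq> U \<or> f \<subseteq> (X - U) \<union> {u}"
       and w: "\<forall>e\<in>cut H X. \<forall>f\<in>cut H X. w \<in> e \<longrightarrow> w \<in> f \<longrightarrow> e = f"
    proof (cases "\<forall>e\<in>cut H X. \<forall>f\<in>cut H X. w1 \<in> e \<longrightarrow> w1 \<in> f \<longrightarrow> e = f")
      case True
      show ?thesis by (rule that[OF U1(1,2,4,5) True])
    next
      case False
      show ?thesis by (rule that[OF U2(1,2,4,5)]) (use single[OF w1 w2] False in \<open>elim disjE; simp\<close>)
    qed
    have "w \<in> A" using U(3) by auto
    then obtain e where e: "e \<in> cut H X" "w \<in> e" by (auto simp: A_def)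
    obtain y where y: "y \<in> verts H" "y \<notin> X" using X by blast
    \<comment> \<open>Off its hinge the end meets \<open>A\<close> only in \<open>w\<close>, and
      \<open>e\<close> is the only cut edge at \<open>w\<close>; so without \<open>e\<close> nothing
      but \<open>u\<close> connects the end to the rest.\<close>
    have "sep H u e U ((verts H - U) \<union> {u})"
    proof (rule sepI)
      show "e \<in> edges H" using FE(1)[OF e(1)] .
      show "w \<in> U" "w \<noteq> u" using U(3) by auto
      show "y \<in> verts H - U \<union> {u}" "y \<noteq> u" using y U by auto
      fix g assume g: "g \<in> edges H" "g \<noteq> e"
      show "g \<subseteq> U \<or> g \<subseteq> verts H - U \<union> {u}"
      proof (cases "g \<subseteq> X")
        case True
        then have "g \<in> edges ?G" "g \<noteq> A" using g AE by (auto simp: edges_glue)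
        then have "g \<subseteq> U \<or> g \<subseteq> X - U \<union> {u}" using U(4) by simp
        then show ?thesis using X(1) by auto
      next
        case False
        show ?thesis
        proof (cases "g \<inter> X = {}")
          case True
          then show ?thesis using hypergraphD(3)[OF hyp g(1)] U(1) by blast
        next
          case ne: False
          then have gF: "g \<in> cut H X" using False g(1) by (simp add: cut_def)
          then have "w \<notin> g" using w e g(2) by blast
          moreover have "g \<inter> (U - {u}) \<subseteq> A \<inter> (U - {u})" using U(1) FE(5)[OF gF] by auto
          ultimately have "g \<inter> (U - {u}) = {}" using U(3) by auto
          then show ?thesis using FE(2)[OF gF] by blast
        qed
      qed
    qed (use U X in auto)
    then show ?thesis by blast
  qed
qed

section \<open>At most one vertex of large degree\<close>

definition deg :: "'a hgraph \<Rightarrow> 'a \<Rightarrow> nat" where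
  "deg H x = card {e \<in> edges H. x \<in> e}"

definition adj :: "'a hgraph \<Rightarrow> 'a \<Rightarrow> 'a \<Rightarrow> bool" where
  "adj H x y \<longleftrightarrow> x \<noteq> y \<and> (\<exists>e\<in>edges H. x \<in> e \<and> y \<in> e)"

lemma adj_sym: "adj H x y \<Longrightarrow> adj H y x"
  unfolding adj_def by blast

lemma extend_by_color:
  assumes \<phi>: "pcol H k D \<phi>" and x: "x \<notin> D" and c: "c < k"
    and ok: "\<And>e. \<lbrakk>e \<in> edges H; x \<in> e; e \<subseteq> insert x D\<rbrakk> \<Longrightarrow> \<exists>u\<in>e - {x}. \<phi> u \<noteq> c"
  shows "pcol H k (insert x D) (\<phi>(x := c))"
  unfolding pcol_def
proof (intro conjI ballI impI notI)
  fix e assume e: "e \<in> edges H" "e \<subseteq> insert x D" "monochr (\<phi>(x := c)) e"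
  show False
  proof (cases "x \<in> e")
    case True
    then obtain u where "u \<in> e" "u \<noteq> x" "\<phi> u \<noteq> c" using ok e(1,2) by blast
    then show False using monochrD[OF e(3) _ True, of u] by simp
  next
    case False
    then have "(\<phi>(x := c)) v = \<phi> v" if "v \<in> e" for v using that by auto
    then have "monochr \<phi> e" using e(3) monochr_cong[of e "\<phi>(x := c)" \<phi>] by blast
    then show False using pcolD(2)[OF \<phi> e(1)] False e(2) by blast
  qed
qed (use pcolD(1)[OF \<phi>] c in auto)

text \<open>The edges in \<open>W\<close> forbid no colour at \<open>x\<close> beyond those forbidden by the other edges at \<open>x\<close>.\<close>

lemma extend_color:
  assumes H: "hypergraph H" and \<phi>: "pcol H k D \<phi>" and x: "x \<notin> D" and deg: "deg H x \<le> k"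
    and W: "W \<subseteq> {e \<in> edges H. x \<in> e}" and S: "finite S" "card S < card W"
    and harmless: "\<And>e. e \<in> W \<Longrightarrow> \<not> e \<subseteq> insert x D \<or> \<not> monochr \<phi> (e - {x}) \<or>
      (\<exists>f u u'. f \<in> edges H \<and> x \<in> f \<and> f \<notin> W \<and> monochr \<phi> (f - {x})
         \<and> u \<in> e - {x} \<and> u' \<in> f - {x} \<and> \<phi> u = \<phi> u')"
  shows "\<exists>c<k. c \<notin> S \<and> pcol H k (insert x D) (\<phi>(x := c))"
proof -
  let ?E = "{e \<in> edges H. x \<in> e}"
  define col where "col e = \<phi> (SOME u. u \<in> e - {x})" for e
  have finE: "finite ?E" using hypergraphD(2)[OF H] by simp
  have col: "\<phi> u = col e" if "monochr \<phi> (e - {x})" "u \<in> e - {x}" for e u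
    unfolding col_def using monochrD[OF that(1,2)] someI[of "\<lambda>u. u \<in> e - {x}", OF that(2)] by blast
  \<comment> \<open>Each edge at \<open>x\<close> forbids at most one colour, namely the common
    colour \<open>col\<close> of its other vertices. Leaving out \<open>W\<close> and adding
    \<open>S\<close> still excludes fewer than \<open>k\<close> colours.\<close>
  have "card (col ` (?E - W) \<union> S) \<le> card (?E - W) + card S"
    using card_Un_le[of "col ` (?E - W)" S] card_image_le[of "?E - W" col] finE by simp
  also have "card (?E - W) = card ?E - card W" using W finE by (meson card_Diff_subset finite_subset)
  also have "card ?E - card W + card S < k"
    using deg S(2) card_mono[OF finE W] unfolding deg_def by linarith
  finally have "\<not> {..<k} \<subseteq> col ` (?E - W) \<union> S"
    using card_mono[of "col ` (?E - W) \<union> S" "{..<k}"] finE S(1) by auto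
  then obtain c where c: "c < k" "c \<notin> S" "c \<notin> col ` (?E - W)" by blast
  have "\<exists>u\<in>e - {x}. \<phi> u \<noteq> c" if e: "e \<in> edges H" "x \<in> e" "e \<subseteq> insert x D" for e
  proof (rule ccontr)
    assume "\<not> ?thesis"
    then have all: "\<And>u. u \<in> e - {x} \<Longrightarrow> \<phi> u = c" by blast
    then have mono: "monochr \<phi> (e - {x})" unfolding monochr_def by simp
    obtain u where u: "u \<in> e - {x}" using hypergraphD(7)[OF H e(1), of x] by blast
    have ce: "col e = c" using col[OF mono u] all[OF u] by simp
    show False
    proof (cases "e \<in> W")
      case False
      then show False using ce c(3) e by blast
    next
      case True
      then obtain f w w' where f: "f \<in> ?E - W" "monochr \<phi> (f - {x})" "w \<in> e - {x}" "w' \<in> f - {x}" "\<phi> w = \<phi> w'"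
        using harmless[OF True] e(3) mono by blast
      then have "col f = c" using col[OF f(2,4)] all[OF f(3)] by simp
      then show False using c(3) f(1) by blast
    qed
  qed
  then show ?thesis using extend_by_color[OF \<phi> x c(1)] c by blast
qed

lemma extend_missing:
  assumes "hypergraph H" "pcol H k D \<phi>" "x \<notin> D" "deg H x \<le> k"
    and "W \<subseteq> {e \<in> edges H. x \<in> e}" "finite S" "card S < card W"
    and "\<And>e. e \<in> W \<Longrightarrow> \<not> e \<subseteq> insert x D"
  shows "\<exists>c<k. c \<notin> S \<and> pcol H k (insert x D) (\<phi>(x := c))"
  by (rule extend_color[OF assms(1-7)]) (use assms(8) in blast)

lemma extend_uncolored_neighbour:
  assumes "hypergraph H" "pcol H k D \<phi>" "x \<notin> D" "deg H x \<le> k" "adj H x y" "y \<notin> D"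
  shows "\<exists>c<k. pcol H k (insert x D) (\<phi>(x := c))"
proof -
  obtain e where e: "e \<in> edges H" "x \<in> e" "y \<in> e" "x \<noteq> y" using assms(5) by (auto simp: adj_def)
  have "\<exists>c<k. c \<notin> {} \<and> pcol H k (insert x D) (\<phi>(x := c))"
    by (rule extend_missing[OF assms(1-4), of "{e}"]) (use e assms(6) in auto)
  then show ?thesis by blast
qed

lemma extend_repeated_color:
  assumes H: "hypergraph H" and c: "pcol H k D \<phi>" "x \<notin> D" "deg H x \<le> k"
    and e: "e \<in> edges H" "x \<in> e" "f \<in> edges H" "x \<in> f" "e \<noteq> f" "u \<in> e - {x}" "w \<in> f - {x}" "\<phi> u = \<phi> w"
  shows "\<exists>c<k. pcol H k (insert x D) (\<phi>(x := c))"
proof (cases "monochr \<phi> (f - {x})")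
  case True
  have "\<exists>c<k. c \<notin> {} \<and> pcol H k (insert x D) (\<phi>(x := c))"
    by (rule extend_color[OF H c, of "{e}"]) (use e True in auto)
  then show ?thesis by blast
next
  case False
  have "\<exists>c<k. c \<notin> {} \<and> pcol H k (insert x D) (\<phi>(x := c))"
    by (rule extend_color[OF H c, of "{f}"]) (use e False in auto)
  then show ?thesis by blast
qed

text \<open>When a vertex of the path is coloured, its successor is still uncoloured, so one of its
  at most \<open>k\<close> edges forbids nothing.\<close>

lemma greedy_path:
  assumes "hypergraph H" "pcol H k D \<phi>" "p \<noteq> []" "distinct p" "set p \<inter> D = {}" "successively (adj H) p"
    and "\<And>x. x \<in> set p \<Longrightarrow> deg H x \<le> k"
  shows "\<exists>\<psi>. (\<forall>v. v \<notin> set (butlast p) \<longrightarrow> \<psi> v = \<phi> v) \<and> pcol H k (D \<union> set (butlast p)) \<psi>"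
  using assms(2-)
proof (induction p arbitrary: D \<phi>)
  case (Cons x p)
  show ?case
  proof (cases p)
    case Nil
    then show ?thesis using Cons.prems by auto
  next
    case (Cons y r)
    then have "adj H x y" "y \<notin> D" "x \<notin> D" "deg H x \<le> k" using Cons.prems by auto
    then obtain c where c: "pcol H k (insert x D) (\<phi>(x := c))"
      using extend_uncolored_neighbour[OF assms(1) Cons.prems(1)] by blast
    have "\<exists>\<psi>. (\<forall>v. v \<notin> set (butlast p) \<longrightarrow> \<psi> v = (\<phi>(x := c)) v) \<and> pcol H k (insert x D \<union> set (butlast p)) \<psi>"
      by (rule Cons.IH[OF c]) (use Cons.prems Cons in \<open>auto simp: successively_Cons\<close>)
    then obtain \<psi> where \<psi>: "\<forall>v. v \<notin> set (butlast p) \<longrightarrow> \<psi> v = (\<phi>(x := c)) v"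
      "pcol H k (insert x D \<union> set (butlast p)) \<psi>" by blast
    have "insert x D \<union> set (butlast p) = D \<union> set (butlast (x # p))" using Cons by auto
    then show ?thesis using \<psi> Cons by (intro exI[of _ \<psi>]) auto
  qed
qed simp

lemma short_path:
  assumes "(x, y) \<in> R\<^sup>*" "y \<in> T" "x \<notin> T"
  shows "\<exists>p. p \<noteq> [] \<and> hd p = x \<and> last p \<in> T \<and> successively (\<lambda>a b. (a, b) \<in> R) p \<and> distinct p
    \<and> set (butlast p) \<inter> T = {}"
  using assms
proof (induction rule: converse_rtrancl_induct)
  case (step x z)
  show ?case
  proof (cases "z \<in> T")
    case True
    then show ?thesis using step.hyps step.prems by (intro exI[of _ "[x, z]"]) auto
  next
    case False
    then obtain p where p: "p \<noteq> []" "hd p = z" "last p \<in> T" "successively (\<lambda>a b. (a, b) \<in> R) p" "distinct p"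
      "set (butlast p) \<inter> T = {}" using step.IH step.prems by blast
    show ?thesis
    proof (cases "x \<in> set p")
      case True
      then obtain a b where ab: "p = a @ x # b" by (meson split_list)
      then have "set (butlast (x # b)) \<subseteq> set (butlast p)" by (auto simp: butlast_append)
      then show ?thesis using p ab
        by (intro exI[of _ "x # b"]) (auto simp: successively_append_iff)
    next
      case False
      then show ?thesis using p step.hyps step.prems
        by (intro exI[of _ "x # p"]) (auto simp: successively_Cons)
    qed
  qed
qed simp

lemma successively_sources:
  "successively (\<lambda>a b. (a, b) \<in> R) p \<Longrightarrow> x \<in> set (butlast p) \<Longrightarrow> x \<in> Domain R"
  by (induction p) (auto simp: successively_Cons split: if_splits)

lemma successively_targets:
  "successively (\<lambda>a b. (a, b) \<in> R) p \<Longrightarrow> x \<in> set (tl p) \<Longrightarrow> x \<in> Range R"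
proof (induction p)
  case (Cons a p)
  then show ?case by (cases p) (auto simp: successively_Cons)
qed simp

text \<open>The degree of \<open>h\<close> is not bounded, so greedy colourings have to run in the
  rest. \<open>no_sep\<close> guarantees that this rest stays connected when any single edge is
  deleted, which is the form of 2-connectivity that Brooks-type arguments need.\<close>

locale one_big_vertex =
  fixes H :: "'a hgraph" and k :: nat and h :: 'a
  assumes crit: "critical H k" and k3: "3 \<le> k" and h: "h \<in> verts H"
    and deg_le: "\<And>x. x \<in> verts H \<Longrightarrow> x \<noteq> h \<Longrightarrow> deg H x \<le> k"
    and no_sep: "\<not> (\<exists>e V1 V2. sep H h e V1 V2)"
begin

lemma hyp: "hypergraph H" using criticalD(1)[OF crit] .

lemma no_part:
  assumes U: "U \<subseteq> verts H - {h}" "U \<noteq> {}" "U \<noteq> verts H - {h}" and e: "e \<in> edges H"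
    and f: "\<And>f. \<lbrakk>f \<in> edges H; f \<noteq> e; f \<inter> U \<noteq> {}\<rbrakk> \<Longrightarrow> f \<subseteq> insert h U"
  shows False
proof -
  obtain a b where ab: "a \<in> U" "b \<in> verts H - {h} - U" using U by blast
  have "sep H h e (insert h U) (verts H - U)"
  proof (rule sepI[OF e])
    show "insert h U \<union> (verts H - U) = verts H" "insert h U \<inter> (verts H - U) = {h}"
      using U h by auto
    show "a \<in> insert h U" "a \<noteq> h" "b \<in> verts H - U" "b \<noteq> h" using ab U by auto
    fix g assume g: "g \<in> edges H" "g \<noteq> e"
    then show "g \<subseteq> insert h U \<or> g \<subseteq> verts H - U" using f[OF g] hypergraphD(3)[OF hyp g(1)] by blast
  qed
  then show False using no_sep by blast
qed

lemma not_colored: "\<not> pcol H k (verts H) \<phi>" using criticalD(2)[OF crit] .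

text \<open>Otherwise let \<open>x \<noteq> h\<close>, \<open>z\<close> and \<open>t\<close> be
  three vertices of \<open>e\<close>, with \<open>z\<close> reached from \<open>x\<close> by a path
  avoiding \<open>h\<close> and the edge \<open>e\<close>. Colour \<open>z\<close> differently from
  \<open>t\<close> and continue greedily along the path back to \<open>x\<close>: at
  \<open>x\<close> the edge \<open>e\<close> forbids nothing, so \<open>x\<close> can be coloured
  last.\<close>

lemma ordinary:
  assumes e: "e \<in> edges H"
  shows "card e = 2"
proof (rule ccontr)
  assume "card e \<noteq> 2"
  then have e3: "3 \<le> card e" using hypergraphD(4)[OF hyp e] by simp
  have fe: "finite e" "e \<subseteq> verts H" using hypergraphD[OF hyp] e by auto
  have "\<not> e \<subseteq> {h}" using hypergraphD(7)[OF hyp e] by blast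
  then obtain x where x: "x \<in> e" "x \<noteq> h" by blast
  let ?L = "verts H - {h}"
  define R where "R = {(a, b). a \<in> ?L \<and> b \<in> ?L \<and> (\<exists>f\<in>edges H. f \<noteq> e \<and> a \<in> f \<and> b \<in> f) \<and> a \<noteq> b}"
  define U where "U = {u. (x, u) \<in> R\<^sup>*}"
  have UL: "U \<subseteq> ?L"
  proof
    fix u assume "u \<in> U"
    then have "(x, u) \<in> R\<^sup>*" by (simp add: U_def)
    then show "u \<in> ?L" by (induction rule: rtrancl_induct) (use x fe in \<open>auto simp: R_def\<close>)
  qed
  have xU: "x \<in> U" by (simp add: U_def)
  have "U \<inter> (e - {x}) \<noteq> {}"
  proof
    assume none: "U \<inter> (e - {x}) = {}"
    have "\<not> e \<subseteq> {x, h}" using e3 card_mono[of "{x, h}" e] x by auto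
    then have neq: "U \<noteq> ?L" using none fe by blast
    show False
    proof (rule no_part[OF UL _ neq e])
      fix f assume f: "f \<in> edges H" "f \<noteq> e" "f \<inter> U \<noteq> {}"
      then obtain a where a: "a \<in> f" "a \<in> U" by blast
      show "f \<subseteq> insert h U"
      proof
        fix b assume b: "b \<in> f"
        show "b \<in> insert h U"
        proof (cases "b = h \<or> a = b")
          case False
          then have "(a, b) \<in> R" using a b f UL hypergraphD(3)[OF hyp f(1)] unfolding R_def by blast
          then show ?thesis using a(2) unfolding U_def by (auto intro: rtrancl_into_rtrancl)
        qed (use a in auto)
      qed
    qed (use xU in auto)
  qed
  then obtain y where y: "(x, y) \<in> R\<^sup>*" "y \<in> e - {x}" by (auto simp: U_def)
  obtain p where p: "p \<noteq> []" "hd p = x" "last p \<in> e - {x}" "successively (\<lambda>a b. (a, b) \<in> R) p" "distinct p"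
    "set (butlast p) \<inter> (e - {x}) = {}" using short_path[OF y] by blast
  define z where "z = last p"
  obtain q where pq: "p = q @ [z]" using p(1) unfolding z_def by (metis append_butlast_last_id)
  have qne: "q \<noteq> []" using p(2,3) pq by (cases q) auto
  define w where "w = last q"
  have "(w, z) \<in> R" using p(4) qne unfolding pq w_def by (simp add: successively_append_iff)
  then obtain f where f: "f \<in> edges H" "f \<noteq> e" "w \<in> f" "z \<in> f" "w \<noteq> z" by (auto simp: R_def)
  have pL: "set p \<subseteq> ?L"
  proof
    fix a assume "a \<in> set p"
    then have "a = x \<or> a \<in> set (tl p)" using p(1,2) by (cases p) auto
    then show "a \<in> ?L" using successively_targets[OF p(4)] x fe by (auto simp: R_def)
  qed
  have xq: "x \<in> set q" "w \<in> set q" using p(2) pq qne by (cases q; auto simp: w_def)+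
  have "\<not> e \<subseteq> {x, z}" using e3 card_mono[of "{x, z}" e] by (auto simp: card_insert_if split: if_splits)
  then obtain t where t: "t \<in> e" "t \<noteq> x" "t \<noteq> z" by blast
  have tp: "t \<notin> set p" using t p(6) pq by auto
  have degp: "deg H a \<le> k" if "a \<in> set p" for a using deg_le pL that by blast
  let ?D = "verts H - set p"
  have "?D \<noteq> verts H" using pL p(1) by (cases p) auto
  then obtain \<phi> where \<phi>: "pcol H k ?D \<phi>" using critical_proper[OF crit, of ?D] by blast
  \<comment> \<open>Two edges at \<open>z\<close> still have an uncoloured vertex besides
    \<open>z\<close>: \<open>e\<close> contains \<open>x\<close>, and the last edge \<open>f\<close>
    of the path contains \<open>w\<close>. This leaves room to avoid the colour of
    \<open>t\<close>.\<close>
  have "\<exists>c<k. c \<notin> {\<phi> t} \<and> pcol H k (insert z ?D) (\<phi>(z := c))"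
  proof (rule extend_missing[OF hyp \<phi>, of z "{e, f}"])
    show "{e, f} \<subseteq> {e \<in> edges H. z \<in> e}" using e f p(3) by (auto simp: z_def)
    show "card {\<phi> t} < card {e, f}" using f(2) by simp
    have "x \<noteq> z" using p(3) by (auto simp: z_def)
    moreover have "w \<in> set p" "x \<in> set p" using xq pq by simp_all
    ultimately have "\<not> e \<subseteq> insert z ?D" "\<not> f \<subseteq> insert z ?D" using x(1) f(3,5) by auto
    then show "\<And>e'. e' \<in> {e, f} \<Longrightarrow> \<not> e' \<subseteq> insert z ?D" by auto
  qed (use degp pq in auto)
  then obtain c where c: "c \<noteq> \<phi> t" "pcol H k (insert z ?D) (\<phi>(z := c))" by blast
  have "successively (adj H) p"
    by (rule successively_mono[OF p(4)]) (auto simp: R_def adj_def)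
  then have "successively (\<lambda>a b. adj H b a) q" unfolding pq
    by (auto simp: successively_append_iff intro: successively_mono adj_sym)
  then have "\<exists>\<psi>. (\<forall>v. v \<notin> set (butlast (rev q)) \<longrightarrow> \<psi> v = (\<phi>(z := c)) v)
      \<and> pcol H k (insert z ?D \<union> set (butlast (rev q))) \<psi>"
    by (intro greedy_path[OF hyp c(2)]) (use degp p(5) qne pq in auto)
  then obtain \<psi> where \<psi>: "\<And>v. v \<notin> set (butlast (rev q)) \<Longrightarrow> \<psi> v = (\<phi>(z := c)) v"
    "pcol H k (insert z ?D \<union> set (butlast (rev q))) \<psi>" by blast
  obtain q' where q': "q = x # q'" using p(2) pq qne by (cases q) auto
  have D: "insert z ?D \<union> set (butlast (rev q)) = verts H - {x}"
    using pL p(5) unfolding pq q' by auto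
  have "\<psi> z = c" using \<psi>(1)[of z] p(5) pq q' by auto
  moreover have "\<psi> t = \<phi> t" using \<psi>(1)[of t] tp t(3) pq q' by auto
  ultimately have "\<not> monochr \<psi> (e - {x})"
    using c(1) t p(3) monochrD[of \<psi> "e - {x}" z t] by (auto simp: z_def)
  then have "\<exists>c<k. c \<notin> {} \<and> pcol H k (insert x (verts H - {x})) (\<psi>(x := c))"
    by (intro extend_color[OF hyp \<psi>(2)[unfolded D], of x "{e}"]) (use degp e x q' pq in auto)
  moreover have "insert x (verts H - {x}) = verts H" using x fe by blast
  ultimately show False using not_colored by auto
qed

lemma edge_adj: "adj H x y \<longleftrightarrow> x \<noteq> y \<and> {x, y} \<in> edges H"
proof
  assume "adj H x y"
  then obtain e where e: "e \<in> edges H" "x \<in> e" "y \<in> e" "x \<noteq> y" by (auto simp: adj_def)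
  have "{x, y} = e" by (rule card_subset_eq) (use e ordinary[OF e(1)] hypergraphD(5)[OF hyp e(1)] in auto)
  then show "x \<noteq> y \<and> {x, y} \<in> edges H" using e by simp
qed (auto simp: adj_def)

lemma edge_cases:
  assumes "e \<in> edges H" "x \<in> e"
  obtains y where "e = {x, y}" "x \<noteq> y" "y \<in> verts H"
proof -
  obtain a b where ab: "e = {a, b}" "a \<noteq> b" using ordinary[OF assms(1)] by (auto simp: card_2_iff)
  then have "a \<in> verts H" "b \<in> verts H" using hypergraphD(3)[OF hyp assms(1)] by auto
  then show ?thesis using ab assms(2) that[of a] that[of b] by auto
qed

section \<open>Cycles avoiding the vertex of large degree\<close>

definition cyclic :: "'a list \<Rightarrow> bool" where
  "cyclic C \<longleftrightarrow> C \<noteq> [] \<and> distinct C \<and> set C \<subseteq> verts H - {h} \<and> successively (adj H) C \<and> adj H (last C) (hd C)"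

lemma cyclic_rotate1: "cyclic C \<Longrightarrow> cyclic (rotate1 C)"
proof -
  assume C: "cyclic C"
  then obtain x r where xr: "C = x # r" unfolding cyclic_def by (cases C) auto
  have "r \<noteq> []" using C xr by (auto simp: cyclic_def adj_def)
  then show ?thesis using C xr by (auto simp: cyclic_def successively_append_iff successively_Cons)
qed

lemma cyclic_rotate: "cyclic C \<Longrightarrow> cyclic (rotate m C)"
  by (induction m) (auto intro: cyclic_rotate1)

definition seen :: "('a \<Rightarrow> nat) \<Rightarrow> 'a set \<Rightarrow> 'a \<Rightarrow> nat set" where
  "seen \<phi> S x = \<phi> ` {u. u \<notin> S \<and> {x, u} \<in> edges H}"

text \<open>Suppose that the last vertex of the cycle sees a colour \<open>c\<close> that the first
  one does not see. Give \<open>c\<close> to the first vertex and colour greedily around the cycle: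
  the last vertex then sees \<open>c\<close> on two edges and can be coloured as well.\<close>

lemma cyclic_step:
  assumes C: "cyclic C" and \<phi>: "pcol H k (verts H - set C) \<phi>"
  shows "seen \<phi> (set C) (last C) \<subseteq> seen \<phi> (set C) (hd C)"
proof
  fix c assume "c \<in> seen \<phi> (set C) (last C)"
  then obtain u where u: "u \<notin> set C" "{last C, u} \<in> edges H" "c = \<phi> u" by (auto simp: seen_def)
  show "c \<in> seen \<phi> (set C) (hd C)"
  proof (rule ccontr)
    assume no: "c \<notin> seen \<phi> (set C) (hd C)"
    obtain b r where br: "C = b # r" using C unfolding cyclic_def by (cases C) auto
    have rne: "r \<noteq> []" using C br by (auto simp: cyclic_def adj_def)
    define a where "a = last C"
    obtain s where sa: "r = s @ [a]" using rne br unfolding a_def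
      by (metis append_butlast_last_id last_ConsR)
    have CV: "set C \<subseteq> verts H - {h}" "distinct C" using C by (auto simp: cyclic_def)
    have uV: "u \<in> verts H" using u(2) hypergraphD(3)[OF hyp] by blast
    let ?D = "verts H - set C"
    have 1: "pcol H k (insert b ?D) (\<phi>(b := c))"
    proof (rule extend_by_color[OF \<phi>])
      show "c < k" using pcolD(1)[OF \<phi>, of u] u uV by simp
      fix e assume e: "e \<in> edges H" "b \<in> e" "e \<subseteq> insert b ?D"
      obtain y where y: "e = {b, y}" "b \<noteq> y" using edge_cases[OF e(1,2)] .
      then have "\<phi> y \<noteq> c" using no e br by (auto simp: seen_def)
      then show "\<exists>u\<in>e - {b}. \<phi> u \<noteq> c" using y by blast
    qed (use br in simp)
    have "\<exists>\<psi>. (\<forall>v. v \<notin> set (butlast r) \<longrightarrow> \<psi> v = (\<phi>(b := c)) v)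
      \<and> pcol H k (insert b ?D \<union> set (butlast r)) \<psi>"
      by (intro greedy_path[OF hyp 1])
        (use C rne br deg_le in \<open>auto simp: cyclic_def successively_Cons\<close>)
    then obtain \<psi> where \<psi>: "\<And>v. v \<notin> set s \<Longrightarrow> \<psi> v = (\<phi>(b := c)) v"
      "pcol H k (insert b ?D \<union> set s) \<psi>" unfolding sa by auto
    have D: "insert b ?D \<union> set s = verts H - {a}" using CV unfolding br sa by auto
    have ab: "{a, b} \<in> edges H" "a \<noteq> b" using C edge_adj by (auto simp: cyclic_def a_def br)
    have "\<psi> b = \<psi> u" using \<psi>(1)[of b] \<psi>(1)[of u] CV u unfolding br sa by auto
    then have "\<exists>c<k. pcol H k (insert a (verts H - {a})) (\<psi>(a := c))"
      using u ab CV deg_le[of a] br sa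
      by (intro extend_repeated_color[OF hyp \<psi>(2)[unfolded D], of a "{a, b}" "{a, u}" b u])
        (auto simp: a_def[symmetric] doubleton_eq_iff)
    moreover have "insert a (verts H - {a}) = verts H" using CV br sa by auto
    ultimately show False using not_colored by auto
  qed
qed

text \<open>Rotating the cycle, the inclusions of \<open>cyclic_step\<close> run all the way round
  and become equalities.\<close>

lemma cyclic_seen_eq:
  assumes C: "cyclic C" and \<phi>: "pcol H k (verts H - set C) \<phi>" and xy: "x \<in> set C" "y \<in> set C"
  shows "seen \<phi> (set C) x = seen \<phi> (set C) y"
proof -
  have step: "seen \<phi> (set C) (last C') \<subseteq> seen \<phi> (set C) (last (rotate m C'))"
    if "cyclic C'" "set C' = set C" for C' m
  proof (induction m)
    case (Suc m)
    let ?R = "rotate m C'"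
    have R: "cyclic ?R" "set ?R = set C" using that cyclic_rotate by auto
    then have "seen \<phi> (set C) (last ?R) \<subseteq> seen \<phi> (set C) (hd ?R)"
      using cyclic_step[of ?R \<phi>] \<phi> by simp
    moreover have "last (rotate (Suc m) C') = hd ?R" using R(1) by (cases ?R) (auto simp: cyclic_def)
    ultimately show ?case using Suc by simp
  qed simp
  have le: "seen \<phi> (set C) u \<subseteq> seen \<phi> (set C) w" if uw: "u \<in> set C" "w \<in> set C" for u w
  proof -
    obtain a b where ab: "C = a @ u # b" using uw(1) by (meson split_list)
    define C' where "C' = rotate (Suc (length a)) C"
    have C': "cyclic C'" "set C' = set C" "last C' = u"
      using cyclic_rotate[OF C, of "Suc (length a)"] rotate_append[of "a @ [u]" b] unfolding C'_def ab by auto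
    obtain a' b' where ab': "C' = a' @ w # b'" using uw(2) C'(2) by (metis split_list)
    have "last (rotate (Suc (length a')) C') = w" using rotate_append[of "a' @ [w]" b'] unfolding ab' by auto
    then show ?thesis using step[OF C'(1,2), of "Suc (length a')"] C'(3) by simp
  qed
  then show ?thesis using xy by blast
qed

text \<open>As \<open>z\<close> sees at most the colour of \<open>h\<close>, every vertex of
  \<open>C\<close> sees exactly this colour, in every colouring of the rest. Hence a neighbour
  \<open>u\<close> of \<open>C\<close> outside it would always be coloured like \<open>h\<close>.
  But some second edge joins the component of \<open>u\<close> to \<open>C\<close>, and this gives
  the freedom to recolour \<open>u\<close>.\<close>

lemma cyclic_spanning:
  assumes C: "cyclic C" and z: "z \<in> set C" "\<And>u. \<lbrakk>{z, u} \<in> edges H; u \<notin> set C\<rbrakk> \<Longrightarrow> u = h"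
  shows "set C = verts H - {h}" "\<And>x. x \<in> set C \<Longrightarrow> {x, h} \<in> edges H"
proof -
  let ?L = "verts H - {h}" and ?S = "set C"
  have CL: "?S \<subseteq> ?L" "?S \<noteq> {}" using C by (auto simp: cyclic_def)
  have edgeV: "y \<in> verts H" if "{x, y} \<in> edges H" for x y using hypergraphD(3)[OF hyp that] by auto
  have seen: "seen \<phi> ?S x = {\<phi> h}" if \<phi>: "pcol H k (verts H - ?S) \<phi>" and x: "x \<in> ?S" for \<phi> x
  proof -
    have "k \<le> card (cut H ?S)" by (rule cut_ge[OF crit]) (use CL h in auto)
    then have "cut H ?S \<noteq> {}" using k3 by auto
    then obtain e where e: "e \<in> edges H" "e \<inter> ?S \<noteq> {}" "\<not> e \<subseteq> ?S" by (auto simp: cut_def)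
    then obtain y where y: "y \<in> e" "y \<in> ?S" by blast
    obtain u where u: "e = {y, u}" using edge_cases[OF e(1) y(1)] .
    then have "\<phi> u \<in> seen \<phi> ?S y" using e y by (auto simp: seen_def)
    moreover have "seen \<phi> ?S z \<subseteq> {\<phi> h}" using z(2) by (auto simp: seen_def)
    ultimately have "seen \<phi> ?S z = {\<phi> h}" using cyclic_seen_eq[OF C \<phi> y(2) z(1)] by auto
    then show ?thesis using cyclic_seen_eq[OF C \<phi> x z(1)] by simp
  qed
  have "z \<in> verts H" "z \<notin> verts H - ?S" using z(1) CL(1) by auto
  then have "verts H - ?S \<subseteq> verts H" "verts H - ?S \<noteq> verts H" by auto
  then obtain \<phi>0 where \<phi>0: "pcol H k (verts H - ?S) \<phi>0" using critical_proper[OF crit] by metis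
  show span: "?S = ?L"
  proof (rule ccontr)
    assume ne: "?S \<noteq> ?L"
    show False
    proof (cases "\<exists>x\<in>?S. \<exists>u\<in>?L - ?S. {x, u} \<in> edges H")
      case False
      obtain e where e: "e \<in> edges H" using criticalD(3)[OF crit h] by blast
      show False
      proof (rule no_part[OF CL ne e])
        fix f assume f: "f \<in> edges H" "f \<inter> ?S \<noteq> {}"
        then obtain x where x: "x \<in> f" "x \<in> ?S" by blast
        obtain y where y: "f = {x, y}" "y \<in> verts H" using edge_cases[OF f(1) x(1)] .
        then show "f \<subseteq> insert h ?S" using False x f(1) by auto
      qed
    next
      case True
      then obtain x u where xu: "x \<in> ?S" "u \<in> ?L" "u \<notin> ?S" "{x, u} \<in> edges H" by blast
      define R where "R = {(a, b). a \<in> ?L - ?S \<and> b \<in> ?L - ?S \<and> adj H a b}"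
      define U where "U = {v. (u, v) \<in> R\<^sup>*}"
      have UL: "U \<subseteq> ?L - ?S"
      proof
        fix v assume "v \<in> U"
        then have "(u, v) \<in> R\<^sup>*" by (simp add: U_def)
        then show "v \<in> ?L - ?S" by (induction rule: rtrancl_induct) (use xu in \<open>auto simp: R_def\<close>)
      qed
      have uU: "u \<in> U" by (simp add: U_def)
      show False
      proof (rule no_part[of U "{x, u}"])
        fix f assume f: "f \<in> edges H" "f \<noteq> {x, u}" "f \<inter> U \<noteq> {}"
        then obtain a where a: "a \<in> f" "a \<in> U" by blast
        obtain b where b: "f = {a, b}" "a \<noteq> b" "b \<in> verts H" using edge_cases[OF f(1) a(1)] .
        have adjab: "adj H a b" using edge_adj f(1) b by blast
        have "b \<notin> ?S"
        proof
          assume bS: "b \<in> ?S"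
          \<comment> \<open>The single extra step from \<open>a\<close> to \<open>b\<close> yields a
            path from \<open>u\<close> back to \<open>C\<close>. It does not begin with the edge
            \<open>{u, x}\<close>, because the edge used to enter \<open>C\<close> is a different
            one.\<close>
          define R' where "R' = insert (a, b) R"
          have "(u, a) \<in> R'\<^sup>*" using a(2) rtrancl_mono[of R R'] unfolding U_def R'_def by blast
          then have "(u, b) \<in> R'\<^sup>*" by (rule rtrancl_into_rtrancl) (simp add: R'_def)
          moreover have "u \<noteq> b" using xu(3) bS by blast
          ultimately obtain p where p: "p \<noteq> []" "hd p = u" "last p = b"
            "successively (\<lambda>a b. (a, b) \<in> R') p" "distinct p"
            using short_path[of u b R' "{b}"] by auto
          obtain q where q: "p = u # q" using p(1,2) by (cases p) auto
          have qne: "q \<noteq> []" using p(3) q \<open>u \<noteq> b\<close> by auto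
          have "(u, hd q) \<in> R'" using p(4) q qne by (auto simp: successively_Cons)
          then have hdq: "hd q \<noteq> x" "adj H u (hd q)" using f(2) b(1) xu(1) adjab unfolding R'_def R_def by auto
          have src: "v \<in> ?L - ?S" if "v \<in> set (butlast p)" for v
            using successively_sources[OF p(4) that] a UL unfolding R'_def R_def by auto
          have lq: "last q = b" using p(3) q qne by simp
          have pq: "set p = insert b (set (butlast p))" "set q = insert b (set (butlast q))"
            using p(1,3) qne lq by (metis append_butlast_last_id set_append list.set Un_insert_right sup_bot_right)+
          have pL: "v \<in> ?L" if "v \<in> set p" for v using pq(1) src that bS CL(1) by auto
          let ?D = "verts H - ?S - set p"
          \<comment> \<open>Both \<open>x\<close> and \<open>hd q\<close> are uncoloured, so two
            edges at \<open>u\<close> forbid nothing and the colour of \<open>h\<close> can be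
            avoided. The other vertices of the path are then recoloured in the direction of
            \<open>b\<close>, which stays uncoloured.\<close>
          have "\<exists>c<k. c \<notin> {\<phi>0 h} \<and> pcol H k (insert u ?D) (\<phi>0(u := c))"
          proof (rule extend_missing[OF hyp pcol_subset[OF \<phi>0], of _ u "{{u, x}, {u, hd q}}"])
            show "{{u, x}, {u, hd q}} \<subseteq> {e \<in> edges H. u \<in> e}"
              using xu(4) hdq(2) edge_adj by (auto simp: insert_commute)
            show "card {\<phi>0 h} < card {{u, x}, {u, hd q}}" using hdq(1) by (auto simp: doubleton_eq_iff)
            have "hd q \<in> set p" "hd q \<noteq> u" using qne p(5) unfolding q by auto
            then show "\<And>e. e \<in> {{u, x}, {u, hd q}} \<Longrightarrow> \<not> e \<subseteq> insert u ?D"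
              using xu(1,3) by auto
          qed (use q xu deg_le in auto)
          then obtain c where c: "c \<noteq> \<phi>0 h" "pcol H k (insert u ?D) (\<phi>0(u := c))" by blast
          have "successively (adj H) p"
            by (rule successively_mono[OF p(4)]) (use adjab in \<open>auto simp: R'_def R_def\<close>)
          then have "\<exists>\<psi>. (\<forall>v. v \<notin> set (butlast q) \<longrightarrow> \<psi> v = (\<phi>0(u := c)) v)
              \<and> pcol H k (insert u ?D \<union> set (butlast q)) \<psi>"
            by (intro greedy_path[OF hyp c(2)])
              (use q qne p(5) deg_le pL in \<open>auto simp: successively_Cons\<close>)
          then obtain \<psi> where \<psi>: "\<And>v. v \<notin> set (butlast q) \<Longrightarrow> \<psi> v = (\<phi>0(u := c)) v"
            "pcol H k (insert u ?D \<union> set (butlast q)) \<psi>" by blast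
          have D: "insert u ?D \<union> set (butlast q) = verts H - ?S"
          proof -
            have "set (butlast p) = insert u (set (butlast q))" using q qne by simp
            then show ?thesis using src pq(1) bS by auto
          qed
          have "h \<notin> set (butlast q)" "u \<notin> set (butlast q)"
            using pL p(5) unfolding q by (auto dest: in_set_butlastD)
          then have "\<psi> h = \<phi>0 h" "\<psi> u = c" using \<psi>(1)[of h] \<psi>(1)[of u] xu(2) by auto
          moreover have "\<psi> u \<in> seen \<psi> ?S x" using xu by (auto simp: seen_def)
          ultimately show False using seen[OF \<psi>(2)[unfolded D] xu(1)] c(1) by simp
        qed
        moreover have "b \<in> U" if "b \<noteq> h" "b \<notin> ?S"
        proof -
          have "(a, b) \<in> R" using that a UL adjab b(3) unfolding R_def by auto
          then show ?thesis using a(2) unfolding U_def by (auto intro: rtrancl_into_rtrancl)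
        qed
        ultimately show "f \<subseteq> insert h U" using b(1) a(2) by auto
      qed (use UL uU xu CL in auto)
    qed
  qed
  show "{x, h} \<in> edges H" if x: "x \<in> ?S" for x
  proof -
    have "\<phi>0 h \<in> seen \<phi>0 ?S x" using seen[OF \<phi>0 x] by simp
    then obtain u where "u \<notin> ?S" "{x, u} \<in> edges H" by (auto simp: seen_def)
    then show ?thesis using edgeV[of x u] span by auto
  qed
qed

section \<open>Spanning cycles, complete graphs and odd wheels\<close>

lemma deg_eq: "x \<in> verts H \<Longrightarrow> x \<noteq> h \<Longrightarrow> deg H x = k"
proof -
  assume x: "x \<in> verts H" "x \<noteq> h"
  have "k \<le> card (cut H {x})" by (rule cut_ge[OF crit]) (use x h in auto)
  also have "\<dots> \<le> deg H x" unfolding deg_def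
    by (rule card_mono) (use hypergraphD(2)[OF hyp] in \<open>auto simp: cut_def\<close>)
  finally show ?thesis using deg_le[OF x] by simp
qed

text \<open>If the path cannot be prolonged at its end \<open>z\<close>, all neighbours of
  \<open>z\<close> other than \<open>h\<close> lie on it. Closing up at the first of them gives a
  cycle to which \<open>cyclic_spanning\<close> applies; it covers everything, so the path has no
  vertices before that neighbour.\<close>

lemma extend_to_spanning_cycle:
  assumes "p \<noteq> []" "distinct p" "set p \<subseteq> verts H - {h}" "successively (adj H) p"
  shows "\<exists>q. cyclic (p @ q) \<and> set (p @ q) = verts H - {h} \<and> (\<forall>x\<in>verts H - {h}. {x, h} \<in> edges H)"
  using assms
proof (induction "card (verts H - {h}) - length p" arbitrary: p rule: less_induct)
  case less
  let ?L = "verts H - {h}"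
  have fin: "finite ?L" using hypergraphD(1)[OF hyp] by simp
  define z where "z = last p"
  have z: "z \<in> set p" "z \<in> ?L" using less.prems(1,3) last_in_set[of p] unfolding z_def by blast+
  show ?case
  proof (cases "\<exists>u\<in>?L - set p. adj H z u")
    case True
    then obtain u where u: "u \<in> ?L" "u \<notin> set p" "adj H z u" by blast
    have "length p < card ?L"
      using psubset_card_mono[OF fin, of "set p"] less.prems u distinct_card[of p] by auto
    then have "\<exists>q. cyclic ((p @ [u]) @ q) \<and> set ((p @ [u]) @ q) = ?L \<and> (\<forall>x\<in>?L. {x, h} \<in> edges H)"
      by (intro less.hyps) (use less.prems u in \<open>auto simp: successively_append_iff z_def\<close>)
    then obtain q where "cyclic ((p @ [u]) @ q) \<and> set ((p @ [u]) @ q) = ?L \<and> (\<forall>x\<in>?L. {x, h} \<in> edges H)" by blast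
    then show ?thesis by (intro exI[of _ "u # q"]) simp
  next
    case False
    have "\<not> {e \<in> edges H. z \<in> e} \<subseteq> {{z, h}}"
      using deg_eq[of z] z k3 card_mono[of "{{z, h}}" "{e \<in> edges H. z \<in> e}"] unfolding deg_def by auto
    then obtain e where e: "e \<in> edges H" "z \<in> e" "e \<noteq> {z, h}" by blast
    obtain y where y: "e = {z, y}" "z \<noteq> y" "y \<in> verts H" using edge_cases[OF e(1,2)] .
    then have "adj H z y" "y \<in> set p" using edge_adj e False by auto
    then have "\<exists>y\<in>set p. adj H z y" by blast
    then obtain r1 w r2 where r: "p = r1 @ w # r2" "adj H z w" "\<forall>v\<in>set r1. \<not> adj H z v"
      using split_list_first_prop[of p "adj H z"] by blast
    let ?C = "w # r2"
    have lastC: "last ?C = z" using r(1) by (simp add: z_def)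
    have C: "cyclic ?C" using less.prems r lastC
      by (auto simp: cyclic_def successively_append_iff)
    have "u = h" if "{z, u} \<in> edges H" "u \<notin> set ?C" for u
    proof (rule ccontr)
      assume "u \<noteq> h"
      have "z \<in> set ?C" using lastC by (metis last_in_set list.distinct(1))
      then have "adj H z u" using that edge_adj by auto
      moreover have "u \<in> verts H" using hypergraphD(3)[OF hyp that(1)] by simp
      ultimately have "u \<in> set p" using False \<open>u \<noteq> h\<close> by blast
      then show False using r that(2) \<open>adj H z u\<close> by auto
    qed
    moreover have "z \<in> set ?C" using lastC by (metis last_in_set list.distinct(1))
    ultimately have sp: "set ?C = ?L" "\<And>x. x \<in> set ?C \<Longrightarrow> {x, h} \<in> edges H"
      using cyclic_spanning[OF C, of z] by blast+
    have "set r1 \<subseteq> set ?C" using sp(1) less.prems(3) r(1) by auto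
    moreover have "set r1 \<inter> set ?C = {}" using less.prems(2) r(1) by auto
    ultimately have "set r1 = {}" by (simp add: inf.absorb1)
    then have "p = ?C" using r(1) by simp
    then show ?thesis using C sp by (intro exI[of _ "[]"]) auto
  qed
qed

lemma rim_nonempty: "verts H - {h} \<noteq> {}"
proof -
  obtain e where e: "e \<in> edges H" "h \<in> e" using criticalD(3)[OF crit h] by blast
  obtain y where "e = {h, y}" "h \<noteq> y" "y \<in> verts H" using edge_cases[OF e] .
  then show ?thesis by auto
qed

lemma spokes:
  assumes "x \<in> verts H - {h}"
  shows "{x, h} \<in> edges H"
proof -
  have "\<exists>q. cyclic ([x] @ q) \<and> set ([x] @ q) = verts H - {h} \<and> (\<forall>x\<in>verts H - {h}. {x, h} \<in> edges H)"
    by (rule extend_to_spanning_cycle) (use assms in auto)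
  then show ?thesis using assms by blast
qed

lemma deg_card:
  assumes "\<And>y. y \<in> verts H \<Longrightarrow> y \<noteq> x \<Longrightarrow> {x, y} \<in> edges H" "x \<in> verts H"
  shows "Suc (deg H x) = card (verts H)"
proof -
  have "{e \<in> edges H. x \<in> e} = (\<lambda>y. {x, y}) ` (verts H - {x})" (is "?A = ?B")
  proof
    show "?B \<subseteq> ?A" using assms by auto
    show "?A \<subseteq> ?B"
    proof
      fix e assume "e \<in> ?A"
      then have "e \<in> edges H" "x \<in> e" by auto
      then obtain y where "e = {x, y}" "x \<noteq> y" "y \<in> verts H" by (rule edge_cases)
      then show "e \<in> ?B" by auto
    qed
  qed
  moreover have "inj_on (\<lambda>y. {x, y}) (verts H - {x})" by (auto simp: inj_on_def doubleton_eq_iff)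
  ultimately have "deg H x = card (verts H - {x})" by (simp add: deg_def card_image)
  then show ?thesis using assms(2) hypergraphD(1)[OF hyp] by (metis card_Suc_Diff1)
qed

lemma deg_less_card: "x \<in> verts H \<Longrightarrow> deg H x < card (verts H)"
proof -
  assume x: "x \<in> verts H"
  have "{e \<in> edges H. x \<in> e} \<subseteq> (\<lambda>y. {x, y}) ` (verts H - {x})"
  proof
    fix e assume "e \<in> {e \<in> edges H. x \<in> e}"
    then have "e \<in> edges H" "x \<in> e" by auto
    then obtain y where "e = {x, y}" "x \<noteq> y" "y \<in> verts H" by (rule edge_cases)
    then show "e \<in> (\<lambda>y. {x, y}) ` (verts H - {x})" by auto
  qed
  then have "deg H x \<le> card (verts H - {x})"
    unfolding deg_def using hypergraphD(1)[OF hyp] surj_card_le by blast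
  also have "\<dots> < card (verts H)" by (rule card_Diff1_less[OF hypergraphD(1)[OF hyp] x])
  finally show ?thesis .
qed

text \<open>Otherwise there is an induced path \<open>x\<close>, \<open>y\<close>, \<open>z\<close>
  avoiding \<open>h\<close>, part of a spanning cycle. Colour \<open>x\<close> and \<open>z\<close>
  alike and \<open>y\<close> last, where the repeated colour helps. For the vertices in between, a
  further neighbour \<open>t\<close> of \<open>y\<close> is needed, towards which they can be
  coloured greedily; it exists because \<open>y\<close> has degree at least 4.\<close>

lemma rim_complete:
  assumes k4: "4 \<le> k" and xL: "x \<in> verts H - {h}" and wL: "w \<in> verts H - {h}" and xw: "x \<noteq> w"
  shows "{x, w} \<in> edges H"
proof (rule ccontr)
  assume nadj: "{x, w} \<notin> edges H"
  let ?L = "verts H - {h}"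
  define U where "U = {u \<in> ?L. u = x \<or> adj H x u}"
  have "\<exists>y\<in>U. \<exists>z\<in>?L - U. {y, z} \<in> edges H"
  proof (rule ccontr)
    assume none: "\<not> ?thesis"
    obtain e where e: "e \<in> edges H" using criticalD(3)[OF crit h] by blast
    show False
    proof (rule no_part[of U e])
      have "w \<notin> U" using nadj xw edge_adj unfolding U_def by auto
      then show "U \<noteq> ?L" using wL by metis
      fix f assume f: "f \<in> edges H" "f \<inter> U \<noteq> {}"
      then obtain a where a: "a \<in> f" "a \<in> U" by blast
      obtain b where b: "f = {a, b}" "b \<in> verts H" using edge_cases[OF f(1) a(1)] .
      then show "f \<subseteq> insert h U" using none a f(1) by auto
    qed (use xL e in \<open>auto simp: U_def\<close>)
  qed
  then obtain y z where yz: "y \<in> U" "z \<in> ?L" "z \<notin> U" "{y, z} \<in> edges H" by blast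
  then have y: "y \<in> ?L" "adj H x y" "y \<noteq> z" "adj H y z" "\<not> adj H x z" "x \<noteq> z" "x \<noteq> y"
    using edge_adj ordinary[OF yz(4)] unfolding U_def by (auto simp: adj_def)
  have "\<exists>q. cyclic ([x, y, z] @ q) \<and> set ([x, y, z] @ q) = ?L \<and> (\<forall>x\<in>?L. {x, h} \<in> edges H)"
    by (rule extend_to_spanning_cycle) (use xL y yz in auto)
  then obtain q where q: "cyclic ([x, y, z] @ q)" "set ([x, y, z] @ q) = ?L" by blast
  have "\<not> {e \<in> edges H. y \<in> e} \<subseteq> {{y, h}, {y, x}, {y, z}}"
    using card_mono[of "{{y, h}, {y, x}, {y, z}}" "{e \<in> edges H. y \<in> e}"] deg_eq[of y] y(1) k4
    unfolding deg_def by (auto simp: card_insert_if split: if_splits)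
  then obtain e where e: "e \<in> edges H" "y \<in> e" "e \<noteq> {y, h}" "e \<noteq> {y, x}" "e \<noteq> {y, z}" by blast
  obtain t where t: "e = {y, t}" "y \<noteq> t" "t \<in> verts H" using edge_cases[OF e(1,2)] .
  have "t \<noteq> h" "t \<noteq> x" "t \<noteq> z" using t(1) e(3-5) by blast+
  moreover from this have "t \<in> set ([x, y, z] @ q)" unfolding q(2) using t(3) by simp
  ultimately have tq: "t \<in> set q" using t(2) by simp
  then obtain q1 q2 where q12: "q = q1 @ t # q2" by (meson split_list)
  have yt: "adj H y t" using edge_adj e(1) t by blast
  have dist: "distinct ([x, y, z] @ q)" and hq: "h \<notin> set q" "h \<noteq> x" "h \<noteq> z" "h \<noteq> y"
    using q by (auto simp: cyclic_def)
  have deg: "deg H v \<le> k" if "v \<in> insert y (set q)" for v using that q(2) y(1) deg_le by auto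
  have succ: "successively (adj H) q" using q(1) by (auto simp: cyclic_def successively_append_iff successively_Cons)
  define \<phi> where "\<phi> v = (if v = h then 0 else 1 :: nat)" for v
  have 1: "pcol H k {h, x, z} \<phi>"
    unfolding pcol_def
  proof (intro conjI ballI impI notI)
    show "\<phi> v < k" for v using k3 by (simp add: \<phi>_def)
    fix f assume f: "f \<in> edges H" "f \<subseteq> {h, x, z}" "monochr \<phi> f"
    show False
    proof (cases "h \<in> f")
      case True
      then obtain v where "f = {h, v}" "h \<noteq> v" using edge_cases[OF f(1)] by metis
      then show False using monochrD[OF f(3), of h v] by (simp add: \<phi>_def)
    next
      case False
      then have "f \<subseteq> {x, z}" using f(2) by blast
      then have "f = {x, z}" using ordinary[OF f(1)] y(6) by (intro card_subset_eq) auto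
      then show False using f(1) y(5,6) edge_adj by simp
    qed
  qed
  \<comment> \<open>The stretch of the cycle before \<open>t\<close> is coloured towards
    \<open>t\<close>; afterwards the stretch behind \<open>t\<close> is coloured backwards, ending
    with \<open>t\<close> itself, whose neighbour \<open>y\<close> is still free.\<close>
  have "\<exists>\<psi>. (\<forall>v. v \<notin> set (butlast (q1 @ [t])) \<longrightarrow> \<psi> v = \<phi> v)
      \<and> pcol H k ({h, x, z} \<union> set (butlast (q1 @ [t]))) \<psi>"
    by (intro greedy_path[OF hyp 1])
      (use succ deg dist hq in \<open>auto simp: q12 successively_append_iff\<close>)
  then obtain \<psi>1 where \<psi>1: "\<And>v. v \<notin> set q1 \<Longrightarrow> \<psi>1 v = \<phi> v" "pcol H k ({h, x, z} \<union> set q1) \<psi>1" by auto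
  let ?p = "rev (t # q2) @ [y]"
  have "successively (adj H) (t # q2)" using succ by (auto simp: q12 successively_append_iff)
  then have "successively (\<lambda>a b. adj H b a) (t # q2)" by (rule successively_mono) (auto intro: adj_sym)
  then have "successively (adj H) (rev (t # q2))" by (simp only: successively_rev)
  then have "successively (adj H) ?p" using adj_sym[OF yt] by (simp add: successively_append_iff)
  then have "\<exists>\<psi>. (\<forall>v. v \<notin> set (butlast ?p) \<longrightarrow> \<psi> v = \<psi>1 v)
      \<and> pcol H k ({h, x, z} \<union> set q1 \<union> set (butlast ?p)) \<psi>"
    by (intro greedy_path[OF hyp \<psi>1(2)])
      (use deg dist hq in \<open>auto simp: q12\<close>)
  moreover have "set (butlast ?p) = set (t # q2)" by (simp only: butlast_snoc set_rev)
  ultimately obtain \<psi> where \<psi>: "\<And>v. v \<notin> set (t # q2) \<Longrightarrow> \<psi> v = \<psi>1 v"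
    "pcol H k ({h, x, z} \<union> set q1 \<union> set (t # q2)) \<psi>" by metis
  have D: "{h, x, z} \<union> set q1 \<union> set (t # q2) = verts H - {y}"
  proof -
    have "verts H = insert h (insert y ({x, z} \<union> set q1 \<union> set (t # q2)))" using q(2) h by (auto simp: q12)
    moreover have "y \<notin> {h, x, z} \<union> set q1 \<union> set (t # q2)" using dist hq by (auto simp: q12)
    ultimately show ?thesis by auto
  qed
  have "\<psi> x = 1" "\<psi> z = 1" using \<psi>(1) \<psi>1(1) dist hq by (auto simp: q12 \<phi>_def)
  then have "\<exists>c<k. pcol H k (insert y (verts H - {y})) (\<psi>(y := c))"
    using y yz(4) edge_adj[of x y] deg
    by (intro extend_repeated_color[OF hyp \<psi>(2)[unfolded D], of y "{y, x}" "{y, z}" x z])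
      (auto simp: doubleton_eq_iff insert_commute)
  moreover have "insert y (verts H - {y}) = verts H" using y(1) by blast
  ultimately show False using not_colored by auto
qed

lemma complete_iso:
  assumes k4: "4 \<le> k"
  shows "iso_hg H (complete_graph (Suc k))"
proof -
  have all: "{x, y} \<in> edges H" if "x \<in> verts H" "y \<in> verts H" "x \<noteq> y" for x y
    using rim_complete[OF k4, of x y] spokes[of x] spokes[of y] that by (cases "x = h"; cases "y = h") (auto simp: insert_commute)
  obtain x where x: "x \<in> verts H - {h}" using rim_nonempty by blast
  have "card (verts H) = Suc k" using deg_card[of x] all x deg_eq[of x] by simp
  then obtain f where f: "bij_betw f (verts H) {0..<Suc k}"
    using ex_bij_betw_finite_nat[OF hypergraphD(1)[OF hyp]] by auto
  have E: "edges H = {e. e \<subseteq> verts H \<and> card e = 2}"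
    using hypergraphD(3)[OF hyp] ordinary all by (auto simp: card_2_iff)
  have inj: "inj_on f (verts H)" and im: "f ` verts H = {0..<Suc k}" using f by (auto simp: bij_betw_def)
  have "{e. e \<subseteq> {0..<Suc k} \<and> card e = 2} = (`) f ` edges H" (is "?K = ?M")
  proof
    show "?M \<subseteq> ?K" using E inj im card_image inj_on_subset by fastforce
    show "?K \<subseteq> ?M"
    proof
      fix e assume e: "e \<in> ?K"
      then obtain d where d: "d \<subseteq> verts H" "e = f ` d" using im by (metis (no_types, lifting) mem_Collect_eq subset_imageE)
      then have "card d = 2" using e card_image[OF inj_on_subset[OF inj d(1)]] by simp
      then show "e \<in> ?M" using d E by blast
    qed
  qed
  then show ?thesis using f unfolding iso_hg_def complete_graph_def by auto
qed

text \<open>Every edge has an end on the rim, and a rim vertex has degree 3, so its two neighbours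
  on the spanning cycle and \<open>h\<close> account for all its edges. An even rim would be
  coloured alternately with 0 and 1, and \<open>h\<close> with 2.\<close>

lemma wheel_iso:
  assumes k: "k = 3"
  shows "\<exists>n. odd n \<and> 3 \<le> n \<and> iso_hg (odd_wheel n) H"
proof -
  let ?L = "verts H - {h}"
  obtain x0 where x0: "x0 \<in> ?L" using rim_nonempty by blast
  have "\<exists>q. cyclic ([x0] @ q) \<and> set ([x0] @ q) = ?L \<and> (\<forall>x\<in>?L. {x, h} \<in> edges H)"
    by (rule extend_to_spanning_cycle) (use x0 in auto)
  then obtain C where C: "cyclic C" "set C = ?L" by blast
  define n where "n = length C"
  have dist: "distinct C" and Cne: "C \<noteq> []" using C(1) by (auto simp: cyclic_def)
  have "card ?L = n" using C(2) dist distinct_card unfolding n_def by metis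
  then have cV: "card (verts H) = Suc n" using h hypergraphD(1)[OF hyp] by (metis card_Suc_Diff1)
  have n3: "3 \<le> n" using deg_less_card[of x0] deg_eq[of x0] x0 k cV by auto
  have inj: "C ! i = C ! j \<longleftrightarrow> i = j" if "i < n" "j < n" for i j
    using that dist by (simp add: n_def nth_eq_iff_index_eq)
  have CL: "C ! i \<in> ?L" if "i < n" for i using that C(2) by (metis n_def nth_mem)
  have next_edge: "{C ! i, C ! Suc i} \<in> edges H" if "Suc i < n" for i
    using C(1) that edge_adj unfolding cyclic_def n_def successively_conv_nth by blast
  have wrap: "{C ! (n - 1), C ! 0} \<in> edges H"
    using C(1) edge_adj Cne unfolding cyclic_def n_def by (simp add: last_conv_nth hd_conv_nth)
  define E0 where "E0 = {{C ! i, C ! Suc i} | i. Suc i < n} \<union> {{C ! (n - 1), C ! 0}} \<union> {{h, C ! i} | i. i < n}"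
  have E0E: "E0 \<subseteq> edges H"
  proof
    fix e assume "e \<in> E0"
    then consider i where "Suc i < n" "e = {C ! i, C ! Suc i}" | "e = {C ! (n - 1), C ! 0}"
      | i where "i < n" "e = {h, C ! i}" unfolding E0_def by blast
    then show "e \<in> edges H"
      using next_edge wrap spokes[OF CL] by cases (simp_all add: insert_commute)
  qed
  have EE0: "edges H \<subseteq> E0"
  proof
    fix e assume e: "e \<in> edges H"
    obtain x where x: "x \<in> e" "x \<noteq> h" using hypergraphD(7)[OF hyp e, of h] by blast
    then have "x \<in> set C" using hypergraphD(3)[OF hyp e] C(2) by blast
    then obtain i where i: "i < n" "x = C ! i" by (metis in_set_conv_nth n_def)
    define j where "j = (if i = n - 1 then 0 else Suc i)"
    define l where "l = (if i = 0 then n - 1 else i - 1)"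
    have jl: "j < n" "l < n" "i \<noteq> j" "i \<noteq> l" "j \<noteq> l" using i(1) n3 by (auto simp: j_def l_def)
    have "{x, C ! j} \<in> E0"
      using i n3 unfolding E0_def j_def by (cases "i = n - 1") auto
    moreover have "{x, C ! l} \<in> E0"
    proof (cases "i = 0")
      case True
      then show ?thesis using i unfolding E0_def l_def by (auto simp: insert_commute)
    next
      case False
      then have "{C ! (i - 1), C ! Suc (i - 1)} \<in> E0" using i(1) unfolding E0_def by auto
      then show ?thesis using False i unfolding l_def by (simp add: insert_commute)
    qed
    moreover have "{x, h} \<in> E0" using i unfolding E0_def by (auto simp: insert_commute)
    ultimately have sub: "{{x, h}, {x, C ! j}, {x, C ! l}} \<subseteq> E0" by simp
    have "C ! j \<noteq> h" "C ! l \<noteq> h" "C ! j \<noteq> C ! l" using CL jl inj by auto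
    then have c3: "card {{x, h}, {x, C ! j}, {x, C ! l}} = 3" by (simp add: doubleton_eq_iff)
    have "{{x, h}, {x, C ! j}, {x, C ! l}} = {e \<in> edges H. x \<in> e}"
    proof (rule card_subset_eq)
      show "finite {e \<in> edges H. x \<in> e}" using hypergraphD(2)[OF hyp] by simp
      show "{{x, h}, {x, C ! j}, {x, C ! l}} \<subseteq> {e \<in> edges H. x \<in> e}" using sub E0E by auto
      show "card {{x, h}, {x, C ! j}, {x, C ! l}} = card {e \<in> edges H. x \<in> e}"
        using c3 deg_eq[of x] x i CL k unfolding deg_def by auto
    qed
    then show "e \<in> E0" using sub e x(1) by blast
  qed
  have E: "edges H = E0" using EE0 E0E by blast
  have "odd n"
  proof
    assume ev: "even n"
    define pos where "pos v = (THE i. i < n \<and> C ! i = v)" for v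
    have pos: "pos (C ! i) = i" if "i < n" for i
      unfolding pos_def by (rule the_equality) (use that inj in auto)
    define \<psi> where "\<psi> v = (if v = h then 2 else pos v mod 2)" for v
    have \<psi>C: "\<psi> (C ! i) = i mod 2" if "i < n" for i using that pos CL by (auto simp: \<psi>_def)
    have "pcol H k (verts H) \<psi>"
      unfolding pcol_def
    proof (intro conjI ballI impI notI)
      show "\<psi> v < k" for v using k mod_less_divisor[of 2 "pos v"] by (auto simp: \<psi>_def simp del: mod_less_divisor)
      fix e assume e: "e \<in> edges H" "monochr \<psi> e"
      then consider i where "Suc i < n" "e = {C ! i, C ! Suc i}" | "e = {C ! (n - 1), C ! 0}"
        | i where "i < n" "e = {h, C ! i}" unfolding E E0_def by blast
      then show False
      proof cases
        case (1 i)
        then have "i mod 2 = Suc i mod 2" using monochrD[OF e(2), of "C ! i" "C ! Suc i"] \<psi>C[of i] \<psi>C[of "Suc i"] by simp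
        then show False by presburger
      next
        case 2
        then have "(n - 1) mod 2 = 0 mod 2"
          using monochrD[OF e(2), of "C ! (n - 1)" "C ! 0"] \<psi>C[of "n - 1"] \<psi>C[of 0] n3 by simp
        then show False using ev n3 by presburger
      next
        case (3 i)
        then have "2 = i mod 2" using monochrD[OF e(2), of h "C ! i"] \<psi>C[of i] by (simp add: \<psi>_def)
        then show False by presburger
      qed
    qed
    then show False using not_colored by blast
  qed
  moreover have "iso_hg (odd_wheel n) H"
  proof -
    define g where "g i = (if i = 0 then h else C ! (i - 1))" for i
    have "inj_on g {0..n}"
    proof (rule inj_onI)
      fix i j assume ij: "i \<in> {0..n}" "j \<in> {0..n}" "g i = g j"
      have "C ! (i - 1) \<noteq> h" if "i \<noteq> 0" "i \<le> n" for i using CL[of "i - 1"] that by auto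
      then show "i = j" using ij inj[of "i - 1" "j - 1"] by (auto simp: g_def split: if_splits)
    qed
    moreover have "g ` {0..n} = verts H"
    proof
      show "g ` {0..n} \<subseteq> verts H" using CL h by (auto simp: g_def)
      show "verts H \<subseteq> g ` {0..n}"
      proof
        fix v assume v: "v \<in> verts H"
        show "v \<in> g ` {0..n}"
        proof (cases "v = h")
          case True
          then show ?thesis by (auto simp: g_def image_iff)
        next
          case False
          then have "v \<in> set C" using v C(2) by simp
          then obtain i where "i < n" "v = C ! i" by (metis in_set_conv_nth n_def)
          then show ?thesis by (intro image_eqI[of _ _ "Suc i"]) (auto simp: g_def)
        qed
      qed
    qed
    moreover have "edges H = (\<lambda>e. g ` e) ` edges (odd_wheel n)"
    proof -
      have 1: "(\<lambda>e. g ` e) ` {{i, Suc i} | i. 1 \<le> i \<and> i < n} = {{C ! i, C ! Suc i} | i. Suc i < n}" (is "?l = ?r")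
      proof
        show "?l \<subseteq> ?r"
        proof
          fix e assume "e \<in> ?l"
          then obtain i where i: "1 \<le> i" "i < n" "e = g ` {i, Suc i}" by blast
          then have "e = {C ! (i - 1), C ! Suc (i - 1)}" "Suc (i - 1) < n" by (auto simp: g_def)
          then show "e \<in> ?r" by blast
        qed
        show "?r \<subseteq> ?l"
        proof
          fix e assume "e \<in> ?r"
          then obtain i where i: "Suc i < n" "e = {C ! i, C ! Suc i}" by blast
          then have "e = g ` {Suc i, Suc (Suc i)}" "1 \<le> Suc i" by (auto simp: g_def)
          then show "e \<in> ?l" using i(1) by blast
        qed
      qed
      have 2: "(\<lambda>e. g ` e) ` {{n, 1}} = {{C ! (n - 1), C ! 0}}" using n3 by (auto simp: g_def)
      have 3: "(\<lambda>e. g ` e) ` {{0, i} | i. 1 \<le> i \<and> i \<le> n} = {{h, C ! i} | i. i < n}" (is "?l = ?r")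
      proof
        show "?l \<subseteq> ?r"
        proof
          fix e assume "e \<in> ?l"
          then obtain i where i: "1 \<le> i" "i \<le> n" "e = g ` {0, i}" by blast
          then have "e = {h, C ! (i - 1)}" "i - 1 < n" by (auto simp: g_def)
          then show "e \<in> ?r" by blast
        qed
        show "?r \<subseteq> ?l"
        proof
          fix e assume "e \<in> ?r"
          then obtain i where i: "i < n" "e = {h, C ! i}" by blast
          then have "e = g ` {0, Suc i}" "1 \<le> Suc i" "Suc i \<le> n" by (auto simp: g_def)
          then show "e \<in> ?l" by blast
        qed
      qed
      show ?thesis unfolding E E0_def odd_wheel_def edges_pair image_Un 1 2 3 ..
    qed
    ultimately show ?thesis unfolding iso_hg_def bij_betw_def by (auto simp: odd_wheel_def)
  qed
  ultimately show ?thesis using n3 by blast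
qed

end

section \<open>The class of Hajos joins\<close>

lemma iso_hg_sym:
  assumes "hypergraph G" "iso_hg G H"
  shows "iso_hg H G"
proof -
  obtain f where f: "bij_betw f (verts G) (verts H)" "edges H = (\<lambda>e. f ` e) ` edges G"
    using assms(2) by (auto simp: iso_hg_def)
  let ?g = "the_inv_into (verts G) f"
  have "?g ` f ` e = e" if "e \<in> edges G" for e
  proof -
    have "e \<subseteq> verts G" using hypergraphD(3)[OF assms(1) that] .
    then have "?g (f x) = x" if "x \<in> e" for x
      using that f(1) by (auto simp: bij_betw_def the_inv_into_f_f)
    then show ?thesis by (auto simp: image_image)
  qed
  then have "(\<lambda>e. ?g ` e) ` (\<lambda>e. f ` e) ` edges G = edges G" by (simp add: image_image)
  then show ?thesis using f bij_betw_the_inv_into[OF f(1)] unfolding iso_hg_def by metis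
qed

lemma monochr_image: "monochr \<phi> (f ` e) \<longleftrightarrow> monochr (\<phi> \<circ> f) e"
  by (simp add: monochr_def)

lemma colorable_iso:
  assumes "iso_hg G H" "colorable H k"
  shows "colorable G k"
proof -
  obtain f where f: "bij_betw f (verts G) (verts H)" "edges H = (\<lambda>e. f ` e) ` edges G"
    using assms(1) by (auto simp: iso_hg_def)
  obtain \<phi> where \<phi>: "pcol H k (verts H) \<phi>" using assms(2) by (auto simp: colorable_def)
  have "pcol G k (verts G) (\<phi> \<circ> f)"
    unfolding pcol_def
  proof (intro conjI ballI impI notI)
    show "(\<phi> \<circ> f) v < k" if "v \<in> verts G" for v
      using that f(1) pcolD(1)[OF \<phi>, of "f v"] by (auto simp: bij_betw_def)
    fix e assume e: "e \<in> edges G" "e \<subseteq> verts G" "monochr (\<phi> \<circ> f) e"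
    then have "f ` e \<in> edges H" "f ` e \<subseteq> verts H"
      using f(2) image_mono[of e "verts G" f] bij_betw_imp_surj_on[OF f(1)] by auto
    moreover have "monochr \<phi> (f ` e)" using e(3) unfolding monochr_image .
    ultimately show False using pcolD(2)[OF \<phi>] by blast
  qed
  then show ?thesis by (auto simp: colorable_def)
qed

text \<open>The hub leaves two colours for the rim, which must alternate. So all odd positions share
  the colour of position 1, among them \<open>n\<close>, which is adjacent to it.\<close>

lemma odd_wheel_not_colorable:
  assumes n: "odd n" "3 \<le> n"
  shows "\<not> colorable (odd_wheel n) 3"
proof
  assume "colorable (odd_wheel n) 3"
  then obtain \<phi> where \<phi>: "pcol (odd_wheel n) 3 {0..n} \<phi>" by (auto simp: colorable_def odd_wheel_def)
  have ne: "\<phi> i \<noteq> \<phi> j" if "{i, j} \<in> edges (odd_wheel n)" "i \<le> n" "j \<le> n" for i j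
    using pcolD(2)[OF \<phi> that(1)] that(2,3) by (auto simp: monochr_def)
  have lt: "\<phi> i < 3" if "i \<le> n" for i using pcolD(1)[OF \<phi>, of i] that by simp
  have hub: "\<phi> 0 \<noteq> \<phi> i" if "1 \<le> i" "i \<le> n" for i
    using ne[of 0 i] that by (auto simp: odd_wheel_def)
  have rim: "\<phi> i \<noteq> \<phi> (Suc i)" if "1 \<le> i" "i < n" for i
    using ne[of i "Suc i"] that by (auto simp: odd_wheel_def)
  have par: "2 * m + 1 \<le> n \<Longrightarrow> \<phi> (2 * m + 1) = \<phi> 1" for m
  proof (induction m)
    case (Suc m)
    let ?i = "2 * m + 1"
    have "\<phi> ?i \<noteq> \<phi> (Suc ?i)" "\<phi> (Suc ?i) \<noteq> \<phi> (Suc (Suc ?i))" using rim[of ?i] rim[of "Suc ?i"] Suc.prems by auto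
    moreover have "\<phi> 0 \<noteq> \<phi> ?i" "\<phi> 0 \<noteq> \<phi> (Suc ?i)" "\<phi> 0 \<noteq> \<phi> (Suc (Suc ?i))"
      using hub[of ?i] hub[of "Suc ?i"] hub[of "Suc (Suc ?i)"] Suc.prems by auto
    moreover have "\<phi> 0 < 3" "\<phi> ?i < 3" "\<phi> (Suc ?i) < 3" "\<phi> (Suc (Suc ?i)) < 3"
      using lt[of 0] lt[of ?i] lt[of "Suc ?i"] lt[of "Suc (Suc ?i)"] Suc.prems by auto
    ultimately have "\<phi> (Suc (Suc ?i)) = \<phi> ?i" by linarith
    then show ?case using Suc by simp
  qed simp
  obtain m where m: "n = 2 * m + 1" using n(1) by (auto elim: oddE)
  have "\<phi> n = \<phi> 1" using par[of m] m by simp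
  moreover have "{n, 1} \<in> edges (odd_wheel n)" by (simp add: odd_wheel_def)
  then have "\<phi> n \<noteq> \<phi> 1" using ne[of n 1] n(2) by simp
  ultimately show False by simp
qed

lemma complete_graph_not_colorable: "\<not> colorable (complete_graph (Suc k)) k"
proof
  assume "colorable (complete_graph (Suc k)) k"
  then obtain \<phi> where \<phi>: "pcol (complete_graph (Suc k)) k {0..<Suc k} \<phi>"
    by (auto simp: colorable_def complete_graph_def)
  have "inj_on \<phi> {0..<Suc k}"
  proof (rule inj_onI, rule ccontr)
    fix i j assume ij: "i \<in> {0..<Suc k}" "j \<in> {0..<Suc k}" "\<phi> i = \<phi> j" "i \<noteq> j"
    then have "{i, j} \<in> edges (complete_graph (Suc k))" by (auto simp: complete_graph_def)
    then show False using pcolD(2)[OF \<phi>, of "{i, j}"] ij by (auto simp: monochr_def)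
  qed
  moreover have "\<phi> ` {0..<Suc k} \<subseteq> {..<k}" using pcolD(1)[OF \<phi>] by auto
  ultimately have "card {0..<Suc k} \<le> card {..<k}" by (rule card_inj_on_le) simp
  then show False by simp
qed

text \<open>A colouring of the join fails on \<open>G1\<close> only at \<open>e1\<close> and on
  \<open>G2\<close> only at \<open>e2\<close>, so both are monochromatic in the colour of the
  identified vertex. Then so is the new edge, whether or not it contains that vertex.\<close>

lemma hajos_join_not_colorable:
  assumes n1: "\<not> colorable G1 k" and n2: "\<not> colorable G2 k" and disj: "verts G1 \<inter> verts G2 = {}"
    and e1: "e1 \<in> edges G1" "v1 \<in> e1" and e2: "e2 \<in> edges G2" "v2 \<in> e2"
  shows "\<not> colorable (hajos_join G1 v1 e1 G2 v2 e2 b) k"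
proof
  let ?J = "hajos_join G1 v1 e1 G2 v2 e2 b"
  define r where "r x = (if x = v2 then v1 else x)" for x
  define es where "es = (e1 \<union> e2) - {v1, v2} \<union> (if b then {v1} else {})"
  have J: "verts ?J = verts G1 \<union> r ` verts G2"
    "edges ?J = (edges G1 - {e1}) \<union> (\<lambda>e. r ` e) ` (edges G2 - {e2}) \<union> {es}"
    by (simp_all add: hajos_join_def Let_def r_def[abs_def] es_def)
  assume "colorable ?J k"
  then obtain \<phi> where \<phi>: "pcol ?J k (verts ?J) \<phi>" by (auto simp: colorable_def)
  \<comment> \<open>The inclusion is part of the claim because \<open>G1\<close> is not assumed to
    be a hypergraph, and \<open>pcol\<close> puts no condition on an edge that leaves the vertex
    set.\<close>
  have c1: "e1 \<subseteq> verts G1 \<and> monochr \<phi> e1"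
  proof (rule ccontr)
    assume a: "\<not> ?thesis"
    have "pcol G1 k (verts G1) \<phi>"
      unfolding pcol_def
    proof (intro conjI ballI impI)
      show "\<phi> v < k" if "v \<in> verts G1" for v using pcolD(1)[OF \<phi>, of v] that J by simp
      fix e assume e: "e \<in> edges G1" "e \<subseteq> verts G1"
      show "\<not> monochr \<phi> e"
      proof (cases "e = e1")
        case False
        then show ?thesis using pcolD(2)[OF \<phi>, of e] e J by auto
      qed (use a e in simp)
    qed
    then show False using n1 by (auto simp: colorable_def)
  qed
  have c2: "e2 \<subseteq> verts G2 \<and> monochr (\<phi> \<circ> r) e2"
  proof (rule ccontr)
    assume a: "\<not> ?thesis"
    have "pcol G2 k (verts G2) (\<phi> \<circ> r)"
      unfolding pcol_def
    proof (intro conjI ballI impI)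
      show "(\<phi> \<circ> r) v < k" if "v \<in> verts G2" for v using pcolD(1)[OF \<phi>, of "r v"] that J by simp
      fix e assume e: "e \<in> edges G2" "e \<subseteq> verts G2"
      show "\<not> monochr (\<phi> \<circ> r) e"
      proof (cases "e = e2")
        case False
        then have "r ` e \<in> edges ?J" unfolding J(2) using e(1) by blast
        moreover have "r ` e \<subseteq> verts ?J" unfolding J(1) using e(2) by blast
        ultimately have "\<not> monochr \<phi> (r ` e)" by (rule pcolD(2)[OF \<phi>])
        then show ?thesis unfolding monochr_image .
      qed (use a e in simp)
    qed
    then show False using n2 by (auto simp: colorable_def)
  qed
  have "\<phi> x = \<phi> v1" if "x \<in> es" for x
  proof (cases "x \<in> e1")
    case True
    then show ?thesis using monochrD[OF conjunct2[OF c1] _ e1(2)] by simp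
  next
    case False
    then have "x \<in> e2" "x \<noteq> v2" using that e1 by (auto simp: es_def split: if_splits)
    then show ?thesis using monochrD[OF conjunct2[OF c2] _ e2(2), of x] by (simp add: r_def)
  qed
  then have "monochr \<phi> es" unfolding monochr_def by simp
  moreover have "es \<in> edges ?J" by (simp add: J)
  moreover have "es \<subseteq> verts ?J"
  proof
    fix x assume x: "x \<in> es"
    show "x \<in> verts ?J"
    proof (cases "x \<in> e1")
      case False
      then have "x \<in> e2" "x \<noteq> v2" using x e1 by (auto simp: es_def split: if_splits)
      then have "x \<in> verts G2" "x = r x" using c2 by (auto simp: r_def)
      then show ?thesis unfolding J by blast
    qed (use c1 J in auto)
  qed
  ultimately show False using pcolD(2)[OF \<phi>] by blast
qed

lemma hajos_class_not_colorable: "G \<in> hajos_class k \<Longrightarrow> \<not> colorable G k"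
proof (induction rule: hajos_class.induct)
  case (join G1 G2 e1 v1 e2 v2 b)
  then show ?case by (intro hajos_join_not_colorable)
qed (use odd_wheel_not_colorable complete_graph_not_colorable colorable_iso in \<open>simp, simp, blast\<close>)

lemma in_H_not_colorable:
  assumes "hypergraph B" "in_H k B"
  shows "\<not> colorable B k"
  using assms hajos_class_not_colorable colorable_iso iso_hg_sym unfolding in_H_def by blast

text \<open>Up to isomorphism \<open>H\<close> is the Hajos join of its two glued parts at their new
  edges. The flag of the join records whether \<open>v \<in> e\<close>.\<close>

lemma in_H_sep:
  assumes crit: "critical H k" and k: "3 \<le> k" and s: "sep H v e V1 V2"
    and in1: "in_H k (glue H V1 (insert v (e \<inter> V1)))" and in2: "in_H k (glue H V2 (insert v (e \<inter> V2)))"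
  shows "in_H k H"
proof -
  note hyp = criticalD(1)[OF crit]
  let ?A1 = "insert v (e \<inter> V1)" and ?A2 = "insert v (e \<inter> V2)"
  define E1 where "E1 = {f \<in> edges H. f \<subseteq> V1}"
  define E2 where "E2 = {f \<in> edges H. f \<subseteq> V2}"
  have V: "V1 \<union> V2 = verts H" "V1 \<inter> V2 = {v}" "v \<in> V1" "v \<in> V2" using sepD[OF s] by auto
  have AE: "?A1 \<notin> E1" "?A2 \<notin> E2"
    using sep_parts(2)[OF crit k s] sep_parts(2)[OF crit k sep_sym[OF s]] by (auto simp: E1_def E2_def)
  have E: "edges H = E1 \<union> E2 \<union> {e}" using sepD(1,10)[OF s] by (auto simp: E1_def E2_def)
  have eV: "e \<subseteq> V1 \<union> V2" using hypergraphD(3)[OF hyp sepD(1)[OF s]] V(1) by simp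
  obtain K1 f1 where K1: "K1 \<in> hajos_class k" and f1: "bij_betw f1 V1 (verts K1)"
    "edges K1 = (\<lambda>e. f1 ` e) ` insert ?A1 E1"
    using in1 by (auto simp: in_H_def iso_hg_def edges_glue E1_def)
  obtain K2 f2 where K2: "K2 \<in> hajos_class k" and f2: "bij_betw f2 V2 (verts K2)"
    "edges K2 = (\<lambda>e. f2 ` e) ` insert ?A2 E2"
    using in2 by (auto simp: in_H_def iso_hg_def edges_glue E2_def)
  have "finite V1" using hypergraphD(1)[OF hyp] V(1) by (metis finite_Un)
  then have "finite (verts K1)" using f1(1) bij_betw_finite by blast
  \<comment> \<open>The representatives of the two parts live on natural numbers and may overlap;
    adding \<open>N\<close> moves the second one past the first.\<close>
  then obtain N where N: "\<And>x. x \<in> verts K1 \<Longrightarrow> x < N" by (auto simp: finite_nat_set_iff_bounded)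
  define K2' :: "nat hgraph" where "K2' = ((+) N ` verts K2, (\<lambda>e. (+) N ` e) ` edges K2)"
  have "iso_hg K2 K2'" unfolding iso_hg_def K2'_def
    by (intro exI[of _ "(+) N"]) (simp add: bij_betw_def inj_on_def)
  then have K2'c: "K2' \<in> hajos_class k" using K2 hajos_class.iso by blast
  define f2' where "f2' = (+) N \<circ> f2"
  have f2': "bij_betw f2' V2 (verts K2')"
    unfolding f2'_def using f2(1) by (rule bij_betw_trans) (simp add: K2'_def bij_betw_def inj_on_def)
  have edges2': "edges K2' = (\<lambda>e. f2' ` e) ` insert ?A2 E2"
    unfolding K2'_def f2'_def edges_pair f2(2) by (simp add: image_image image_comp)
  have disj: "verts K1 \<inter> verts K2' = {}" by (auto simp: K2'_def dest!: N)
  have inj1: "inj_on f1 V1" and im1: "f1 ` V1 = verts K1" using f1(1) by (auto simp: bij_betw_def)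
  have inj2: "inj_on f2' V2" and im2: "f2' ` V2 = verts K2'" using f2' by (auto simp: bij_betw_def)
  let ?v1 = "f1 v" and ?e1 = "f1 ` ?A1" and ?v2 = "f2' v" and ?e2 = "f2' ` ?A2"
  define J where "J = hajos_join K1 ?v1 ?e1 K2' ?v2 ?e2 (v \<in> e)"
  have "J \<in> hajos_class k" unfolding J_def
    by (rule hajos_class.join[OF K1 K2'c disj]) (use f1(2) edges2' in auto)
  moreover have "iso_hg H J"
  proof -
    \<comment> \<open>The two maps disagree at \<open>v\<close>. The renaming \<open>r\<close> of
      the join sends \<open>f2' v\<close> to \<open>f1 v\<close>, so that \<open>g\<close> equals
      \<open>r\<close> after \<open>f2'\<close> on all of \<open>V2\<close>.\<close>
    define g where "g x = (if x \<in> V1 then f1 x else f2' x)" for x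
    define r where "r x = (if x = ?v2 then ?v1 else x)" for x
    define es where "es = (?e1 \<union> ?e2) - {?v1, ?v2} \<union> (if v \<in> e then {?v1} else {})"
    have J: "verts J = verts K1 \<union> r ` verts K2'"
      "edges J = (edges K1 - {?e1}) \<union> (\<lambda>e. r ` e) ` (edges K2' - {?e2}) \<union> {es}"
      by (simp_all only: J_def hajos_join_def Let_def r_def[abs_def] es_def verts_pair edges_pair)
    have g1: "g x = f1 x" if "x \<in> V1" for x using that by (simp add: g_def)
    have g2: "g x = r (f2' x)" if "x \<in> V2" for x
    proof (cases "x = v")
      case True
      then show ?thesis using V(3) by (simp add: g_def r_def)
    next
      case False
      then have "x \<notin> V1" using that V(2) by blast
      moreover have "f2' x \<noteq> ?v2" using inj_onD[OF inj2 _ that V(4)] False by blast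
      ultimately show ?thesis by (simp add: g_def r_def)
    qed
    have g2': "g x = f2' x" if "x \<in> V2" "x \<noteq> v" for x using that V(2) by (auto simp: g_def)
    have gK: "x \<in> V1 \<Longrightarrow> g x \<in> verts K1" "x \<in> V2 \<Longrightarrow> x \<noteq> v \<Longrightarrow> g x \<in> verts K2'" for x
      using g1 g2' im1 im2 by auto
    have inj: "inj_on g (verts H)"
    proof (rule inj_onI)
      fix x y assume xy: "x \<in> verts H" "y \<in> verts H" "g x = g y"
      consider "x \<in> V1" "y \<in> V1" | "x \<in> V2" "x \<noteq> v" "y \<in> V2" "y \<noteq> v"
        | "x \<in> V1" "y \<in> V2" "y \<noteq> v" | "y \<in> V1" "x \<in> V2" "x \<noteq> v" using xy V by blast
      then show "x = y"
      proof cases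
        case 1
        then show ?thesis using xy(3) g1 inj_onD[OF inj1] by metis
      next
        case 2
        then show ?thesis using xy(3) g2' inj_onD[OF inj2] by metis
      next
        case 3
        then show ?thesis using gK[of x] gK[of y] xy(3) disj by auto
      next
        case 4
        then show ?thesis using gK[of x] gK[of y] xy(3) disj by auto
      qed
    qed
    have "g ` V1 = verts K1" "g ` V2 = r ` verts K2'"
      unfolding im1[symmetric] im2[symmetric] image_image using g1 g2 by (auto cong: image_cong)
    then have vJ: "verts J = g ` verts H" unfolding J V(1)[symmetric] by auto
    have "edges K1 - {?e1} = (\<lambda>e. f1 ` e) ` E1"
    proof -
      have "f1 ` f \<noteq> ?e1" if "f \<in> E1" for f
      proof
        assume "f1 ` f = ?e1"
        then have "f = ?A1" using inj_on_image_eq_iff[OF inj1, of f ?A1] that V(3) by (auto simp: E1_def)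
        then show False using that AE by simp
      qed
      then show ?thesis unfolding f1(2) by blast
    qed
    moreover have "f1 ` f = g ` f" if "f \<in> E1" for f
      by (rule image_cong) (use that g1 in \<open>auto simp: E1_def\<close>)
    ultimately have 1: "edges K1 - {?e1} = (\<lambda>e. g ` e) ` E1" by simp
    have 3: "edges K2' - {?e2} = (\<lambda>e. f2' ` e) ` E2"
    proof -
      have "f2' ` f \<noteq> ?e2" if "f \<in> E2" for f
      proof
        assume "f2' ` f = ?e2"
        then have "f = ?A2" using inj_on_image_eq_iff[OF inj2, of f ?A2] that V(4) by (auto simp: E2_def)
        then show False using that AE by simp
      qed
      then show ?thesis unfolding edges2' by blast
    qed
    have "(\<lambda>e. r ` e) ` (edges K2' - {?e2}) = (\<lambda>e. r ` f2' ` e) ` E2" unfolding 3 by (rule image_image)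
    moreover have "r ` f2' ` f = g ` f" if "f \<in> E2" for f
      unfolding image_image by (rule image_cong) (use that g2 in \<open>auto simp: E2_def\<close>)
    ultimately have 2: "(\<lambda>e. r ` e) ` (edges K2' - {?e2}) = (\<lambda>e. g ` e) ` E2"
      by (metis (no_types, lifting) image_cong)
    have diff: "A - {a, b} = A - {a}" if "b \<notin> A" for A and a b :: nat using that by blast
    have "?e1 - {?v1, ?v2} = g ` (e \<inter> V1 - {v})"
    proof -
      have "?v2 \<notin> verts K1" using disj im2 V(4) by blast
      moreover have "?e1 \<subseteq> verts K1" unfolding im1[symmetric] by (rule image_mono) (use V(3) in auto)
      ultimately have "?e1 - {?v1, ?v2} = ?e1 - {?v1}" by (intro diff) blast
      also have "\<dots> = ?e1 - f1 ` {v}" by (simp only: image_insert image_empty)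
      also have "\<dots> = f1 ` (?A1 - {v})"
        by (rule inj_on_image_set_diff[OF inj1, symmetric]) (use V(3) in auto)
      also have "?A1 - {v} = e \<inter> V1 - {v}" by auto
      also have "f1 ` \<dots> = g ` \<dots>" by (rule image_cong[OF refl], rule g1[symmetric]) simp
      finally show ?thesis .
    qed
    moreover have "?e2 - {?v1, ?v2} = g ` (e \<inter> V2 - {v})"
    proof -
      have "?v1 \<notin> verts K2'" using disj im1 V(3) by blast
      moreover have "?e2 \<subseteq> verts K2'" unfolding im2[symmetric] by (rule image_mono) (use V(4) in auto)
      ultimately have "?e2 - {?v1, ?v2} = ?e2 - {?v2}"
        unfolding insert_commute[of ?v1 ?v2] by (intro diff) blast
      also have "\<dots> = ?e2 - f2' ` {v}" by (simp only: image_insert image_empty)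
      also have "\<dots> = f2' ` (?A2 - {v})"
        by (rule inj_on_image_set_diff[OF inj2, symmetric]) (use V(4) in auto)
      also have "?A2 - {v} = e \<inter> V2 - {v}" by auto
      also have "f2' ` \<dots> = g ` \<dots>" by (rule image_cong[OF refl], rule g2'[symmetric]) simp_all
      finally show ?thesis .
    qed
    ultimately have "es = g ` (e \<inter> V1 - {v}) \<union> g ` (e \<inter> V2 - {v}) \<union> (if v \<in> e then {g v} else {})"
      unfolding es_def using g1[OF V(3)] by (simp add: Un_Diff)
    also have "\<dots> = g ` ((e \<inter> V1 - {v}) \<union> (e \<inter> V2 - {v}) \<union> (if v \<in> e then {v} else {}))" by auto
    also have "(e \<inter> V1 - {v}) \<union> (e \<inter> V2 - {v}) \<union> (if v \<in> e then {v} else {}) = e" using eV by auto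
    finally have "edges J = (\<lambda>e. g ` e) ` edges H" unfolding J 1 2 E by auto
    then show ?thesis using inj vJ unfolding iso_hg_def bij_betw_def by auto
  qed
  ultimately show ?thesis unfolding in_H_def by blast
qed

section \<open>Critical subhypergraphs as blocks\<close>

lemma critical_block:
  assumes G: "hypergraph G" and crit: "critical H k" and k: "3 \<le> k" and sub: "subhypergraph H G"
    and low: "low_conn G k"
  shows "is_block G H"
proof -
  note hyp = criticalD(1)[OF crit]
  have HG: "verts H \<subseteq> verts G" "edges H \<subseteq> edges G" using sub by (auto simp: subhypergraph_def)
  have big: "k \<le> card (cut H Z)" if "Z \<subseteq> verts H" "v \<in> Z" "w \<in> verts H" "w \<notin> Z" for Z v w
    using cut_ge[OF crit that(1)] that by blast
  have conn: "connected_hg H"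
    unfolding connected_hg_def
  proof (intro ballI)
    fix v w assume vw: "v \<in> verts H" "w \<in> verts H"
    show "\<exists>vs es. hyperpath H v w vs es"
    proof (cases "v = w")
      case True
      then have "hyperpath H v w [v] []" using vw by (simp add: hyperpath_def)
      then show ?thesis by blast
    next
      case False
      have "1 \<le> card (cut H Z)" if "Z \<subseteq> verts H" "v \<in> Z" "w \<notin> Z" for Z
        using big[OF that(1,2) vw(2) that(3)] k by simp
      then show ?thesis using hyperpaths_of_cuts[OF hyp False vw(1), of 1] by auto
    qed
  qed
  have nosep: "no_sep_vertex H"
    unfolding no_sep_vertex_def
  proof
    assume "\<exists>v. separating_vertex H v"
    then obtain v V1 V2 where V: "V1 \<union> V2 = verts H" "V1 \<inter> V2 = {v}"
      "edges H = edges (induced H V1) \<union> edges (induced H V2)" "1 < card V1" "1 < card V2"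
      by (auto simp: separating_vertex_def separating_set_def)
    obtain x where "x \<in> verts H" using critical_nonempty[OF crit] by blast
    then obtain e where e: "e \<in> edges H" using criticalD(3)[OF crit] by blast
    have f: "f \<subseteq> V1 \<or> f \<subseteq> V2" if "f \<in> edges H" for f
    proof -
      have "f \<in> edges (induced H V1) \<union> edges (induced H V2)" using that V(3) by blast
      then show ?thesis by (auto simp: induced_def)
    qed
    \<comment> \<open>If \<open>v\<close> separates \<open>H\<close>, any edge may serve as the edge
      of a splitting, although it lies inside one of the two sides; this is what
      \<open>sep_edge\<close> forbids.\<close>
    then have "sep H v e V1 V2" using V(1,2,4,5) e unfolding sep_def by auto
    then show False using sep_edge(1,2)[OF crit] f[OF e] by blast
  qed
  have "B = H" if B: "subhypergraph B G" "connected_hg B" "no_sep_vertex B" "verts H \<subseteq> verts B" "edges H \<subseteq> edges B" for B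
  proof (rule ccontr)
    assume ne: "B \<noteq> H"
    have hB: "hypergraph B" and BG: "edges B \<subseteq> edges G" "verts B \<subseteq> verts G" using B(1) by (auto simp: subhypergraph_def)
    obtain a where a: "a \<in> verts H" using critical_nonempty[OF crit] by blast
    have crossing: "\<exists>f\<in>edges B - edges H. f \<inter> verts H \<noteq> {}" if y: "y \<in> verts B" "y \<notin> verts H" for y
    proof -
      obtain vs es where p: "hyperpath B a y vs es" using B(2,4) a y unfolding connected_hg_def by blast
      have vs: "vs \<noteq> []" "vs ! 0 = a" "vs ! (length vs - 1) = y" "length vs = length es + 1"
        using p by (auto simp: hyperpath_def hd_conv_nth last_conv_nth)
      have "\<exists>i<length es. vs ! i \<in> verts H \<and> vs ! Suc i \<notin> verts H"
      proof (rule ccontr)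
        assume none: "\<not> ?thesis"
        have all: "i \<le> length es \<Longrightarrow> vs ! i \<in> verts H" for i
          by (induction i) (use none vs a in auto)
        show False using all[of "length es"] vs y by simp
      qed
      then obtain i where i: "i < length es" "vs ! i \<in> verts H" "vs ! Suc i \<notin> verts H" by blast
      have "es ! i \<in> edges B" "vs ! i \<in> es ! i" "vs ! Suc i \<in> es ! i"
        using p i(1) unfolding hyperpath_def by auto
      moreover from this have "es ! i \<notin> edges H" using hypergraphD(3)[OF hyp] i(3) by blast
      ultimately show ?thesis using i(2) by blast
    qed
    have "\<exists>f\<in>edges B - edges H. f \<inter> verts H \<noteq> {}"
    proof (cases "verts B = verts H")
      case True
      then have "edges B \<noteq> edges H" using ne prod_eqI[of B H] unfolding verts_def edges_def by blast
      then obtain f where "f \<in> edges B - edges H" using B(5) by blast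
      then show ?thesis using hypergraphD(3,6)[OF hB, of f] True by blast
    qed (use crossing B(4) in blast)
    then obtain f0 x where f0: "f0 \<in> edges B" "f0 \<notin> edges H" "x \<in> f0" "x \<in> verts H" by blast
    define R where "R = {(u, w). \<exists>f\<in>edges B - edges H. u \<in> f \<and> w \<in> f}"
    \<comment> \<open>All that is reached from \<open>x\<close> by edges of \<open>B\<close> outside
      \<open>H\<close>. The cut argument shows that \<open>U\<close> meets \<open>H\<close> only in
      \<open>x\<close>, which makes \<open>x\<close> a separating vertex of
      \<open>B\<close>.\<close>
    define U where "U = {u. (x, u) \<in> R\<^sup>*}"
    have RU: "f \<subseteq> U" if f: "f \<in> edges B" "f \<notin> edges H" "f \<inter> U \<noteq> {}" for f
    proof
      fix w assume "w \<in> f"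
      moreover obtain u where "u \<in> f" "u \<in> U" using f(3) by blast
      ultimately have "(u, w) \<in> R" "(x, u) \<in> R\<^sup>*" using f(1,2) by (auto simp: R_def U_def)
      then show "w \<in> U" unfolding U_def by (auto intro: rtrancl_into_rtrancl)
    qed
    have xU: "x \<in> U" by (simp add: U_def)
    have UB: "U \<subseteq> verts B"
    proof
      fix u assume "u \<in> U"
      then have "(x, u) \<in> R\<^sup>*" by (simp add: U_def)
      then show "u \<in> verts B"
        by (induction rule: rtrancl_induct) (use f0 B(4) hypergraphD(3)[OF hB] in \<open>auto simp: R_def\<close>)
    qed
    have UH: "u = x" if u: "u \<in> U" "u \<in> verts H" for u
    proof (rule ccontr)
      assume "u \<noteq> x"
      moreover have "x \<in> verts G" "u \<in> verts G" using f0(4) u(2) HG(1) by auto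
      ultimately obtain Z where Z: "x \<in> Z" "u \<notin> Z" "card (cut G Z) \<le> k"
        using low unfolding low_conn_def by metis
      have "\<exists>f\<in>edges B - edges H. f \<inter> Z \<noteq> {} \<and> \<not> f \<subseteq> Z"
      proof (rule ccontr)
        assume none: "\<not> ?thesis"
        have "(x, u) \<in> R\<^sup>*" using u by (simp add: U_def)
        then have "u \<in> Z" by (induction rule: rtrancl_induct) (use Z none in \<open>auto simp: R_def\<close>)
        then show False using Z by simp
      qed
      then obtain f where f: "f \<in> edges B" "f \<notin> edges H" "f \<in> cut G Z" using BG by (auto simp: cut_def)
      have "cut H (Z \<inter> verts H) = cut H Z" using hypergraphD(3)[OF hyp] by (auto simp: cut_def)
      then have "k \<le> card (cut H Z)" using big[of "Z \<inter> verts H" x u] Z f0 u by auto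
      also have "\<dots> < card (insert f (cut H Z))" using f finite_cut[OF hyp, of Z] by (auto simp: cut_def card_insert_if)
      also have "\<dots> \<le> card (cut G Z)"
        by (rule card_mono[OF finite_cut[OF G]]) (use f HG in \<open>auto simp: cut_def\<close>)
      finally show False using Z by simp
    qed
    let ?W = "(verts B - U) \<union> {x}"
    have fB: "finite (verts B)" using hypergraphD(1)[OF hB] .
    have HW: "verts H \<subseteq> ?W" using UH B(4) by auto
    have "separating_vertex B x"
      unfolding separating_vertex_def separating_set_def
    proof (rule exI[of _ U], rule exI[of _ ?W], intro conjI)
      show "U \<subseteq> verts B" by (rule UB)
      show "?W \<subseteq> verts B" "U \<union> ?W = verts B" "U \<inter> ?W = {x}" using UB xU by auto
      have "f \<subseteq> U \<or> f \<subseteq> ?W" if f: "f \<in> edges B" for f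
      proof (cases "f \<in> edges H")
        case True
        then show ?thesis using subset_trans[OF hypergraphD(3)[OF hyp True] HW] by simp
      next
        case False
        have "f \<subseteq> ?W" if "f \<inter> U = {}" using that hypergraphD(3)[OF hB f] by auto
        then show ?thesis using RU[OF f False] by argo
      qed
      then have "edges B \<subseteq> {f \<in> edges B. f \<subseteq> U} \<union> {f \<in> edges B. f \<subseteq> ?W}"
        by (intro subsetI) simp
      then show "edges B = edges (induced B U) \<union> edges (induced B ?W)"
        unfolding induced_def edges_pair by (intro equalityI) simp_all
      have "f0 \<subseteq> U" using RU f0 xU by blast
      then have "card f0 \<le> card U" using UB fB by (meson card_mono finite_subset)
      then show "card {x} < card U" using hypergraphD(4)[OF hB f0(1)] by simp
      obtain e where e: "e \<in> edges H" using criticalD(3)[OF crit f0(4)] by blast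
      have "card e \<le> card ?W" using hypergraphD(3)[OF hyp e] HW fB by (intro card_mono) auto
      then show "card {x} < card ?W" using hypergraphD(4)[OF hyp e] by simp
    qed
    then show False using B(3) by (auto simp: no_sep_vertex_def)
  qed
  then show ?thesis using sub conn nosep unfolding is_block_def by blast
qed

lemma card_edge_cut: "hypergraph H \<Longrightarrow> cut H {x} = {e \<in> edges H. x \<in> e}"
  using hypergraphD(7)[of H _ x] unfolding cut_def by blast

text \<open>Induction on the number of vertices, because a nontrivial cut leads to a smaller
  hypergraph. The first alternative records that all edges are ordinary since \<open>ends\<close>
  relies on it; membership in the class would not imply it, as Hajos joins create
  hyperedges.\<close>

lemma critical_low_conn_cases:
  fixes H :: "'a hgraph"
  assumes k: "3 \<le> k"
  shows "\<lbrakk>critical H k; low_conn H k\<rbrakk> \<Longrightarrow>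
    ((\<forall>e\<in>edges H. card e = 2) \<and> in_H k H) \<or> (\<exists>v e V1 V2. sep H v e V1 V2)"
proof (induction "card (verts H)" arbitrary: H rule: less_induct)
  case less
  note crit = less.prems(1) and low = less.prems(2)
  note hyp = criticalD(1)[OF crit]
  have IH: "\<forall>G :: 'a hgraph. card (verts G) < card (verts H) \<longrightarrow> critical G k \<longrightarrow> low_conn G k
      \<longrightarrow> (\<forall>e\<in>edges G. card e = 2) \<or> (\<exists>v e V1 V2. sep G v e V1 V2)"
    using less.hyps by blast
  show ?case
  proof (cases "\<exists>X \<subseteq> verts H. 2 \<le> card X \<and> 2 \<le> card (verts H - X) \<and> card (cut H X) \<le> k")
    case True
    then obtain X where X: "X \<subseteq> verts H" "2 \<le> card X" "2 \<le> card (verts H - X)" "card (cut H X) \<le> k" by blast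
    show ?thesis using nontrivial_tight_cut[OF IH k crit low X] by blast
  next
    case False
    \<comment> \<open>A cut of at most \<open>k\<close> edges between \<open>x\<close> and
      \<open>y\<close> has a single vertex on one side, which is \<open>x\<close> or
      \<open>y\<close>. So no two vertices can both have degree above \<open>k\<close>.\<close>
    have small: "card (cut H {x}) \<le> k \<or> card (cut H {y}) \<le> k"
      if xy: "x \<in> verts H" "y \<in> verts H" "x \<noteq> y" for x y
    proof -
      obtain Z where Z: "x \<in> Z" "y \<notin> Z" "card (cut H Z) \<le> k" using low xy unfolding low_conn_def by blast
      let ?Z = "Z \<inter> verts H"
      have cZ: "cut H ?Z = cut H Z" using hypergraphD(3)[OF hyp] by (auto simp: cut_def)
      have fin: "finite ?Z" "finite (verts H - ?Z)" using hypergraphD(1)[OF hyp] by auto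
      have "\<not> 2 \<le> card ?Z \<or> \<not> 2 \<le> card (verts H - ?Z)" using False Z(3) cZ by auto
      then show ?thesis
      proof
        assume "\<not> 2 \<le> card ?Z"
        then have "?Z = {x}" using card_le_Suc0_iff_eq[OF fin(1)] Z(1) xy(1) by auto
        then show ?thesis using cZ Z(3) by simp
      next
        assume "\<not> 2 \<le> card (verts H - ?Z)"
        then have "verts H - ?Z = {y}" using card_le_Suc0_iff_eq[OF fin(2)] Z(2) xy(2) by auto
        then show ?thesis using cut_compl[OF hyp, of ?Z] cZ Z(3) by simp
      qed
    qed
    obtain a where a: "a \<in> verts H" using critical_nonempty[OF crit] by blast
    have "\<exists>h\<in>verts H. \<forall>x\<in>verts H. x \<noteq> h \<longrightarrow> card (cut H {x}) \<le> k" using small a by metis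
    then obtain h where h: "h \<in> verts H" "\<And>x. \<lbrakk>x \<in> verts H; x \<noteq> h\<rbrakk> \<Longrightarrow> deg H x \<le> k"
      unfolding deg_def card_edge_cut[OF hyp] by blast
    show ?thesis
    proof (cases "\<exists>e V1 V2. sep H h e V1 V2")
      case False
      interpret one_big_vertex H k h by unfold_locales (use crit k h False in auto)
      have "in_H k H"
      proof (cases "k = 3")
        case True
        obtain n where "odd n" "3 \<le> n" "iso_hg (odd_wheel n) H" using wheel_iso[OF True] by blast
        moreover have "hypergraph (odd_wheel n)" if "3 \<le> n" for n
          using that by (auto simp: hypergraph_def odd_wheel_def)
        ultimately show ?thesis using iso_hg_sym hajos_class.wheel[OF True] unfolding in_H_def by blast
      next
        case False
        then have "4 \<le> k" using k by simp
        then show ?thesis using complete_iso hajos_class.complete unfolding in_H_def by blast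
      qed
      then show ?thesis using ordinary by blast
    qed blast
  qed
qed

lemma critical_low_conn_in_H:
  fixes H :: "'a hgraph"
  assumes k: "3 \<le> k"
  shows "\<lbrakk>critical H k; low_conn H k\<rbrakk> \<Longrightarrow> in_H k H"
proof (induction "card (verts H)" arbitrary: H rule: less_induct)
  case less
  note crit = less.prems(1) and low = less.prems(2)
  note fin = hypergraphD(1)[OF criticalD(1)[OF crit]]
  show ?case
  proof (cases "\<exists>v e V1 V2. sep H v e V1 V2")
    case True
    then obtain v e V1 V2 where s: "sep H v e V1 V2" by blast
    have "card V1 < card (verts H)" "card V2 < card (verts H)"
      using sepD(6-9)[OF s] fin by (simp_all add: psubset_card_mono psubset_eq)
    then have "in_H k (glue H V1 (insert v (e \<inter> V1)))" "in_H k (glue H V2 (insert v (e \<inter> V2)))"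
      using sep_parts(1)[OF crit k s] sep_parts(1)[OF crit k sep_sym[OF s]]
        sep_low_conn[OF crit k s low] sep_low_conn[OF crit k sep_sym[OF s] low]
      by (auto intro!: less.hyps)
    then show ?thesis by (rule in_H_sep[OF crit k s])
  qed (use critical_low_conn_cases[OF k crit low] in blast)
qed

section \<open>Critical subhypergraphs, the chromatic number and the theorem\<close>

lemma critical_subhypergraph:
  assumes G: "hypergraph G" and n: "\<not> colorable G k" and k: "0 < k"
  obtains H where "subhypergraph H G" "critical H k"
proof -
  let ?P = "\<lambda>E. E \<subseteq> edges G \<and> \<not> colorable (verts G, E) k"
  have "?P (edges G)" using n by (simp add: colorable_def pcol_def)
  from ex_has_least_nat[of ?P "edges G" card, OF this]
  obtain E where "?P E \<and> (\<forall>F. ?P F \<longrightarrow> card E \<le> card F)" by (rule exE)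
  then have E: "?P E" "\<forall>F. ?P F \<longrightarrow> card E \<le> card F" by (rule conjunct1, rule conjunct2)
  have fE: "finite E" using E(1) finite_subset[OF _ hypergraphD(2)[OF G]] by simp
  \<comment> \<open>The edge set is minimised over the full vertex set, and isolated vertices are
    dropped only afterwards. Going back, \<open>extend\<close> gives them the colour 0, which is
    where \<open>0 < k\<close> enters.\<close>
  let ?V = "\<Union>E"
  have VG: "?V \<subseteq> verts G" using E(1) hypergraphD(3)[OF G] by blast
  have extend: "colorable (verts G, F) k" if F: "F \<subseteq> E" "colorable (?V, F) k" for F
  proof -
    obtain \<phi> where \<phi>: "pcol (?V, F) k ?V \<phi>" using F(2) by (auto simp: colorable_def)
    let ?\<psi> = "\<lambda>v. if v \<in> ?V then \<phi> v else 0"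
    have eq: "pcol (?V, F) k ?V ?\<psi>" using \<phi> pcol_cong[of ?V ?\<psi> \<phi>] by simp
    have "pcol (verts G, F) k (verts G) ?\<psi>"
      unfolding pcol_def
    proof (intro conjI ballI impI)
      show "?\<psi> v < k" if "v \<in> verts G" for v using pcolD(1)[OF \<phi>] k by simp
      fix e assume "e \<in> edges (verts G, F)"
      then have "e \<in> F" "e \<subseteq> ?V" using F(1) by auto
      then show "\<not> monochr ?\<psi> e" using pcolD(2)[OF eq, of e] by simp
    qed
    then show ?thesis by (auto simp: colorable_def)
  qed
  have hE: "hypergraph (?V, E)"
    using VG hypergraphD(1,4)[OF G] E(1) finite_subset[OF VG] unfolding hypergraph_def by auto
  have "critical (?V, E) k"
    unfolding critical_def
  proof (intro conjI ballI)
    show "\<not> colorable (?V, E) k" using extend[of E] E(1) by blast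
    fix e assume e: "e \<in> edges (?V, E)"
    have "card (E - {e}) < card E" using card_Diff1_less[OF fE, of e] e by simp
    then have "\<not> ?P (E - {e})" using E(2) by (meson not_le)
    then have "colorable (verts G, E - {e}) k" using E(1) by blast
    then obtain \<phi> where \<phi>: "pcol (verts G, E - {e}) k (verts G) \<phi>" by (auto simp: colorable_def)
    have "pcol (?V, E - {e}) k ?V \<phi>" using \<phi> VG unfolding pcol_def by auto
    then show "colorable (verts (?V, E), edges (?V, E) - {e}) k" by (auto simp: colorable_def)
  qed (use hE in auto)
  moreover have "subhypergraph (?V, E) G" using hE VG E(1) by (simp add: subhypergraph_def)
  ultimately show ?thesis using that by blast
qed

lemma colorable_mono: "colorable G k \<Longrightarrow> k \<le> l \<Longrightarrow> colorable G l"
  unfolding colorable_def pcol_def by (meson order_less_le_trans)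

text \<open>A shift by one between the colour sets \<open>{1..k}\<close> and
  \<open>{..<k}\<close>.\<close>

lemma coloring_iff_colorable:
  assumes G: "hypergraph G"
  shows "(\<exists>\<phi> :: 'a \<Rightarrow> nat. coloring G \<phi> {1..k}) \<longleftrightarrow> colorable (G :: 'a hgraph) k"
proof
  assume "\<exists>\<phi> :: 'a \<Rightarrow> nat. coloring G \<phi> {1..k}"
  then obtain \<phi> :: "'a \<Rightarrow> nat" where \<phi>: "coloring G \<phi> {1..k}" by blast
  have r: "1 \<le> \<phi> v \<and> \<phi> v \<le> k" if "v \<in> verts G" for v using \<phi> that by (auto simp: coloring_def)
  have "pcol G k (verts G) (\<lambda>v. \<phi> v - 1)"
    unfolding pcol_def
  proof (intro conjI ballI impI notI)
    show "\<phi> v - 1 < k" if "v \<in> verts G" for v using r[OF that] by linarith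
    fix e assume e: "e \<in> edges G" "e \<subseteq> verts G" "monochr (\<lambda>v. \<phi> v - 1) e"
    then obtain u w where uw: "u \<in> e" "w \<in> e" "\<phi> u \<noteq> \<phi> w" using \<phi> by (auto simp: coloring_def)
    then have "\<phi> u - 1 = \<phi> w - 1" by (intro monochrD[OF e(3)])
    moreover have "1 \<le> \<phi> u" "1 \<le> \<phi> w" using r[of u] r[of w] uw(1,2) e(2) by auto
    ultimately show False using uw(3) by linarith
  qed
  then show "colorable G k" by (auto simp: colorable_def)
next
  assume "colorable G k"
  then obtain \<phi> where \<phi>: "pcol G k (verts G) \<phi>" by (auto simp: colorable_def)
  have "coloring G (\<lambda>v. Suc (\<phi> v)) {1..k}"
    unfolding coloring_def
  proof (intro conjI ballI)
    show "Suc (\<phi> v) \<in> {1..k}" if "v \<in> verts G" for v using pcolD(1)[OF \<phi> that] by simp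
    fix e assume "e \<in> edges G"
    then have "\<not> monochr \<phi> e" using pcolD(2)[OF \<phi>] hypergraphD(3)[OF G] by blast
    then show "\<exists>u\<in>e. \<exists>w\<in>e. Suc (\<phi> u) \<noteq> Suc (\<phi> w)" by (auto simp: monochr_def)
  qed
  then show "\<exists>\<phi> :: 'a \<Rightarrow> nat. coloring G \<phi> {1..k}" by blast
qed

lemma chi_le_iff:
  assumes G: "hypergraph G"
  shows "chi G \<le> k \<longleftrightarrow> colorable G k"
proof -
  have chi: "chi G = (LEAST k. colorable G k)" unfolding chi_def coloring_iff_colorable[OF G] ..
  \<comment> \<open>For \<open>LEAST\<close> to be attained, some number of colours has to suffice:
    distinct colours for all vertices work because every edge has two vertices.\<close>
  obtain f where f: "bij_betw f (verts G) {0..<card (verts G)}"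
    using ex_bij_betw_finite_nat[OF hypergraphD(1)[OF G]] by blast
  have "pcol G (card (verts G)) (verts G) f"
    unfolding pcol_def
  proof (intro conjI ballI impI notI)
    show "f v < card (verts G)" if "v \<in> verts G" for v using f that by (auto simp: bij_betw_def)
    fix e assume e: "e \<in> edges G" "e \<subseteq> verts G" "monochr f e"
    obtain x where x: "x \<in> e" using hypergraphD(6)[OF G e(1)] by blast
    have "y = x" if "y \<in> e" for y
      using monochrD[OF e(3) that x] inj_onD[OF bij_betw_imp_inj_on[OF f]] e(2) that x by blast
    then show False using hypergraphD(7)[OF G e(1), of x] by blast
  qed
  then have ex: "colorable G (card (verts G))" by (auto simp: colorable_def)
  show ?thesis
  proof
    assume "chi G \<le> k"
    moreover have "colorable G (chi G)" unfolding chi using ex by (rule LeastI)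
    ultimately show "colorable G k" using colorable_mono by blast
  next
    assume "colorable G k"
    then show "chi G \<le> k" unfolding chi by (rule Least_le)
  qed
qed

lemma colorable_subhypergraph:
  assumes "subhypergraph B G" "colorable G k"
  shows "colorable B k"
proof -
  obtain \<phi> where "pcol G k (verts G) \<phi>" using assms(2) by (auto simp: colorable_def)
  then have "pcol B k (verts B) \<phi>" using assms(1) unfolding pcol_def subhypergraph_def by blast
  then show ?thesis by (auto simp: colorable_def)
qed

lemma low_conn_subhypergraph:
  assumes G: "hypergraph G" and sub: "subhypergraph H G" and low: "low_conn G k"
  shows "low_conn H k"
proof -
  have "card (cut H Z) \<le> card (cut G Z)" for Z
    by (rule card_mono[OF finite_cut[OF G]]) (use sub in \<open>auto simp: cut_def subhypergraph_def\<close>)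
  then show ?thesis using low sub unfolding low_conn_def subhypergraph_def by (meson order_trans subsetD)
qed

theorem theorem2:
  fixes G :: "'a hgraph"
  assumes "hypergraph G"
    and "lambda G \<ge> 3"
  shows "chi G \<le> lambda G + 1
     \<and> (chi G = lambda G + 1 \<longleftrightarrow> (\<exists>B. is_block G B \<and> in_H (lambda G) B))"
proof -
  let ?k = "lambda G"
  note G = assms(1) and k = assms(2)
  have low: "low_conn G ?k" by (rule low_conn_lambda[OF G])
  \<comment> \<open>Here \<open>critical\<close> is used with \<open>k + 1\<close> in place of
    \<open>k\<close>, so all cuts have at least \<open>k + 1\<close> edges; the ends of any edge
    then contradict \<open>low_conn\<close>.\<close>
  have upper: "colorable G (?k + 1)"
  proof (rule ccontr)
    assume "\<not> ?thesis"
    then obtain H where H: "subhypergraph H G" "critical H (?k + 1)"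
      using critical_subhypergraph[OF G] by (metis add_gr_0 zero_less_one)
    have lH: "low_conn H ?k" by (rule low_conn_subhypergraph[OF G H(1) low])
    note hyp = criticalD(1)[OF H(2)]
    obtain x where x: "x \<in> verts H" using critical_nonempty[OF H(2)] by blast
    then obtain e where e: "e \<in> edges H" "x \<in> e" using criticalD(3)[OF H(2)] by blast
    obtain y where y: "y \<in> e" "y \<noteq> x" using hypergraphD(7)[OF hyp e(1), of x] by blast
    then have "y \<in> verts H" using hypergraphD(3)[OF hyp e(1)] by blast
    then obtain Z where Z: "x \<in> Z" "y \<notin> Z" "card (cut H Z) \<le> ?k" using lH x y(2) unfolding low_conn_def by metis
    have "cut H (Z \<inter> verts H) = cut H Z" using hypergraphD(3)[OF hyp] by (auto simp: cut_def)
    moreover have "?k + 1 \<le> card (cut H (Z \<inter> verts H))"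
      by (rule cut_ge[OF H(2)]) (use Z x \<open>y \<in> verts H\<close> in auto)
    ultimately show False using Z(3) by simp
  qed
  have "\<not> colorable G ?k \<longleftrightarrow> (\<exists>B. is_block G B \<and> in_H ?k B)"
  proof
    assume "\<not> colorable G ?k"
    moreover have "0 < ?k" using k by simp
    ultimately obtain H where H: "subhypergraph H G" "critical H ?k"
      by (rule critical_subhypergraph[OF G])
    then show "\<exists>B. is_block G B \<and> in_H ?k B"
      using critical_block[OF G H(2) k H(1) low]
        critical_low_conn_in_H[OF k H(2) low_conn_subhypergraph[OF G H(1) low]] by blast
  next
    assume "\<exists>B. is_block G B \<and> in_H ?k B"
    then obtain B where B: "subhypergraph B G" "in_H ?k B" by (auto simp: is_block_def)
    then have "\<not> colorable B ?k" using in_H_not_colorable[of B] by (simp add: subhypergraph_def)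
    then show "\<not> colorable G ?k" using colorable_subhypergraph[OF B(1)] by blast
  qed
  moreover have "chi G = ?k + 1 \<longleftrightarrow> \<not> colorable G ?k"
    using upper unfolding chi_le_iff[OF G, symmetric] by linarith
  ultimately show ?thesis using upper chi_le_iff[OF G] by simp
qed

end
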